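(* Let $A$ be a separable exact $C^*$-algebra and let $\alpha$ be an automorphism of $A$. Let $Q(A)$ be the quasi-state space of $A$ with the weak$^*$ topology and let $T_\alpha:Q(A)\to Q(A)$ be the homeomorphism $T_\alpha(\omega)=\omega\circ\alpha$. If the Voiculescu-Brown entropy $ht(\alpha)$ is zero, then the topological entropy $h_{\mathrm{top}}(T_\alpha)$ is zero.
   Context: The quasi-state space $Q(A)$ is the convex set of positive linear functionals $\phi$ on $A$ with $\|\phi\|\leq 1$, equipped with the weak$^*$ topology, under which it is compact (and metrizable when $A$ is separable). Topological entropy: let $T:X\to X$ be a homeomorphism of a compact metrizable space. For a finite open cover $\mathcal{U}$ of $X$ set $$h_{\mathrm{top}}(T,\mathcal{U})=\lim_{n\to\infty}\frac1n\log N(\mathcal{U}\vee T^{-1}\mathcal{U}\vee\cdots\vee T^{-(n-1)}\mathcal{U}),$$ where $N(\cdot)$ is the smallest cardinality of a subcover and the join $\mathcal{U}_1\vee\cdots\vee\mathcal{U}_m$ is the set of all nonempty intersections $U_1\cap\cdots\cap U_m$ with $U_i\in\mathcal{U}_i$. Then $h_{\mathrm{top}}(T)=\sup_{\mathcal{U}}h_{\mathrm{top}}(T,\mathcal{U})$, the supremum being over all finite open covers. Voiculescu-Brown entropy: let $A$ be an exact $C^*$-algebra and $\pi:A\to\mathcal{B}(\mathcal{H})$ a faithful representation. For a finite set $\Omega\subset A$ and $\delta>0$, let $\mathrm{CPA}(\pi,\Omega,\delta)$ be the collection of triples $(\phi,\psi,B)$ where $B$ is a finite-dimensional $C^*$-algebra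 and $\phi:A\to B$ and $\psi:B\to\mathcal{B}(\mathcal{H})$ are completely positive contractive linear maps such that $\|(\psi\circ\phi)(x)-\pi(x)\|<\delta$ for all $x\in\Omega$. (This collection is nonempty because $A$ is exact.) Let $\mathrm{rcp}(\Omega,\delta)$ be the infimum of $\mathrm{rank}\,B$ over all $(\phi,\psi,B)\in\mathrm{CPA}(\pi,\Omega,\delta)$, where $\mathrm{rank}\,B$ is the dimension of a maximal commutative $C^*$-subalgebra of $B$; this quantity does not depend on the choice of $\pi$. For an automorphism $\alpha$ of $A$ set $$ht(\alpha,\Omega,\delta)=\limsup_{n\to\infty}\frac1n\log\mathrm{rcp}(\Omega\cup\alpha\Omega\cup\cdots\cup\alpha^{n-1}\Omega,\delta),$$ $$ht(\alpha,\Omega)=\sup_{\delta>0}ht(\alpha,\Omega,\delta),\qquad ht(\alpha)=\sup_{\Omega}ht(\alpha,\Omega),$$ the last supremum being over all finite sets $\Omega\subset A$. *)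

theory Defs
  imports "HOL-Analysis.Analysis" "HOL-Library.Function_Algebras"
begin

section \<open>Complex vector spaces and Hilbert spaces\<close>

class complex_vector = ab_group_add +
  fixes scaleC :: "complex \<Rightarrow> 'a \<Rightarrow> 'a"
  assumes scaleC_add_right: "scaleC c (x + y) = scaleC c x + scaleC c y"
    and scaleC_add_left: "scaleC (c + d) x = scaleC c x + scaleC d x"
    and scaleC_scaleC: "scaleC c (scaleC d x) = scaleC (c * d) x"
    and scaleC_one: "scaleC 1 x = x"

global_interpretation complex_vector: vector_space "scaleC :: complex \<Rightarrow> 'a \<Rightarrow> 'a::complex_vector"
  by standard (rule scaleC_add_right scaleC_add_left scaleC_scaleC scaleC_one)+

instantiation complex :: complex_vector
begin
definition "scaleC c (x::complex) = c * x"
instance by standard (simp_all add: scaleC_complex_def algebra_simps)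
end

instantiation "fun" :: (type, complex_vector) complex_vector
begin
definition "scaleC c f = (\<lambda>x. scaleC c (f x))"
instance
  by standard (simp_all add: scaleC_fun_def fun_eq_iff scaleC_add_right scaleC_add_left
      scaleC_scaleC scaleC_one)
end

text \<open>Completeness comes from class \<^class>\<open>banach\<close>; the inner product is linear in its
  first argument.\<close>

class chilbert_space = banach + complex_vector +
  fixes cinner :: "'a \<Rightarrow> 'a \<Rightarrow> complex"
  assumes scaleR_eq_scaleC: "scaleR r x = scaleC (complex_of_real r) x"
    and cinner_commute: "cinner x y = cnj (cinner y x)"
    and cinner_add_left: "cinner (x + y) z = cinner x z + cinner y z"
    and cinner_scaleC_left: "cinner (scaleC c x) y = c * cinner x y"
    and cinner_ge_zero: "0 \<le> Re (cinner x x)"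
    and norm_eq_sqrt_cinner: "norm x = sqrt (Re (cinner x x))"


section \<open>C*-algebras\<close>

text \<open>The carrier is a complex linear subspace of the ambient type \<^typ>\<open>'a::complex_vector\<close>, from
  which addition and scalar multiplication are inherited. Algebras are not assumed to be unital.
  The norm is split off so that matrix algebras over a C*-algebra can be treated as plain
  *-algebras.\<close>

record 'a star_alg =
  carr :: "'a set"
  times_alg :: "'a \<Rightarrow> 'a \<Rightarrow> 'a"  (infixl \<open>\<cdot>\<index>\<close> 70)
  adj :: "'a \<Rightarrow> 'a"

record 'a cstar = "'a star_alg" +
  cnorm :: "'a \<Rightarrow> real"

locale cstar_algebra =
  fixes A :: "'a::complex_vector cstar" (structure)
  assumes subspace: "complex_vector.subspace (carr A)"
    and times_closed: "\<lbrakk>x \<in> carr A; y \<in> carr A\<rbrakk> \<Longrightarrow> x \<cdot> y \<in> carr A"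
    and times_assoc: "\<lbrakk>x \<in> carr A; y \<in> carr A; z \<in> carr A\<rbrakk> \<Longrightarrow> (x \<cdot> y) \<cdot> z = x \<cdot> (y \<cdot> z)"
    and times_add_left: "\<lbrakk>x \<in> carr A; y \<in> carr A; z \<in> carr A\<rbrakk> \<Longrightarrow> (x + y) \<cdot> z = x \<cdot> z + y \<cdot> z"
    and times_add_right: "\<lbrakk>x \<in> carr A; y \<in> carr A; z \<in> carr A\<rbrakk> \<Longrightarrow> x \<cdot> (y + z) = x \<cdot> y + x \<cdot> z"
    and times_scale_left: "\<lbrakk>x \<in> carr A; y \<in> carr A\<rbrakk> \<Longrightarrow> scaleC c x \<cdot> y = scaleC c (x \<cdot> y)"
    and times_scale_right: "\<lbrakk>x \<in> carr A; y \<in> carr A\<rbrakk> \<Longrightarrow> x \<cdot> scaleC c y = scaleC c (x \<cdot> y)"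
    and adj_closed: "x \<in> carr A \<Longrightarrow> adj A x \<in> carr A"
    and adj_adj: "x \<in> carr A \<Longrightarrow> adj A (adj A x) = x"
    and adj_add: "\<lbrakk>x \<in> carr A; y \<in> carr A\<rbrakk> \<Longrightarrow> adj A (x + y) = adj A x + adj A y"
    and adj_scale: "x \<in> carr A \<Longrightarrow> adj A (scaleC c x) = scaleC (cnj c) (adj A x)"
    and adj_times: "\<lbrakk>x \<in> carr A; y \<in> carr A\<rbrakk> \<Longrightarrow> adj A (x \<cdot> y) = adj A y \<cdot> adj A x"
    and norm_ge_zero: "x \<in> carr A \<Longrightarrow> 0 \<le> cnorm A x"
    and norm_eq_zero: "x \<in> carr A \<Longrightarrow> cnorm A x = 0 \<longleftrightarrow> x = 0"
    and norm_triangle: "\<lbrakk>x \<in> carr A; y \<in> carr A\<rbrakk> \<Longrightarrow> cnorm A (x + y) \<le> cnorm A x + cnorm A y"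
    and norm_scale: "x \<in> carr A \<Longrightarrow> cnorm A (scaleC c x) = cmod c * cnorm A x"
    and norm_times: "\<lbrakk>x \<in> carr A; y \<in> carr A\<rbrakk> \<Longrightarrow> cnorm A (x \<cdot> y) \<le> cnorm A x * cnorm A y"
    and cstar_identity: "x \<in> carr A \<Longrightarrow> cnorm A (adj A x \<cdot> x) = (cnorm A x)\<^sup>2"
    and complete: "\<lbrakk>\<And>n. s n \<in> carr A; \<And>e. e > 0 \<Longrightarrow> \<exists>N. \<forall>m\<ge>N. \<forall>n\<ge>N. cnorm A (s m - s n) < e\<rbrakk>
        \<Longrightarrow> \<exists>l\<in>carr A. (\<lambda>n::nat. cnorm A (s n - l)) \<longlonglongrightarrow> 0"

definition separable_cstar :: "'a::complex_vector cstar \<Rightarrow> bool" where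
  "separable_cstar A \<longleftrightarrow>
     (\<exists>D. countable D \<and> D \<subseteq> carr A \<and> (\<forall>x\<in>carr A. \<forall>e>0. \<exists>d\<in>D. cnorm A (x - d) < e))"

definition linear_map :: "('a::complex_vector, 'c) star_alg_scheme \<Rightarrow>
    ('b::complex_vector, 'd) star_alg_scheme \<Rightarrow> ('a \<Rightarrow> 'b) \<Rightarrow> bool" where
  "linear_map A B f \<longleftrightarrow> f ` carr A \<subseteq> carr B
     \<and> (\<forall>x\<in>carr A. \<forall>y\<in>carr A. f (x + y) = f x + f y)
     \<and> (\<forall>c. \<forall>x\<in>carr A. f (scaleC c x) = scaleC c (f x))"

definition star_hom :: "('a::complex_vector, 'c) star_alg_scheme \<Rightarrow>
    ('b::complex_vector, 'd) star_alg_scheme \<Rightarrow> ('a \<Rightarrow> 'b) \<Rightarrow> bool" where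
  "star_hom A B f \<longleftrightarrow> linear_map A B f
     \<and> (\<forall>x\<in>carr A. \<forall>y\<in>carr A. f (x \<cdot>\<^bsub>A\<^esub> y) = f x \<cdot>\<^bsub>B\<^esub> f y)
     \<and> (\<forall>x\<in>carr A. f (adj A x) = adj B (f x))"

definition cstar_automorphism :: "'a::complex_vector cstar \<Rightarrow> ('a \<Rightarrow> 'a) \<Rightarrow> bool" where
  "cstar_automorphism A \<alpha> \<longleftrightarrow> star_hom A A \<alpha> \<and> bij_betw \<alpha> (carr A) (carr A)"

definition positive_elements :: "('a, 'c) star_alg_scheme \<Rightarrow> 'a set" where
  "positive_elements A = {adj A y \<cdot>\<^bsub>A\<^esub> y | y. y \<in> carr A}"


section \<open>Bounded operators and representations\<close>

definition hilbert_adjoint :: "('h::chilbert_space \<Rightarrow> 'h) \<Rightarrow> 'h \<Rightarrow> 'h" where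
  "hilbert_adjoint f = (SOME g. \<forall>x y. cinner (f x) y = cinner x (g y))"

definition bounded_operators :: "('h::chilbert_space \<Rightarrow> 'h) cstar" where
  "bounded_operators =
     \<lparr>carr = {f. bounded_linear f \<and> (\<forall>c x. f (scaleC c x) = scaleC c (f x))},
      times_alg = (\<circ>), adj = hilbert_adjoint, cnorm = onorm\<rparr>"

definition faithful_rep :: "'a::complex_vector cstar \<Rightarrow> ('a \<Rightarrow> 'h \<Rightarrow> 'h::chilbert_space) \<Rightarrow> bool" where
  "faithful_rep A \<pi> \<longleftrightarrow> star_hom A bounded_operators \<pi> \<and> inj_on \<pi> (carr A)"


section \<open>Completely positive maps\<close>

text \<open>The *-algebra of n by n matrices over \<open>A\<close>; entries with an index outside
  \<open>{..<n}\<close> are 0.\<close>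

definition matrix_alg :: "nat \<Rightarrow> ('a::complex_vector, 'c) star_alg_scheme \<Rightarrow>
    (nat \<Rightarrow> nat \<Rightarrow> 'a) star_alg" where
  "matrix_alg n A =
     \<lparr>carr = {M. \<forall>i j. if i < n \<and> j < n then M i j \<in> carr A else M i j = 0},
      times_alg = (\<lambda>M N i j. if i < n \<and> j < n then \<Sum>k<n. M i k \<cdot>\<^bsub>A\<^esub> N k j else 0),
      adj = (\<lambda>M i j. if i < n \<and> j < n then adj A (M j i) else 0)\<rparr>"

definition completely_positive :: "('a::complex_vector, 'c) star_alg_scheme \<Rightarrow>
    ('b::complex_vector, 'd) star_alg_scheme \<Rightarrow> ('a \<Rightarrow> 'b) \<Rightarrow> bool" where
  "completely_positive A B f \<longleftrightarrow> linear_map A B f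
     \<and> (\<forall>n. \<forall>M\<in>positive_elements (matrix_alg n A).
            (\<lambda>i j. f (M i j)) \<in> positive_elements (matrix_alg n B))"

definition cpc_map :: "'a::complex_vector cstar \<Rightarrow> 'b::complex_vector cstar \<Rightarrow> ('a \<Rightarrow> 'b) \<Rightarrow> bool" where
  "cpc_map A B f \<longleftrightarrow>
     completely_positive A B f \<and> (\<forall>x\<in>carr A. cnorm B (f x) \<le> cnorm A x)"


section \<open>Finite-dimensional C*-algebras and their rank\<close>

definition finite_dim_cstar :: "'b::complex_vector cstar \<Rightarrow> bool" where
  "finite_dim_cstar B \<longleftrightarrow>
     cstar_algebra B \<and> (\<exists>S. finite S \<and> carr B \<subseteq> complex_vector.span S)"

definition cstar_subalgebra :: "'b::complex_vector set \<Rightarrow> 'b cstar \<Rightarrow> bool" where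
  "cstar_subalgebra C B \<longleftrightarrow> C \<subseteq> carr B \<and> cstar_algebra (B\<lparr>carr := C\<rparr>)"

definition commutative_subalgebra :: "'b::complex_vector set \<Rightarrow> 'b cstar \<Rightarrow> bool" where
  "commutative_subalgebra C B \<longleftrightarrow>
     cstar_subalgebra C B \<and> (\<forall>x\<in>C. \<forall>y\<in>C. x \<cdot>\<^bsub>B\<^esub> y = y \<cdot>\<^bsub>B\<^esub> x)"

definition maximal_commutative :: "'b::complex_vector set \<Rightarrow> 'b cstar \<Rightarrow> bool" where
  "maximal_commutative C B \<longleftrightarrow> commutative_subalgebra C B
     \<and> (\<forall>D. commutative_subalgebra D B \<and> C \<subseteq> D \<longrightarrow> D = C)"

text \<open>In a finite-dimensional C*-algebra all maximal commutative C*-subalgebras have the same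
  dimension, so the choice is immaterial.\<close>

definition rank_cstar :: "'b::complex_vector cstar \<Rightarrow> nat" where
  "rank_cstar B = complex_vector.dim (SOME C. maximal_commutative C B)"


section \<open>Exactness and Voiculescu-Brown entropy\<close>

text \<open>Every finite-dimensional complex vector space is isomorphic to a subspace of
  \<^typ>\<open>nat \<Rightarrow> complex\<close>, so restricting \<open>B\<close> to this ambient type captures all
  finite-dimensional C*-algebras up to isomorphism.\<close>

definition CPA :: "'a::complex_vector cstar \<Rightarrow> ('a \<Rightarrow> 'h \<Rightarrow> 'h::chilbert_space) \<Rightarrow> 'a set \<Rightarrow> real \<Rightarrow>
    (('a \<Rightarrow> nat \<Rightarrow> complex) \<times> ((nat \<Rightarrow> complex) \<Rightarrow> 'h \<Rightarrow> 'h) \<times> (nat \<Rightarrow> complex) cstar) set" where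
  "CPA A \<pi> \<Omega> \<delta> = {(\<phi>, \<psi>, B).
     finite_dim_cstar B \<and> cpc_map A B \<phi> \<and> cpc_map B bounded_operators \<psi>
     \<and> (\<forall>x\<in>\<Omega>. cnorm bounded_operators ((\<psi> \<circ> \<phi>) x - \<pi> x) < \<delta>)}"

text \<open>Exactness in the sense of nuclear embeddability: some faithful representation is a nuclear
  map. The Hilbert space on which it acts ranges over types, hence the type argument.\<close>

definition exact_cstar :: "'k::chilbert_space itself \<Rightarrow> 'a::complex_vector cstar \<Rightarrow> bool" where
  "exact_cstar _ A \<longleftrightarrow> (\<exists>\<rho> :: 'a \<Rightarrow> 'k \<Rightarrow> 'k. faithful_rep A \<rho>
     \<and> (\<forall>\<Omega> \<delta>. finite \<Omega> \<and> \<Omega> \<subseteq> carr A \<and> \<delta> > 0 \<longrightarrow> CPA A \<rho> \<Omega> \<delta> \<noteq> {}))"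

text \<open>The infimum over the empty set is \<open>\<infinity>\<close>.\<close>

definition rcp :: "'a::complex_vector cstar \<Rightarrow> ('a \<Rightarrow> 'h \<Rightarrow> 'h::chilbert_space) \<Rightarrow> 'a set \<Rightarrow> real \<Rightarrow> enat" where
  "rcp A \<pi> \<Omega> \<delta> = (INF (\<phi>, \<psi>, B) \<in> CPA A \<pi> \<Omega> \<delta>. enat (rank_cstar B))"

text \<open>The value at 0 is 0 because \<^term>\<open>ln (0::real) = 0\<close>. It arises only when \<open>B = {0}\<close> is an
  admissible approximant; for a nonzero algebra the suprema below are not affected.\<close>

definition log_enat :: "enat \<Rightarrow> ereal" where
  "log_enat k = (case k of enat m \<Rightarrow> ereal (ln (real m)) | \<infinity> \<Rightarrow> \<infinity>)"

definition ht_local :: "'a::complex_vector cstar \<Rightarrow> ('a \<Rightarrow> 'h \<Rightarrow> 'h::chilbert_space) \<Rightarrow> ('a \<Rightarrow> 'a) \<Rightarrow>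
    'a set \<Rightarrow> real \<Rightarrow> ereal" where
  "ht_local A \<pi> \<alpha> \<Omega> \<delta> =
     limsup (\<lambda>n. log_enat (rcp A \<pi> (\<Union>i<n. (\<alpha> ^^ i) ` \<Omega>) \<delta>) / ereal (real n))"

definition ht :: "'a::complex_vector cstar \<Rightarrow> ('a \<Rightarrow> 'h \<Rightarrow> 'h::chilbert_space) \<Rightarrow> ('a \<Rightarrow> 'a) \<Rightarrow> ereal" where
  "ht A \<pi> \<alpha> = (SUP \<Omega>\<in>{\<Omega>. finite \<Omega> \<and> \<Omega> \<subseteq> carr A}. SUP \<delta>\<in>{0<..}. ht_local A \<pi> \<alpha> \<Omega> \<delta>)"


section \<open>The quasi-state space\<close>

text \<open>Functionals on \<open>A\<close> are represented by functions that are \<^const>\<open>undefined\<close> outside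
  the carrier, in accordance with \<^const>\<open>product_topology\<close>.\<close>

definition quasi_states :: "'a::complex_vector cstar \<Rightarrow> ('a \<Rightarrow> complex) set" where
  "quasi_states A = {\<phi> \<in> extensional (carr A).
     (\<forall>x\<in>carr A. \<forall>y\<in>carr A. \<phi> (x + y) = \<phi> x + \<phi> y)
     \<and> (\<forall>c. \<forall>x\<in>carr A. \<phi> (scaleC c x) = c * \<phi> x)
     \<and> (\<forall>x\<in>positive_elements A. \<phi> x \<in> \<real>\<^sub>\<ge>\<^sub>0)
     \<and> (\<forall>x\<in>carr A. cmod (\<phi> x) \<le> cnorm A x)}"

definition quasi_state_space :: "'a::complex_vector cstar \<Rightarrow> ('a \<Rightarrow> complex) topology" where
  "quasi_state_space A =
     subtopology (product_topology (\<lambda>_. euclidean) (carr A)) (quasi_states A)"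

definition induced_map :: "'a::complex_vector cstar \<Rightarrow> ('a \<Rightarrow> 'a) \<Rightarrow> ('a \<Rightarrow> complex) \<Rightarrow> 'a \<Rightarrow> complex" where
  "induced_map A \<alpha> \<omega> = restrict (\<omega> \<circ> \<alpha>) (carr A)"


section \<open>Topological entropy\<close>

definition finite_open_cover :: "'x topology \<Rightarrow> 'x set set \<Rightarrow> bool" where
  "finite_open_cover X U \<longleftrightarrow> finite U \<and> (\<forall>u\<in>U. openin X u) \<and> \<Union>U = topspace X"

definition pullback_cover :: "'x topology \<Rightarrow> ('x \<Rightarrow> 'x) \<Rightarrow> 'x set set \<Rightarrow> 'x set set" where
  "pullback_cover X f U = (\<lambda>u. {x \<in> topspace X. f x \<in> u}) ` U"

definition cover_join :: "nat \<Rightarrow> (nat \<Rightarrow> 'x set set) \<Rightarrow> 'x set set" where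
  "cover_join n U = {\<Inter>i<n. u i | u. \<forall>i<n. u i \<in> U i} - {{}}"

definition min_subcover :: "'x topology \<Rightarrow> 'x set set \<Rightarrow> nat" where
  "min_subcover X U = (LEAST k. \<exists>W\<subseteq>U. finite W \<and> \<Union>W = topspace X \<and> card W = k)"

definition htop_cover :: "'x topology \<Rightarrow> ('x \<Rightarrow> 'x) \<Rightarrow> 'x set set \<Rightarrow> real" where
  "htop_cover X T U =
     lim (\<lambda>n. ln (real (min_subcover X (cover_join n (\<lambda>i. pullback_cover X (T ^^ i) U)))) / real n)"

definition htop :: "'x topology \<Rightarrow> ('x \<Rightarrow> 'x) \<Rightarrow> ereal" where
  "htop X T = (SUP U\<in>{U. finite_open_cover X U}. ereal (htop_cover X T U))"

end

theory Submission
  imports Defs "HOL-Computational_Algebra.Fundamental_Theorem_Algebra"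
begin

text \<open>
  A finite open cover of the quasi-state space is refined by the sets of quasi-states that agree up to
  some \<open>\<epsilon>\<close> on a finite set of elements (\<open>quasi_state_Lebesgue_number\<close>).  Hence the n-step complexity of
  \<open>T\<^sub>\<alpha>\<close> is bounded by the number of cells needed to sort the vectors \<open>(Re \<omega> (y j))\<close> for \<open>j < m\<close> up to \<open>\<epsilon>\<close>, where
  the \<open>y j\<close> run through the first n iterates of a finite set and m is proportional to n.  If the
  Voiculescu-Brown entropy vanishes, then these iterates factor approximately through a
  finite-dimensional B with \<open>log (rank B) = o(n)\<close>, and \<open>approximation_dual_bound\<close> says that for the present
  purpose a quasi-state of A is as good as a bounded functional on B.  It remains to see that functionals
  on B, seen through m vectors \<open>x j\<close> of bounded norm, fall into \<open>exp (o(m))\<close> cells.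

  This is done by predicting the values \<open>Re \<omega> (x j)\<close> one after the other.  A learner keeps a vector Y in
  B, predicts the next value by the slope of the square of a norm at Y in the direction of \<open>x j\<close>, and
  moves Y by a small multiple of \<open>x j\<close> or \<open>- x j\<close> when the prediction was wrong by more than \<open>\<epsilon>\<close>.  For a norm with
  \<open>N (Y + x)\<^sup>2 + N (Y - x)\<^sup>2 \<le> 2 (N Y\<^sup>2 + L N x\<^sup>2)\<close> a potential argument (\<open>few_corrections\<close>) bounds the number
  of wrong predictions by a constant times \<open>L / \<epsilon>\<^sup>2\<close>.  The Schatten norm with exponent of order \<open>log (rank B)\<close>
  is equivalent to the C*-norm up to a factor 2 and has such an L of the order of its exponent
  (\<open>two_smooth_renorming\<close>).  So a quasi-state makes the learner err only \<open>K = O(log (rank B)) = o(n)\<close> times.  All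
  predictions are determined by the positions of the errors together with labels from a fixed finite set,
  and there are only \<open>exp (o(n))\<close> such patterns (\<open>card_sparse_functions_le\<close>).

  The operator algebra behind this is elementary.  The iteration \<open>r \<mapsto> (w + r\<^sup>2) / 2\<close> replaces
  functional calculus and yields that *-homomorphisms are contractive and that faithful representations are
  bounded below.  The trace on B is the sum of diagonal entries with respect to the minimal projections of a
  maximal commutative subalgebra; Hoelder's inequality and smoothness for Schatten norms whose exponent is a
  power of two follow from it by doubling the exponent.
\<close>

section \<open>Arithmetic and limits in a C*-algebra\<close>

context cstar_algebra
begin

lemma zero_closed [simp]: "0 \<in> carr A"
  by (rule complex_vector.subspace_0[OF subspace])

lemma add_closed [simp]: "x \<in> carr A \<Longrightarrow> y \<in> carr A \<Longrightarrow> x + y \<in> carr A"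
  by (rule complex_vector.subspace_add[OF subspace])

lemma diff_closed [simp]: "x \<in> carr A \<Longrightarrow> y \<in> carr A \<Longrightarrow> x - y \<in> carr A"
  by (rule complex_vector.subspace_diff[OF subspace])

lemma uminus_closed [simp]: "x \<in> carr A \<Longrightarrow> - x \<in> carr A"
  by (rule complex_vector.subspace_neg[OF subspace])

lemma scale_closed [simp]: "x \<in> carr A \<Longrightarrow> scaleC c x \<in> carr A"
  by (rule complex_vector.subspace_scale[OF subspace])

lemma sum_closed: "(\<And>i. i \<in> I \<Longrightarrow> f i \<in> carr A) \<Longrightarrow> sum f I \<in> carr A"
  by (rule complex_vector.subspace_sum[OF subspace])

declare times_closed [simp] adj_closed [simp] adj_adj [simp]

lemma times_zero_left [simp]: "x \<in> carr A \<Longrightarrow> 0 \<cdot> x = 0"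
  using times_add_left[of 0 0 x] by simp

lemma times_zero_right [simp]: "x \<in> carr A \<Longrightarrow> x \<cdot> 0 = 0"
  using times_add_right[of x 0 0] by simp

lemma times_minus_left: "x \<in> carr A \<Longrightarrow> y \<in> carr A \<Longrightarrow> (- x) \<cdot> y = - (x \<cdot> y)"
  using times_add_left[of x "- x" y] by (simp add: eq_neg_iff_add_eq_0 add.commute)

lemma times_minus_right: "x \<in> carr A \<Longrightarrow> y \<in> carr A \<Longrightarrow> x \<cdot> (- y) = - (x \<cdot> y)"
  using times_add_right[of x y "- y"] by (simp add: eq_neg_iff_add_eq_0 add.commute)

lemma times_diff_left:
  "x \<in> carr A \<Longrightarrow> y \<in> carr A \<Longrightarrow> z \<in> carr A \<Longrightarrow> (x - y) \<cdot> z = x \<cdot> z - y \<cdot> z"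
  using times_add_left[of x "- y" z] by (simp add: times_minus_left)

lemma times_diff_right:
  "x \<in> carr A \<Longrightarrow> y \<in> carr A \<Longrightarrow> z \<in> carr A \<Longrightarrow> z \<cdot> (x - y) = z \<cdot> x - z \<cdot> y"
  using times_add_right[of z x "- y"] by (simp add: times_minus_right)

lemma times_sum_left:
  "(\<And>i. i \<in> I \<Longrightarrow> f i \<in> carr A) \<Longrightarrow> x \<in> carr A \<Longrightarrow> sum f I \<cdot> x = (\<Sum>i\<in>I. f i \<cdot> x)"
  by (induction I rule: infinite_finite_induct) (auto simp: times_add_left sum_closed)

lemma times_sum_right:
  "(\<And>i. i \<in> I \<Longrightarrow> f i \<in> carr A) \<Longrightarrow> x \<in> carr A \<Longrightarrow> x \<cdot> sum f I = (\<Sum>i\<in>I. x \<cdot> f i)"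
  by (induction I rule: infinite_finite_induct) (auto simp: times_add_right sum_closed)

lemma adj_zero [simp]: "adj A 0 = 0"
  using adj_add[of 0 0] by simp

lemma adj_minus: "x \<in> carr A \<Longrightarrow> adj A (- x) = - adj A x"
  using adj_add[of x "- x"] by (simp add: eq_neg_iff_add_eq_0 add.commute)

lemma adj_diff: "x \<in> carr A \<Longrightarrow> y \<in> carr A \<Longrightarrow> adj A (x - y) = adj A x - adj A y"
  using adj_add[of x "- y"] by (simp add: adj_minus)

lemma adj_sum: "(\<And>i. i \<in> I \<Longrightarrow> f i \<in> carr A) \<Longrightarrow> adj A (sum f I) = (\<Sum>i\<in>I. adj A (f i))"
  by (induction I rule: infinite_finite_induct) (auto simp: adj_add sum_closed)

lemmas alg_simps = times_assoc times_add_left times_add_right times_minus_left times_minus_right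
  times_diff_left times_diff_right times_scale_left times_scale_right
  adj_add adj_diff adj_minus adj_times adj_scale

lemma norm_zero [simp]: "cnorm A 0 = 0"
  by (simp add: norm_eq_zero)

lemma norm_minus: "x \<in> carr A \<Longrightarrow> cnorm A (- x) = cnorm A x"
  using norm_scale[of x "-1"] by simp

lemma norm_diff_triangle: "x \<in> carr A \<Longrightarrow> y \<in> carr A \<Longrightarrow> cnorm A (x - y) \<le> cnorm A x + cnorm A y"
  using norm_triangle[of x "- y"] by (simp add: norm_minus)

lemma norm_diff_commute: "x \<in> carr A \<Longrightarrow> y \<in> carr A \<Longrightarrow> cnorm A (x - y) = cnorm A (y - x)"
  using norm_minus[of "x - y"] by simp

lemma norm_sum: "(\<And>i. i \<in> I \<Longrightarrow> f i \<in> carr A) \<Longrightarrow> cnorm A (sum f I) \<le> (\<Sum>i\<in>I. cnorm A (f i))"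
proof (induction I rule: infinite_finite_induct)
  case (insert i I)
  then show ?case using norm_triangle[of "f i" "sum f I"] by (auto simp: sum_closed)
qed auto

lemma norm_adj: assumes "x \<in> carr A" shows "cnorm A (adj A x) = cnorm A x"
proof -
  have *: "cnorm A y \<le> cnorm A (adj A y)" if y: "y \<in> carr A" for y
  proof (cases "cnorm A y = 0")
    case False
    have "cnorm A y * cnorm A y \<le> cnorm A (adj A y) * cnorm A y"
      using cstar_identity[OF y] norm_times[of "adj A y" y] y by (simp add: power2_eq_square)
    moreover have "0 < cnorm A y" using False norm_ge_zero[OF y] by simp
    ultimately show ?thesis by simp
  qed (use y in \<open>simp add: norm_ge_zero\<close>)
  from *[of x] *[of "adj A x"] assms show ?thesis by simp
qed

lemma norm_selfadjoint_square:
  "x \<in> carr A \<Longrightarrow> adj A x = x \<Longrightarrow> cnorm A (x \<cdot> x) = (cnorm A x)\<^sup>2"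
  using cstar_identity[of x] by simp

lemma norm_pos: "x \<in> carr A \<Longrightarrow> x \<noteq> 0 \<Longrightarrow> 0 < cnorm A x"
  using norm_ge_zero[of x] norm_eq_zero[of x] by linarith

lemma adj_times_self_eq_0: "x \<in> carr A \<Longrightarrow> adj A x \<cdot> x = 0 \<Longrightarrow> x = 0"
  using cstar_identity[of x] by (simp add: norm_eq_zero)

abbreviation tends :: "(nat \<Rightarrow> 'a) \<Rightarrow> 'a \<Rightarrow> bool" where
  "tends s l \<equiv> (\<lambda>n. cnorm A (s n - l)) \<longlonglongrightarrow> 0"

lemma tends_unique:
  assumes "tends s k" "tends s l" "\<And>n. s n \<in> carr A" "k \<in> carr A" "l \<in> carr A"
  shows "k = l"
proof -
  have "(\<lambda>n. cnorm A (s n - k) + cnorm A (s n - l)) \<longlonglongrightarrow> 0 + 0"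
    by (intro tendsto_add assms)
  moreover have "cnorm A (k - l) \<le> cnorm A (s n - k) + cnorm A (s n - l)" for n
    using norm_diff_triangle[of "s n - l" "s n - k"] assms by (simp add: algebra_simps)
  ultimately have "cnorm A (k - l) \<le> 0"
    by (intro LIMSEQ_le_const[of _ 0]) auto
  then show ?thesis using norm_ge_zero[of "k - l"] norm_eq_zero[of "k - l"] assms by simp
qed

lemma tends_Suc: "tends s l \<Longrightarrow> tends (\<lambda>n. s (Suc n)) l"
  by (rule LIMSEQ_Suc)

lemma tends_squeeze:
  assumes "f \<longlonglongrightarrow> 0" "\<And>n. cnorm A (s n - l) \<le> f n" "\<And>n. s n \<in> carr A" "l \<in> carr A"
  shows "tends s l"
  by (rule tendsto_sandwich[OF _ _ tendsto_const assms(1)]) (use assms in \<open>auto simp: norm_ge_zero\<close>)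

lemma tends_add:
  assumes "tends s k" "tends t l" "\<And>n. s n \<in> carr A" "\<And>n. t n \<in> carr A" "k \<in> carr A" "l \<in> carr A"
  shows "tends (\<lambda>n. s n + t n) (k + l)"
proof (rule tends_squeeze)
  show "(\<lambda>n. cnorm A (s n - k) + cnorm A (t n - l)) \<longlonglongrightarrow> 0"
    using tendsto_add[OF assms(1,2)] by simp
  show "cnorm A (s n + t n - (k + l)) \<le> cnorm A (s n - k) + cnorm A (t n - l)" for n
    using norm_triangle[of "s n - k" "t n - l"] assms by (simp add: algebra_simps)
qed (use assms in auto)

lemma tends_scale:
  assumes "tends s k" "\<And>n. s n \<in> carr A" "k \<in> carr A"
  shows "tends (\<lambda>n. scaleC c (s n)) (scaleC c k)"
  using tendsto_mult_left[OF assms(1), of "cmod c"] assms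
  by (simp add: norm_scale flip: complex_vector.scale_right_diff_distrib)

lemma tends_adj:
  assumes "tends s k" "\<And>n. s n \<in> carr A" "k \<in> carr A"
  shows "tends (\<lambda>n. adj A (s n)) (adj A k)"
  using assms by (simp add: norm_adj flip: adj_diff)

lemma tends_times_left:
  assumes "tends s k" "\<And>n. s n \<in> carr A" "k \<in> carr A" "x \<in> carr A"
  shows "tends (\<lambda>n. x \<cdot> s n) (x \<cdot> k)"
proof (rule tends_squeeze)
  show "(\<lambda>n. cnorm A x * cnorm A (s n - k)) \<longlonglongrightarrow> 0"
    using tendsto_mult_left[OF assms(1), of "cnorm A x"] by simp
  show "cnorm A (x \<cdot> s n - x \<cdot> k) \<le> cnorm A x * cnorm A (s n - k)" for n
    using norm_times[of x "s n - k"] assms by (simp add: times_diff_right)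
qed (use assms in auto)

lemma tends_times_right:
  assumes "tends s k" "\<And>n. s n \<in> carr A" "k \<in> carr A" "x \<in> carr A"
  shows "tends (\<lambda>n. s n \<cdot> x) (k \<cdot> x)"
proof (rule tends_squeeze)
  show "(\<lambda>n. cnorm A (s n - k) * cnorm A x) \<longlonglongrightarrow> 0"
    using tendsto_mult_right[OF assms(1), of "cnorm A x"] by simp
  show "cnorm A (s n \<cdot> x - k \<cdot> x) \<le> cnorm A (s n - k) * cnorm A x" for n
    using norm_times[of "s n - k" x] assms by (simp add: times_diff_left)
qed (use assms in auto)

lemma tends_norm_le:
  assumes "tends s k" "\<And>n. s n \<in> carr A" "k \<in> carr A" "\<And>n. cnorm A (s n) \<le> c"
  shows "cnorm A k \<le> c"
proof -
  have "(\<lambda>n. cnorm A (s n - k) + c) \<longlonglongrightarrow> c"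
    using tendsto_add[OF assms(1) tendsto_const[of c]] by simp
  moreover have "cnorm A k \<le> cnorm A (s n - k) + c" for n
    using norm_diff_triangle[of "s n" "s n - k"] assms(2)[of n] assms(3) assms(4)[of n] by simp
  ultimately show ?thesis
    by (intro LIMSEQ_le_const[of _ c]) auto
qed

lemma norm_square_diff:
  assumes "x \<in> carr A" "y \<in> carr A"
  shows "cnorm A (x \<cdot> x - y \<cdot> y) \<le> (cnorm A x + cnorm A y) * cnorm A (x - y)"
proof -
  have "x \<cdot> x - y \<cdot> y = x \<cdot> (x - y) + (x - y) \<cdot> y"
    using assms by (simp add: alg_simps)
  then have "cnorm A (x \<cdot> x - y \<cdot> y) \<le> cnorm A (x \<cdot> (x - y)) + cnorm A ((x - y) \<cdot> y)"
    using norm_triangle[of "x \<cdot> (x - y)" "(x - y) \<cdot> y"] assms by simp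
  also have "\<dots> \<le> cnorm A x * cnorm A (x - y) + cnorm A (x - y) * cnorm A y"
    using assms by (intro add_mono norm_times) auto
  finally show ?thesis by (simp add: algebra_simps)
qed

section \<open>Square roots and unitaries without a unit\<close>

primrec root_iter :: "'a \<Rightarrow> nat \<Rightarrow> 'a" where
  "root_iter w 0 = 0"
| "root_iter w (Suc n) = scaleC (1/2) (w + root_iter w n \<cdot> root_iter w n)"

text \<open>The iteration above for the scalar \<open>w = 1\<close>.  It increases to 1 and dominates both the
  norms of the iterates and the norms of their increments.\<close>

primrec root_majorant :: "nat \<Rightarrow> real" where
  "root_majorant 0 = 0"
| "root_majorant (Suc n) = (1 + (root_majorant n)\<^sup>2) / 2"

lemma root_majorant_bounds: "0 \<le> root_majorant n \<and> root_majorant n \<le> 1"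
proof (induction n)
  case (Suc n)
  then have "(root_majorant n)\<^sup>2 \<le> 1" by (simp add: power_le_one)
  then show ?case by simp
qed simp

lemma incseq_root_majorant: "incseq root_majorant"
proof (rule incseq_SucI)
  fix n
  have "0 \<le> (1 - root_majorant n)\<^sup>2" by simp
  then show "root_majorant n \<le> root_majorant (Suc n)" by (simp add: power2_eq_square algebra_simps)
qed

text \<open>This iteration replaces functional calculus.  Its limit is \<open>1 - sqrt (1 - w)\<close>, an element that
  can be described without a unit.  On the boundary \<open>\<parallel>w\<parallel> = 1\<close> the map \<open>r \<mapsto> (w + r\<^sup>2) / 2\<close> is not a strict
  contraction of the unit ball; convergence comes from the comparison with the scalar iteration,
  whose increments are summable.\<close>

lemma half_square_fixed_point:
  assumes w: "w \<in> carr A" and w1: "cnorm A w \<le> 1"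
  obtains r where "r \<in> carr A" "cnorm A r \<le> 1" "r + r = w + r \<cdot> r"
    "\<And>z. z \<in> carr A \<Longrightarrow> z \<cdot> w = w \<cdot> z \<Longrightarrow> z \<cdot> r = r \<cdot> z"
    "adj A w = w \<Longrightarrow> adj A r = r"
proof -
  let ?f = "root_iter w" and ?t = root_majorant
  have f: "?f n \<in> carr A" for n by (induction n) (use w in auto)
  have half: "cnorm A (scaleC (1/2) x) = cnorm A x / 2" if "x \<in> carr A" for x
    using norm_scale[OF that, of "1/2"] by (simp add: norm_divide)
  have le: "cnorm A (?f n) \<le> ?t n" for n
  proof (induction n)
    case (Suc n)
    have "cnorm A (w + ?f n \<cdot> ?f n) \<le> cnorm A w + cnorm A (?f n) * cnorm A (?f n)"
      using norm_triangle[of w "?f n \<cdot> ?f n"] norm_times[of "?f n" "?f n"] w f[of n] by simp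
    also have "\<dots> \<le> 1 + ?t n * ?t n"
      using w1 Suc f[of n] by (intro add_mono mult_mono) (auto simp: norm_ge_zero root_majorant_bounds)
    finally show ?case using f[of n] w by (simp add: half power2_eq_square)
  qed simp
  have step: "cnorm A (?f (Suc n) - ?f n) \<le> ?t (Suc n) - ?t n" for n
  proof (induction n)
    case 0
    then show ?case using w w1 by (simp add: half)
  next
    case (Suc n)
    have "?f (Suc (Suc n)) - ?f (Suc n) = scaleC (1/2) (?f (Suc n) \<cdot> ?f (Suc n) - ?f n \<cdot> ?f n)"
      unfolding root_iter.simps(2)[of w "Suc n"]
      by (subst (3) root_iter.simps(2)) (simp only: complex_vector.scale_right_diff_distrib
            complex_vector.scale_right_distrib, simp)
    then have "cnorm A (?f (Suc (Suc n)) - ?f (Suc n))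
        = cnorm A (?f (Suc n) \<cdot> ?f (Suc n) - ?f n \<cdot> ?f n) / 2"
      using half[of "?f (Suc n) \<cdot> ?f (Suc n) - ?f n \<cdot> ?f n"] f[of n] f[of "Suc n"]
      by (simp del: root_iter.simps)
    also have "\<dots> \<le> ((cnorm A (?f (Suc n)) + cnorm A (?f n)) * cnorm A (?f (Suc n) - ?f n)) / 2"
      by (intro divide_right_mono norm_square_diff f) simp
    also have "\<dots> \<le> ((?t (Suc n) + ?t n) * (?t (Suc n) - ?t n)) / 2"
    proof (intro divide_right_mono mult_mono add_mono le Suc)
      show "0 \<le> cnorm A (?f (Suc n) - ?f n)" by (rule norm_ge_zero, rule diff_closed; rule f)
      show "0 \<le> ?t (Suc n) + ?t n" using root_majorant_bounds[of n] root_majorant_bounds[of "Suc n"] by linarith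
    qed simp
    also have "\<dots> = ?t (Suc (Suc n)) - ?t (Suc n)"
    proof -
      have "?t (Suc (Suc n)) = (1 + (?t (Suc n))\<^sup>2) / 2" "?t (Suc n) = (1 + (?t n)\<^sup>2) / 2" by simp_all
      then show ?thesis by (simp only: power2_eq_square) (simp add: field_simps)
    qed
    finally show ?case .
  qed
  have dist: "cnorm A (?f (n + k) - ?f n) \<le> ?t (n + k) - ?t n" for n k
  proof (induction k)
    case (Suc k)
    have "cnorm A (?f (n + Suc k) - ?f n)
        \<le> cnorm A (?f (Suc (n + k)) - ?f (n + k)) + cnorm A (?f (n + k) - ?f n)"
      using norm_triangle[of "?f (Suc (n + k)) - ?f (n + k)" "?f (n + k) - ?f n"] f diff_closed
      by (simp del: root_iter.simps)
    then show ?case using Suc step[of "n + k"] by (simp del: root_iter.simps root_majorant.simps)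
  qed simp
  have "Bseq ?t" by (rule BseqI'[of _ 1]) (simp add: root_majorant_bounds)
  then have "Cauchy ?t"
    using incseq_root_majorant by (intro convergent_Cauchy Bseq_mono_convergent) (auto simp: incseq_def)
  have "\<exists>N. \<forall>m\<ge>N. \<forall>n\<ge>N. cnorm A (?f m - ?f n) < e" if "e > 0" for e
  proof -
    from \<open>Cauchy ?t\<close> obtain N where N: "\<And>m n. m \<ge> N \<Longrightarrow> n \<ge> N \<Longrightarrow> dist (?t m) (?t n) < e"
      using \<open>e > 0\<close> unfolding Cauchy_def by blast
    have *: "cnorm A (?f m - ?f n) < e" if "m \<ge> n" "n \<ge> N" for m n
      using dist[of n "m - n"] N[of m n] that by (auto simp: dist_real_def)
    have "cnorm A (?f m - ?f n) < e" if "m \<ge> N" "n \<ge> N" for m n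
      using *[of m n] *[of n m] norm_diff_commute[of "?f m" "?f n"] f that by (cases "m \<ge> n") auto
    then show ?thesis by blast
  qed
  from complete[OF f this] obtain r where r: "r \<in> carr A" and lim: "tends ?f r" by blast
  have r1: "cnorm A r \<le> 1"
    using tends_norm_le[OF lim f r, of 1] le root_majorant_bounds order_trans by blast
  have "tends (\<lambda>n. ?f n \<cdot> ?f n) (r \<cdot> r)"
  proof (rule tends_squeeze)
    show "(\<lambda>n. 2 * cnorm A (?f n - r)) \<longlonglongrightarrow> 0" using tendsto_mult_left[OF lim, of 2] by simp
    fix n
    have "cnorm A (?f n) + cnorm A r \<le> 2" using le[of n] root_majorant_bounds[of n] r1 by linarith
    then show "cnorm A (?f n \<cdot> ?f n - r \<cdot> r) \<le> 2 * cnorm A (?f n - r)"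
      using norm_square_diff[OF f[of n] r] mult_right_mono[of _ 2 "cnorm A (?f n - r)"] f[of n] r
        norm_ge_zero[of "?f n - r"] by fastforce
  qed (use f r in auto)
  then have "tends (\<lambda>n. scaleC (1/2) (w + ?f n \<cdot> ?f n)) (scaleC (1/2) (w + r \<cdot> r))"
    using f r w by (intro tends_scale tends_add) auto
  then have "tends (\<lambda>n. ?f (Suc n)) (scaleC (1/2) (w + r \<cdot> r))" by simp
  from tends_unique[OF tends_Suc[OF lim] this] have "r = scaleC (1/2) (w + r \<cdot> r)"
    using f r w by (simp del: root_iter.simps)
  then have "scaleC 2 r = w + r \<cdot> r" by (metis complex_vector.scale_scale complex_vector.scale_one
     nonzero_mult_div_cancel_left times_divide_eq_right mult.right_neutral zero_neq_numeral)
  then have eq: "r + r = w + r \<cdot> r" using scaleC_add_left[of 1 1 r] by simp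
  have comm: "z \<cdot> r = r \<cdot> z" if z: "z \<in> carr A" and zw: "z \<cdot> w = w \<cdot> z" for z
  proof -
    have "z \<cdot> ?f n = ?f n \<cdot> z" for n
    proof (induction n)
      case (Suc n)
      have "z \<cdot> (?f n \<cdot> ?f n) = (?f n \<cdot> ?f n) \<cdot> z"
        using Suc f[of n] z by (metis times_assoc)
      then show ?case using f[of n] z w zw by (simp add: alg_simps)
    qed (use z in simp)
    then have "tends (\<lambda>n. z \<cdot> ?f n) (r \<cdot> z)"
      using tends_times_right[OF lim f r z] by simp
    from tends_unique[OF tends_times_left[OF lim f r z] this] show ?thesis
      using f r z by simp
  qed
  have sa: "adj A r = r" if "adj A w = w"
  proof -
    have "adj A (?f n) = ?f n" for n
      by (induction n) (use f w that in \<open>simp_all add: alg_simps\<close>)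
    then show ?thesis
      using tends_unique[OF tends_adj[OF lim f r] _ _ _ r] lim f r by simp
  qed
  from that[OF r r1 eq comm sa] show thesis .
qed

text \<open>The hypothesis on h says that \<open>1 + h\<close> is an isometry of the unitization, so the C*-identity
  makes multiplication by \<open>1 + h\<close> norm preserving.  Working with h avoids adjoining a unit.\<close>

lemma unitary_multiplier_isometric:
  assumes h: "h \<in> carr A" and u: "h + adj A h + adj A h \<cdot> h = 0" and y: "y \<in> carr A"
  shows "cnorm A (y + h \<cdot> y) = cnorm A y"
proof -
  have "adj A (y + h \<cdot> y) \<cdot> (y + h \<cdot> y)
      = adj A y \<cdot> y + adj A y \<cdot> ((h + adj A h + adj A h \<cdot> h) \<cdot> y)"
    using h y by (simp add: alg_simps)
  also have "\<dots> = adj A y \<cdot> y" using u y by simp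
  finally have "(cnorm A (y + h \<cdot> y))\<^sup>2 = (cnorm A y)\<^sup>2"
    using cstar_identity[of "y + h \<cdot> y"] cstar_identity[of y] h y by simp
  then show ?thesis using norm_ge_zero[of "y + h \<cdot> y"] norm_ge_zero[of y] h y by simp
qed

text \<open>The equation between \<open>a\<close> and r reads \<open>a\<^sup>2 + (1 - r)\<^sup>2 = 1\<close>, so \<open>1 - r + i a\<close> and \<open>1 - r - i a\<close> are
  unitary multipliers, and their difference \<open>2 i a\<close> has norm at most 2 as a multiplier; evaluating it
  at \<open>a\<close> gives \<open>\<parallel>a\<parallel>\<^sup>2 \<le> \<parallel>a\<parallel>\<close>.  The point of this criterion is that it is algebraic: a *-homomorphism maps
  such a pair to such a pair and hence transports the norm bound.\<close>

lemma norm_le_one_if_unitary_real_part: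
  assumes a: "a \<in> carr A" "adj A a = a" and r: "r \<in> carr A" "adj A r = r"
    and comm: "a \<cdot> r = r \<cdot> a" and eq: "r + r = a \<cdot> a + r \<cdot> r"
  shows "cnorm A a \<le> 1"
proof -
  let ?h = "scaleC \<i> a - r" and ?k = "- scaleC \<i> a - r"
  have c: "?h \<in> carr A" "?k \<in> carr A" using a r by auto
  have adj: "adj A ?h = ?k" "adj A ?k = ?h"
    using a r by (simp_all add: adj_diff adj_scale adj_minus complex_vector.scale_minus_left)
  have "?h + ?k = - (r + r)" by simp
  moreover have "?k \<cdot> ?h = a \<cdot> a + r \<cdot> r"
    using a r comm by (simp add: alg_simps complex_vector.scale_right_diff_distrib)
  moreover have "?h \<cdot> ?k = a \<cdot> a + r \<cdot> r"
    using a r comm by (simp add: alg_simps complex_vector.scale_right_diff_distrib)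
  ultimately have u: "?h + adj A ?h + adj A ?h \<cdot> ?h = 0" "?k + adj A ?k + adj A ?k \<cdot> ?k = 0"
    using eq unfolding adj by (auto simp: add.commute[of ?k ?h])
  have "cnorm A (scaleC (2 * \<i>) (a \<cdot> a)) = cnorm A ((a + ?h \<cdot> a) - (a + ?k \<cdot> a))"
  proof -
    have "scaleC (2 * \<i>) (a \<cdot> a) = scaleC \<i> (a \<cdot> a) + scaleC \<i> (a \<cdot> a)"
      by (metis mult_2 scaleC_add_left)
    then show ?thesis using a r by (simp add: alg_simps)
  qed
  also have "\<dots> \<le> cnorm A (a + ?h \<cdot> a) + cnorm A (a + ?k \<cdot> a)"
    using a c by (intro norm_diff_triangle) auto
  also have "\<dots> = 2 * cnorm A a"
    using unitary_multiplier_isometric[OF c(1) u(1) a(1)] unitary_multiplier_isometric[OF c(2) u(2) a(1)]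
    by simp
  finally have "(cnorm A a)\<^sup>2 \<le> cnorm A a"
    using a by (simp add: norm_scale norm_mult norm_selfadjoint_square)
  then show ?thesis
    using mult_strict_right_mono[of 1 "cnorm A a" "cnorm A a"] unfolding power2_eq_square by (smt (verit))
qed

text \<open>If \<open>a\<close> is thought of as a sine, then \<open>1 - r\<close> is the corresponding cosine.\<close>

lemma selfadjoint_cosine:
  assumes a: "a \<in> carr A" "adj A a = a" and a1: "cnorm A a \<le> 1"
  obtains r where "r \<in> carr A" "adj A r = r" "a \<cdot> r = r \<cdot> a" "r + r = a \<cdot> a + r \<cdot> r"
proof -
  have aa1: "cnorm A (a \<cdot> a) \<le> 1"
    using a a1 by (simp add: norm_selfadjoint_square power_le_one norm_ge_zero)
  show thesis
  proof (rule half_square_fixed_point[OF times_closed[OF a(1) a(1)] aa1])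
    fix r assume r: "r \<in> carr A" "r + r = a \<cdot> a + r \<cdot> r"
      and c: "\<And>z. z \<in> carr A \<Longrightarrow> z \<cdot> (a \<cdot> a) = (a \<cdot> a) \<cdot> z \<Longrightarrow> z \<cdot> r = r \<cdot> z"
      and s: "adj A (a \<cdot> a) = a \<cdot> a \<Longrightarrow> adj A r = r"
    have "a \<cdot> r = r \<cdot> a" using a by (intro c) (simp_all add: times_assoc)
    moreover have "adj A r = r" using a by (intro s) (simp add: adj_times)
    ultimately show thesis using that r by blast
  qed
qed

text \<open>This is \<open>sin\<^sup>2 cos\<^sup>2 \<le> 1/4\<close>.  With x as sine and \<open>1 - r\<close> as cosine, \<open>2 (x - x r)\<close> is the sine of the
  doubled angle and \<open>1 - 2 x\<^sup>2\<close> its cosine, so the preceding criterion bounds it by 1.\<close>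

lemma norm_logistic_le:
  assumes x: "x \<in> carr A" "adj A x = x" and x1: "cnorm A x \<le> 1"
  shows "cnorm A (x \<cdot> x - (x \<cdot> x) \<cdot> (x \<cdot> x)) \<le> 1/4"
proof -
  let ?b = "x \<cdot> x"
  obtain r where r: "r \<in> carr A" "adj A r = r" "x \<cdot> r = r \<cdot> x" and eq: "r + r = ?b + r \<cdot> r"
    using selfadjoint_cosine[OF x x1] .
  let ?c = "x - x \<cdot> r"
  have c: "?c \<in> carr A" using x r by simp
  have csa: "adj A ?c = ?c" using x r by (simp add: alg_simps)
  have xr: "x \<cdot> (r \<cdot> z) = r \<cdot> (x \<cdot> z)" if "z \<in> carr A" for z
    using x r that by (metis times_assoc)
  have "?c \<cdot> ?c = x \<cdot> (x \<cdot> (x - x)) + x \<cdot> x - x \<cdot> (x \<cdot> (r + r - r \<cdot> r))"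
    using x r xr by (simp add: alg_simps)
  also have "r + r - r \<cdot> r = ?b" using eq by simp
  finally have c2: "?c \<cdot> ?c = ?b - ?b \<cdot> ?b" using x by (simp add: alg_simps)
  have bc: "?b \<cdot> ?c = ?c \<cdot> ?b" using x r xr by (simp add: alg_simps)
  have "cnorm A (scaleC 2 ?c) \<le> 1"
  proof (rule norm_le_one_if_unitary_real_part[of _ "scaleC 2 ?b"])
    show "scaleC 2 ?b + scaleC 2 ?b = scaleC 2 ?c \<cdot> scaleC 2 ?c + scaleC 2 ?b \<cdot> scaleC 2 ?b"
    proof -
      have "scaleC 2 ?c \<cdot> scaleC 2 ?c = scaleC 4 (?b - ?b \<cdot> ?b)"
        using c by (simp add: times_scale_left times_scale_right c2)
      moreover have "scaleC 2 ?b \<cdot> scaleC 2 ?b = scaleC 4 (?b \<cdot> ?b)"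
        using x by (simp add: times_scale_left times_scale_right)
      ultimately show ?thesis
        by (simp add: complex_vector.scale_right_diff_distrib flip: scaleC_add_left)
    qed
  qed (use c x csa bc in \<open>auto simp: adj_scale times_scale_left times_scale_right adj_times\<close>)
  then have "cnorm A ?c \<le> 1/2" using c by (simp add: norm_scale)
  moreover have "cnorm A (?b - ?b \<cdot> ?b) = (cnorm A ?c)\<^sup>2"
    using norm_selfadjoint_square[OF c csa] c2 by simp
  ultimately show ?thesis
    using power_mono[of "cnorm A ?c" "1/2" 2] norm_ge_zero[OF c] by (simp add: power2_eq_square)
qed

end

lemma star_homD:
  assumes "star_hom A B f" "x \<in> carr A" "y \<in> carr A"
  shows "f x \<in> carr B" "f (x + y) = f x + f y" "f (scaleC c x) = scaleC c (f x)"
    "f (x \<cdot>\<^bsub>A\<^esub> y) = f x \<cdot>\<^bsub>B\<^esub> f y" "f (adj A x) = adj B (f x)"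
  using assms by (auto simp: star_hom_def linear_map_def)

text \<open>For a self-adjoint element of norm at most 1, the homomorphism carries along the equation that
  witnesses the bound.  Scaling and the C*-identity give the rest.\<close>

lemma star_hom_contractive:
  assumes A: "cstar_algebra A" and B: "cstar_algebra B" and f: "star_hom A B f" and x: "x \<in> carr A"
  shows "cnorm B (f x) \<le> cnorm A x"
proof -
  interpret A: cstar_algebra A by fact
  interpret B: cstar_algebra B by fact
  note hom = star_homD[OF f]
  have unit: "cnorm B (f a) \<le> 1" if a: "a \<in> carr A" "adj A a = a" "cnorm A a \<le> 1" for a
  proof -
    obtain r where r: "r \<in> carr A" "adj A r = r" "a \<cdot>\<^bsub>A\<^esub> r = r \<cdot>\<^bsub>A\<^esub> a" "r + r = a \<cdot>\<^bsub>A\<^esub> a + r \<cdot>\<^bsub>A\<^esub> r"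
      using A.selfadjoint_cosine[OF a] .
    show ?thesis
      by (rule B.norm_le_one_if_unitary_real_part[of _ "f r"])
        (use a r in \<open>auto simp: hom(1) simp flip: hom(2,4,5)\<close>)
  qed
  have sa: "cnorm B (f a) \<le> cnorm A a" if a: "a \<in> carr A" "adj A a = a" for a
  proof (cases "a = 0")
    case True
    have "f 0 = 0" using hom(2)[of 0 0] by simp
    then show ?thesis using True by simp
  next
    case False
    define m where "m = cnorm A a"
    have m: "m > 0" unfolding m_def using A.norm_pos[OF a(1) False] .
    have "cnorm B (f (scaleC (of_real (1/m)) a)) \<le> 1"
      using a m by (intro unit) (auto simp: A.adj_scale A.norm_scale norm_divide m_def)
    then show ?thesis
      using a m hom by (simp add: B.norm_scale norm_divide field_simps flip: m_def)
  qed
  have "(cnorm B (f x))\<^sup>2 = cnorm B (f (adj A x \<cdot>\<^bsub>A\<^esub> x))"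
    using x hom by (simp add: B.cstar_identity)
  also have "\<dots> \<le> cnorm A (adj A x \<cdot>\<^bsub>A\<^esub> x)"
    using x by (intro sa) (auto simp: A.adj_times)
  finally have "(cnorm B (f x))\<^sup>2 \<le> (cnorm A x)\<^sup>2" using x by (simp add: A.cstar_identity)
  then show ?thesis using A.norm_ge_zero[OF x] by (rule power2_le_imp_le)
qed

section \<open>Adjoints of Hilbert space operators\<close>

lemma cinner_add_right: "cinner (x::'h::chilbert_space) (y + z) = cinner x y + cinner x z"
  by (metis cinner_commute cinner_add_left complex_cnj_add)

lemma cinner_scaleC_right: "cinner (x::'h::chilbert_space) (scaleC c y) = cnj c * cinner x y"
  by (metis cinner_commute cinner_scaleC_left complex_cnj_mult)

lemma cinner_minus_left: "cinner (- x::'h::chilbert_space) y = - cinner x y"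
  using cinner_scaleC_left[of "-1" x y] by simp

lemma cinner_minus_right: "cinner (x::'h::chilbert_space) (- y) = - cinner x y"
  using cinner_scaleC_right[of x "-1" y] by simp

lemma cinner_diff_left: "cinner (x - y::'h::chilbert_space) z = cinner x z - cinner y z"
  using cinner_add_left[of x "- y" z] by (simp add: cinner_minus_left)

lemma cinner_diff_right: "cinner (x::'h::chilbert_space) (y - z) = cinner x y - cinner x z"
  using cinner_add_right[of x y "- z"] by (simp add: cinner_minus_right)

lemma cinner_zero_left [simp]: "cinner (0::'h::chilbert_space) x = 0"
  using cinner_add_left[of 0 0 x] by simp

lemma cinner_zero_right [simp]: "cinner (x::'h::chilbert_space) 0 = 0"
  using cinner_add_right[of x 0 0] by simp

lemma cinner_self: "cinner (x::'h::chilbert_space) x = of_real ((norm x)\<^sup>2)"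
proof -
  have "Im (cinner x x) = 0" using arg_cong[OF cinner_commute[of x x], of Im] by simp
  moreover have "Re (cinner x x) = (norm x)\<^sup>2"
    using norm_eq_sqrt_cinner[of x] cinner_ge_zero[of x] by simp
  ultimately show ?thesis by (simp add: complex_eq_iff)
qed

lemma norm_diff_power2:
  "(norm (x - y::'h::chilbert_space))\<^sup>2 = (norm x)\<^sup>2 + (norm y)\<^sup>2 - 2 * Re (cinner x y)"
proof -
  have "of_real ((norm (x - y))\<^sup>2) = of_real ((norm x)\<^sup>2) + of_real ((norm y)\<^sup>2) - (cinner x y + cnj (cinner x y))"
    unfolding cinner_self[symmetric] cinner_commute[of y x, symmetric]
    by (simp add: cinner_diff_left cinner_diff_right)
  also have "cinner x y + cnj (cinner x y) = of_real (2 * Re (cinner x y))"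
    by (simp add: complex_add_cnj)
  finally show ?thesis
    by (metis (no_types, lifting) of_real_add of_real_diff of_real_eq_iff)
qed

lemma parallelogram:
  "(norm (x + y::'h::chilbert_space))\<^sup>2 + (norm (x - y))\<^sup>2 = 2 * (norm x)\<^sup>2 + 2 * (norm y)\<^sup>2"
  using norm_diff_power2[of x y] norm_diff_power2[of x "- y"] by (simp add: cinner_minus_right)

lemma norm_project_power2:
  assumes "(y::'h::chilbert_space) \<noteq> 0"
  shows "(norm (x - scaleC (cinner x y / of_real ((norm y)\<^sup>2)) y))\<^sup>2
    = (norm x)\<^sup>2 - (cmod (cinner x y))\<^sup>2 / (norm y)\<^sup>2"
proof -
  let ?t = "cinner x y / of_real ((norm y)\<^sup>2)"
  have n: "(norm y)\<^sup>2 \<noteq> 0" using assms by simp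
  have "cinner (scaleC t y) (scaleC t y) = t * cnj t * of_real ((norm y)\<^sup>2)" for t
    by (simp only: cinner_scaleC_left cinner_scaleC_right cinner_self[of y] mult_ac)
  from this[of ?t] have "of_real ((norm (scaleC ?t y))\<^sup>2) = ?t * cnj ?t * of_real ((norm y)\<^sup>2)"
    unfolding cinner_self[of "scaleC ?t y"] .
  also have "\<dots> = of_real ((cmod (cinner x y))\<^sup>2 / (norm y)\<^sup>2)"
    using n by (simp add: field_simps power2_eq_square flip: complex_norm_square)
  finally have 1: "(norm (scaleC ?t y))\<^sup>2 = (cmod (cinner x y))\<^sup>2 / (norm y)\<^sup>2"
    using of_real_eq_iff by blast
  have "cinner x (scaleC ?t y) = of_real ((cmod (cinner x y))\<^sup>2 / (norm y)\<^sup>2)"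
    using n by (simp add: cinner_scaleC_right mult.commute flip: complex_norm_square)
  then have "Re (cinner x (scaleC ?t y)) = (cmod (cinner x y))\<^sup>2 / (norm y)\<^sup>2"
    by (simp only: Re_complex_of_real)
  then show ?thesis using 1 by (simp add: norm_diff_power2)
qed

lemma cinner_Cauchy_Schwarz: "cmod (cinner x y) \<le> norm (x::'h::chilbert_space) * norm y"
proof (cases "y = 0")
  case True
  then show ?thesis by simp
next
  case False
  then have "(cmod (cinner x y))\<^sup>2 / (norm y)\<^sup>2 \<le> (norm x)\<^sup>2"
    using norm_project_power2[OF False, of x] zero_le_power2 by (metis diff_ge_0_iff_ge)
  then have "(cmod (cinner x y))\<^sup>2 \<le> (norm x * norm y)\<^sup>2"
    using False by (simp add: field_simps)
  then show ?thesis by (rule power2_le_imp_le) simp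
qed

text \<open>A sequence in the hyperplane whose norms approach the infimum is a Cauchy sequence by the
  parallelogram law, because midpoints stay in the hyperplane.\<close>

lemma minimal_norm_point:
  fixes f :: "'h::chilbert_space \<Rightarrow> complex"
  assumes add: "\<And>x y. f (x + y) = f x + f y" and scale: "\<And>c x. f (scaleC c x) = c * f x"
    and bound: "\<And>x. cmod (f x) \<le> K * norm x" and u: "f u = 1"
  obtains z where "f z = 1" "\<And>x. f x = 1 \<Longrightarrow> norm z \<le> norm x"
proof -
  have fdiff: "f (x - y) = f x - f y" for x y
    using add[of x "- y"] scale[of "-1" y] by simp
  define d where "d = (INF x\<in>{x. f x = 1}. norm x)"
  have bdd: "bdd_below (norm ` {x. f x = 1})" by (rule bdd_belowI[of _ 0]) auto
  have dle: "d \<le> norm x" if "f x = 1" for x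
    unfolding d_def using bdd that by (auto intro: cINF_lower)
  have d0: "0 \<le> d" unfolding d_def using u by (intro cINF_greatest) auto
  have "\<exists>x. f x = 1 \<and> norm x < d + 1 / real (Suc n)" for n
  proof (rule ccontr)
    assume "\<not> ?thesis"
    then have "d + 1 / real (Suc n) \<le> d"
      unfolding d_def using u by (intro cINF_greatest) (auto simp: not_less)
    then show False by simp
  qed
  then obtain s where s: "\<And>n. f (s n) = 1" and sd: "\<And>n. norm (s n) < d + 1 / real (Suc n)"
    by metis
  \<comment> \<open>the parallelogram law, with the midpoint in the hyperplane\<close>
  have mid: "(norm (x - y))\<^sup>2 \<le> 2 * ((norm x)\<^sup>2 - d\<^sup>2) + 2 * ((norm y)\<^sup>2 - d\<^sup>2)"
    if "f x = 1" "f y = 1" for x y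
  proof -
    have "f (scaleC (1/2) (x + y)) = 1" using that by (simp add: scale add)
    from dle[OF this] have "d \<le> norm ((1/2) *\<^sub>R (x + y))"
      using scaleR_eq_scaleC[of "1/2" "x + y"] by simp
    then have "2 * d \<le> norm (x + y)" by simp
    then have "(2 * d)\<^sup>2 \<le> (norm (x + y))\<^sup>2" using d0 by (intro power_mono) auto
    then show ?thesis using parallelogram[of x y] by (simp add: algebra_simps)
  qed
  define g where "g n = (2 * d + 1) / real (Suc n)" for n
  have gap: "(norm (s n))\<^sup>2 - d\<^sup>2 \<le> g n" for n
  proof -
    have "(norm (s n))\<^sup>2 \<le> (d + 1 / real (Suc n))\<^sup>2"
      using sd[of n] by (intro power_mono) auto
    also have "\<dots> = d\<^sup>2 + (2 * d + 1 / real (Suc n)) * (1 / real (Suc n))"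
      by (simp add: power2_eq_square algebra_simps)
    also have "\<dots> \<le> d\<^sup>2 + (2 * d + 1) * (1 / real (Suc n))"
      by (intro add_left_mono mult_right_mono) auto
    finally show ?thesis by (simp add: g_def)
  qed
  have "Cauchy s"
    unfolding Cauchy_def
  proof (intro allI impI)
    fix e :: real assume e: "e > 0"
    obtain N where "4 * (2 * d + 1) / e\<^sup>2 < real N" using reals_Archimedean2 by blast
    then have N: "4 * (2 * d + 1) / e\<^sup>2 < real (Suc N)" by simp
    have "dist (s m) (s n) < e" if "m \<ge> N" "n \<ge> N" for m n
    proof -
      have *: "g k \<le> g N" if "k \<ge> N" for k
        unfolding g_def using d0 that by (intro divide_left_mono) auto
      have "(norm (s m - s n))\<^sup>2 \<le> 4 * g N"
        using mid[OF s s, of m n] gap[of m] gap[of n] *[OF that(1)] *[OF that(2)] by (smt (verit))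
      also have "\<dots> < e\<^sup>2" using N e by (simp add: g_def field_simps)
      finally show ?thesis using e by (simp add: dist_norm power2_less_imp_less)
    qed
    then show "\<exists>M. \<forall>m\<ge>M. \<forall>n\<ge>M. dist (s m) (s n) < e" by blast
  qed
  then obtain z where lim: "s \<longlonglongrightarrow> z" using Cauchy_convergent convergent_def by blast
  have "(\<lambda>n. norm (s n - z)) \<longlonglongrightarrow> 0" using lim by (simp add: LIM_zero tendsto_norm_zero)
  then have "(\<lambda>n. K * norm (s n - z)) \<longlonglongrightarrow> K * 0" by (intro tendsto_mult_left)
  moreover have "cmod (1 - f z) \<le> K * norm (s n - z)" for n
    using bound[of "s n - z"] by (simp add: fdiff s)
  ultimately have "cmod (1 - f z) \<le> K * 0" by (intro LIMSEQ_le_const[of _ "K * 0"]) auto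
  then have fz: "f z = 1" by simp
  have "(\<lambda>n. d + 1 / real (Suc n)) \<longlonglongrightarrow> d + 0"
    by (intro tendsto_add tendsto_const LIMSEQ_Suc[OF lim_1_over_n])
  with tendsto_norm[OF lim] have "norm z \<le> d + 0"
    by (rule LIMSEQ_le) (use sd in \<open>auto intro!: exI[of _ 0] less_imp_le\<close>)
  then show thesis using that[of z] fz dle by fastforce
qed

text \<open>The point of least norm in the hyperplane where f is 1 is orthogonal to the kernel of f;
  otherwise subtracting a projection would shorten it.\<close>

lemma Riesz_representation:
  fixes f :: "'h::chilbert_space \<Rightarrow> complex"
  assumes add: "\<And>x y. f (x + y) = f x + f y" and scale: "\<And>c x. f (scaleC c x) = c * f x"
    and bound: "\<And>x. cmod (f x) \<le> K * norm x"
  shows "\<exists>z. \<forall>x. f x = cinner x z"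
proof (cases "\<forall>x. f x = 0")
  case True
  then show ?thesis by (intro exI[of _ 0]) simp
next
  case False
  then obtain v where "f v \<noteq> 0" by blast
  then have "f (scaleC (1 / f v) v) = 1" by (simp add: scale)
  then obtain z where z: "f z = 1" "\<And>x. f x = 1 \<Longrightarrow> norm z \<le> norm x"
    using minimal_norm_point[OF add scale bound] by metis
  have fdiff: "f (x - y) = f x - f y" for x y
    using add[of x "- y"] scale[of "-1" y] by simp
  have orth: "cinner h z = 0" if h: "f h = 0" for h
  proof (cases "h = 0")
    case True
    then show ?thesis by simp
  next
    case False
    let ?t = "cinner z h / of_real ((norm h)\<^sup>2)"
    have "norm z \<le> norm (z - scaleC ?t h)" by (rule z(2)) (simp add: fdiff scale h z(1))
    then have "(norm z)\<^sup>2 \<le> (norm z)\<^sup>2 - (cmod (cinner z h))\<^sup>2 / (norm h)\<^sup>2"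
      unfolding norm_project_power2[OF False, symmetric] by (intro power_mono) auto
    then have "cinner z h = 0" using False by (simp add: field_simps)
    then show ?thesis using cinner_commute[of h z] by simp
  qed
  have "z \<noteq> 0" using z(1) scale[of 0 z] by auto
  have "f x = cinner x (scaleC (of_real (1 / (norm z)\<^sup>2)) z)" for x
  proof -
    have "cinner (x - scaleC (f x) z) z = 0" by (rule orth) (simp add: fdiff scale z(1))
    then have "cinner x z = f x * of_real ((norm z)\<^sup>2)"
      by (simp add: cinner_diff_left cinner_scaleC_left cinner_self)
    then show ?thesis using \<open>z \<noteq> 0\<close> by (simp add: cinner_scaleC_right)
  qed
  then show ?thesis by blast
qed

lemma bounded_operatorsD:
  assumes "T \<in> carr bounded_operators"
  shows "bounded_linear T" "T (x + y) = T x + T y" "T (scaleC c x) = scaleC c (T x)"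
  using assms by (auto simp: bounded_operators_def linear_simps)

text \<open>The adjoint is defined by a choice, so its defining property has to come from an existence
  proof, which is the Riesz representation of \<open>x \<mapsto> \<langle>T x, y\<rangle>\<close>.\<close>

lemma cinner_hilbert_adjoint:
  fixes T :: "'h::chilbert_space \<Rightarrow> 'h"
  assumes T: "T \<in> carr bounded_operators"
  shows "cinner (T x) y = cinner x (hilbert_adjoint T y)"
proof -
  note T = bounded_operatorsD[OF T]
  have "\<exists>z. \<forall>x. cinner (T x) y = cinner x z" for y
  proof (rule Riesz_representation[of _ "onorm T * norm y"])
    fix x
    have "cmod (cinner (T x) y) \<le> norm (T x) * norm y" by (rule cinner_Cauchy_Schwarz)
    also have "\<dots> \<le> (onorm T * norm x) * norm y"
      by (intro mult_right_mono onorm T) auto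
    finally show "cmod (cinner (T x) y) \<le> onorm T * norm y * norm x" by (simp add: algebra_simps)
  qed (simp_all add: T cinner_add_left cinner_scaleC_left)
  then obtain g where "\<forall>x y. cinner (T x) y = cinner x (g y)" by metis
  then have "\<forall>x y. cinner (T x) y = cinner x (hilbert_adjoint T y)"
    unfolding hilbert_adjoint_def
    by (rule someI[where P = "\<lambda>g. \<forall>x y. cinner (T x) y = cinner x (g y)"])
  then show ?thesis by blast
qed

lemma norm_hilbert_adjoint_le:
  fixes T :: "'h::chilbert_space \<Rightarrow> 'h"
  assumes T: "T \<in> carr bounded_operators"
  shows "norm (hilbert_adjoint T y) \<le> onorm T * norm y"
proof (cases "hilbert_adjoint T y = 0")
  case True
  then show ?thesis using onorm_pos_le[OF bounded_operatorsD(1)[OF T]] by simp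
next
  case False
  let ?z = "hilbert_adjoint T y"
  have "(norm ?z)\<^sup>2 = cmod (cinner (T ?z) y)"
    unfolding cinner_hilbert_adjoint[OF T] cinner_self by (simp add: norm_power)
  also have "\<dots> \<le> norm (T ?z) * norm y" by (rule cinner_Cauchy_Schwarz)
  also have "\<dots> \<le> (onorm T * norm ?z) * norm y"
    by (intro mult_right_mono onorm bounded_operatorsD[OF T]) auto
  finally show ?thesis using False by (simp add: power2_eq_square)
qed

section \<open>Faithful representations are bounded below\<close>

context cstar_algebra
begin

text \<open>With r as in \<open>selfadjoint_cosine\<close>, the deficit \<open>\<parallel>\<xi>\<parallel>\<^sup>2 - \<parallel>\<pi> a \<xi>\<parallel>\<^sup>2\<close> is the square \<open>\<parallel>\<xi> - \<pi> r \<xi>\<parallel>\<^sup>2\<close>.\<close>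

lemma star_rep_contractive:
  fixes \<pi> :: "'a \<Rightarrow> 'h \<Rightarrow> 'h::chilbert_space"
  assumes \<pi>: "star_hom A bounded_operators \<pi>" and a: "a \<in> carr A" "adj A a = a"
  shows "norm (\<pi> a \<xi>) \<le> cnorm A a * norm \<xi>"
proof -
  note hom = star_homD[OF \<pi>]
  have hom_add: "\<pi> (x + y) v = \<pi> x v + \<pi> y v" if "x \<in> carr A" "y \<in> carr A" for x y v
    using hom(2)[OF that] by simp
  have hom_times: "\<pi> (x \<cdot> y) v = \<pi> x (\<pi> y v)" if "x \<in> carr A" "y \<in> carr A" for x y v
    using hom(4)[OF that] by (simp add: bounded_operators_def)
  have sa: "cinner (\<pi> x u) v = cinner u (\<pi> x v)" if x: "x \<in> carr A" "adj A x = x" for x u v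
    using cinner_hilbert_adjoint[OF hom(1)[OF x(1) x(1)], of u v] hom(5)[OF x(1) x(1)] x
    by (simp add: bounded_operators_def)
  have unit: "norm (\<pi> b \<xi>) \<le> norm \<xi>" if b: "b \<in> carr A" "adj A b = b" "cnorm A b \<le> 1" for b
  proof -
    obtain r where r: "r \<in> carr A" "adj A r = r" and eq: "r + r = b \<cdot> b + r \<cdot> r"
      using selfadjoint_cosine[OF b] .
    have "\<pi> r \<xi> + \<pi> r \<xi> = \<pi> b (\<pi> b \<xi>) + \<pi> r (\<pi> r \<xi>)"
      using arg_cong[OF eq, of "\<lambda>x. \<pi> x \<xi>"] b r by (simp add: hom_add hom_times)
    then have "cinner \<xi> (\<pi> r \<xi>) + cinner \<xi> (\<pi> r \<xi>)
        = cinner (\<pi> b \<xi>) (\<pi> b \<xi>) + cinner (\<pi> r \<xi>) (\<pi> r \<xi>)"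
      using b r by (simp add: sa flip: cinner_add_right)
    from arg_cong[OF this, of Re] have "2 * Re (cinner \<xi> (\<pi> r \<xi>)) = (norm (\<pi> b \<xi>))\<^sup>2 + (norm (\<pi> r \<xi>))\<^sup>2"
      by (simp add: cinner_self)
    then have "(norm (\<xi> - \<pi> r \<xi>))\<^sup>2 = (norm \<xi>)\<^sup>2 - (norm (\<pi> b \<xi>))\<^sup>2"
      by (simp add: norm_diff_power2)
    then have "(norm (\<pi> b \<xi>))\<^sup>2 \<le> (norm \<xi>)\<^sup>2" using zero_le_power2 by (metis diff_ge_0_iff_ge)
    then show ?thesis by (rule power2_le_imp_le) simp
  qed
  show ?thesis
  proof (cases "a = 0")
    case True
    then show ?thesis using hom_add[of 0 0 \<xi>] by simp
  next
    case False
    define m where "m = cnorm A a"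
    have m: "m > 0" unfolding m_def using norm_pos[OF a(1) False] .
    have "norm (\<pi> (scaleC (of_real (1/m)) a) \<xi>) \<le> norm \<xi>"
      using a m by (intro unit) (auto simp: adj_scale norm_scale norm_divide m_def)
    moreover have "\<pi> (scaleC (of_real (1/m)) a) \<xi> = (1/m) *\<^sub>R \<pi> a \<xi>"
      using hom(3)[OF a(1) a(1), of "of_real (1/m)"] by (simp add: scaleR_eq_scaleC scaleC_fun_def)
    ultimately show ?thesis using m by (simp add: field_simps flip: m_def)
  qed
qed

text \<open>Let \<open>b = a\<^sup>2\<close> with \<open>a\<close> self-adjoint and \<open>\<parallel>a\<parallel> \<le> 1\<close>, and suppose \<open>\<parallel>\<pi> b\<parallel> < 1/2\<close>.  By the estimate
  \<open>\<parallel>b - b\<^sup>2\<parallel> \<le> 1/4\<close> the equation \<open>v - v\<^sup>2 = b - b\<^sup>2\<close> has a solution with \<open>\<parallel>v\<parallel> \<le> 1/2\<close> that commutes with b.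
  The images of v and b solve the same equation and have norms adding up to less than 1, so they
  agree; injectivity yields \<open>v = b\<close>, and thus \<open>\<parallel>b\<parallel> \<le> 1/2\<close>.  Hence \<open>\<parallel>a\<parallel> = 1\<close> forces \<open>\<parallel>\<pi> b\<parallel> \<ge> 1/2\<close>.  This is weaker
  than the theorem that \<open>\<pi>\<close> is isometric, but a fixed constant suffices for entropy.\<close>

lemma faithful_rep_bounded_below:
  fixes \<pi> :: "'a \<Rightarrow> 'h \<Rightarrow> 'h::chilbert_space"
  assumes \<pi>: "faithful_rep A \<pi>" and x: "x \<in> carr A"
  shows "cnorm A x \<le> 2 * onorm (\<pi> x)"
proof -
  have hom: "star_hom A bounded_operators \<pi>" and inj: "inj_on \<pi> (carr A)"
    using \<pi> by (auto simp: faithful_rep_def)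
  note h = star_homD[OF hom]
  have op: "\<pi> a \<in> carr bounded_operators" if "a \<in> carr A" for a using h(1)[OF that that] .
  note bl = bounded_operatorsD(1)[OF op]
  have hom_add: "\<pi> (a + b) v = \<pi> a v + \<pi> b v" if "a \<in> carr A" "b \<in> carr A" for a b v
    using h(2)[OF that] by simp
  have hom_times: "\<pi> (a \<cdot> b) v = \<pi> a (\<pi> b v)" if "a \<in> carr A" "b \<in> carr A" for a b v
    using h(4)[OF that] by (simp add: bounded_operators_def)
  have \<pi>0: "\<pi> 0 v = 0" for v using hom_add[of 0 0 v] by simp
  have nonneg: "0 \<le> onorm (\<pi> a)" if "a \<in> carr A" for a using onorm_pos_le[OF bl[OF that]] .
  have square: "cnorm A (a \<cdot> a) \<le> 1/2"
    if a: "a \<in> carr A" "adj A a = a" "cnorm A a \<le> 1" and small: "onorm (\<pi> (a \<cdot> a)) < 1/2" for a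
  proof -
    let ?b = "a \<cdot> a"
    \<comment> \<open>For \<open>v = r / 2\<close> the equation \<open>v = (b - b\<^sup>2) + v\<^sup>2\<close> is \<open>r + r = 4 (b - b\<^sup>2) + r\<^sup>2\<close>.\<close>
    define w where "w = scaleC 4 (?b - ?b \<cdot> ?b)"
    have b: "?b \<in> carr A" "adj A ?b = ?b" using a by (auto simp: adj_times)
    have w: "w \<in> carr A" "cnorm A w \<le> 1" "adj A w = w" "?b \<cdot> w = w \<cdot> ?b"
      using norm_logistic_le[OF a] b(1) a(1) unfolding w_def
      by (simp_all add: norm_scale adj_scale b(2) alg_simps) (simp_all add: alg_simps a)
    show ?thesis
    proof (rule half_square_fixed_point[OF w(1,2)])
      fix r assume r: "r \<in> carr A" "cnorm A r \<le> 1" and eq: "r + r = w + r \<cdot> r"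
        and comm: "\<And>z. z \<in> carr A \<Longrightarrow> z \<cdot> w = w \<cdot> z \<Longrightarrow> z \<cdot> r = r \<cdot> z"
        and sa: "adj A w = w \<Longrightarrow> adj A r = r"
      define v where "v = scaleC (1/2) r"
      have v: "v \<in> carr A" "adj A v = v" and v1: "cnorm A v \<le> 1/2"
        using r sa[OF w(3)] by (auto simp: v_def adj_scale norm_scale norm_divide)
      have bv: "?b \<cdot> v = v \<cdot> ?b"
        using comm[OF b(1) w(4)] r(1) b(1) by (simp add: v_def times_scale_left times_scale_right)
      have "scaleC 4 v = scaleC 4 (?b - ?b \<cdot> ?b + v \<cdot> v)"
      proof -
        have "scaleC 4 v = r + r" using scaleC_add_left[of 1 1 r] by (simp add: v_def scaleC_one)
        moreover have "scaleC 4 (v \<cdot> v) = r \<cdot> r"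
          using r(1) by (simp add: v_def times_scale_left times_scale_right scaleC_one)
        ultimately show ?thesis using eq by (simp add: w_def scaleC_add_right)
      qed
      then have veq: "v = ?b - ?b \<cdot> ?b + v \<cdot> v" by (simp only: complex_vector.scale_cancel_left) simp
      define z where "z = v - ?b"
      have z: "z \<in> carr A" using v b by (simp add: z_def)
      have "z = v \<cdot> v - ?b \<cdot> ?b" unfolding z_def by (subst (1) veq) simp
      also have "\<dots> = z \<cdot> (v + ?b)" 
        unfolding z_def using v(1) b(1) bv by (simp only: times_add_right times_diff_left add_closed diff_closed) simp
      finally have zz: "z = z \<cdot> (v + ?b)" .
      define q where "q = 1/2 + onorm (\<pi> ?b)"
      have q: "q < 1" "0 \<le> q" using small nonneg[OF b(1)] by (simp_all add: q_def)
      have "norm (\<pi> z \<xi>) \<le> q * onorm (\<pi> z) * norm \<xi>" for \<xi>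
      proof -
        have "norm (\<pi> (v + ?b) \<xi>) \<le> norm (\<pi> v \<xi>) + norm (\<pi> ?b \<xi>)"
          unfolding hom_add[OF v(1) b(1)] by (rule norm_triangle_ineq)
        also have "\<dots> \<le> 1/2 * norm \<xi> + onorm (\<pi> ?b) * norm \<xi>"
          using star_rep_contractive[OF hom v, of \<xi>] mult_right_mono[OF v1, of "norm \<xi>"]
            onorm[OF bl[OF b(1)], of \<xi>] by simp
        finally have 1: "norm (\<pi> (v + ?b) \<xi>) \<le> q * norm \<xi>" by (simp add: q_def algebra_simps)
        have "norm (\<pi> z \<xi>) = norm (\<pi> z (\<pi> (v + ?b) \<xi>))"
          using hom_times[OF z, of "v + ?b" \<xi>] v(1) b(1) zz by simp
        also have "\<dots> \<le> onorm (\<pi> z) * norm (\<pi> (v + ?b) \<xi>)" by (rule onorm[OF bl[OF z]])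
        also have "\<dots> \<le> onorm (\<pi> z) * (q * norm \<xi>)"
          by (intro mult_left_mono 1 nonneg z)
        finally show ?thesis by (simp add: algebra_simps)
      qed
      then have "onorm (\<pi> z) \<le> q * onorm (\<pi> z)"
        using q nonneg[OF z] by (intro onorm_bound) auto
      then have "onorm (\<pi> z) = 0" using q nonneg[OF z]
        by (metis mult_le_cancel_right1 order_antisym_conv not_less)
      then have "\<pi> z = \<pi> 0"
        using onorm_eq_0[OF bl[OF z]] \<pi>0 by auto
      then have "z = 0" using inj z by (auto dest: inj_onD)
      then show ?thesis using v1 by (simp add: z_def)
    qed
  qed
  have unit: "1 \<le> 2 * (onorm (\<pi> a))\<^sup>2" if a: "a \<in> carr A" "adj A a = a" "cnorm A a = 1" for a
  proof (rule ccontr)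
    assume "\<not> ?thesis"
    moreover have "onorm (\<pi> (a \<cdot> a)) \<le> (onorm (\<pi> a))\<^sup>2"
      using onorm_compose[OF bl[OF a(1)] bl[OF a(1)]] h(4)[OF a(1) a(1)]
      by (simp add: bounded_operators_def power2_eq_square comp_def)
    ultimately have "cnorm A (a \<cdot> a) \<le> 1/2" using a by (intro square) auto
    then show False using a by (simp add: norm_selfadjoint_square)
  qed
  have sa: "(cnorm A a)\<^sup>2 \<le> 2 * (onorm (\<pi> a))\<^sup>2" if a: "a \<in> carr A" "adj A a = a" for a
  proof (cases "a = 0")
    case False
    define m where "m = cnorm A a"
    have m: "m > 0" unfolding m_def using norm_pos[OF a(1) False] .
    have "1 \<le> 2 * (onorm (\<pi> (scaleC (of_real (1/m)) a)))\<^sup>2"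
      using a m by (intro unit) (auto simp: adj_scale norm_scale norm_divide m_def)
    moreover have "\<pi> (scaleC (of_real (1/m)) a) = (\<lambda>\<xi>. (1/m) *\<^sub>R \<pi> a \<xi>)"
      using h(3)[OF a(1) a(1), of "of_real (1/m)"] by (simp add: scaleR_eq_scaleC scaleC_fun_def)
    ultimately have "1 \<le> 2 * (onorm (\<pi> a) / m)\<^sup>2"
      using m onorm_scaleR[OF bl[OF a(1)], of "1/m"] by simp
    then show ?thesis using m by (simp add: power_divide field_simps flip: m_def)
  qed simp
  define k where "k = onorm (\<pi> x)"
  have "norm (\<pi> (adj A x \<cdot> x) \<xi>) \<le> k\<^sup>2 * norm \<xi>" for \<xi>
  proof -
    have "\<pi> (adj A x \<cdot> x) \<xi> = hilbert_adjoint (\<pi> x) (\<pi> x \<xi>)"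
      using x hom_times[of "adj A x" x \<xi>] h(5)[OF x x] by (simp add: bounded_operators_def)
    then have "norm (\<pi> (adj A x \<cdot> x) \<xi>) \<le> k * norm (\<pi> x \<xi>)"
      using norm_hilbert_adjoint_le[OF op[OF x]] by (simp add: k_def)
    also have "\<dots> \<le> k * (k * norm \<xi>)"
      unfolding k_def by (intro mult_left_mono onorm bl nonneg x)
    finally show ?thesis by (simp add: power2_eq_square algebra_simps)
  qed
  then have "onorm (\<pi> (adj A x \<cdot> x)) \<le> k\<^sup>2" by (intro onorm_bound) auto
  then have "(onorm (\<pi> (adj A x \<cdot> x)))\<^sup>2 \<le> (k\<^sup>2)\<^sup>2" using x by (intro power_mono nonneg) auto
  moreover have "((cnorm A x)\<^sup>2)\<^sup>2 \<le> 2 * (onorm (\<pi> (adj A x \<cdot> x)))\<^sup>2"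
    using sa[of "adj A x \<cdot> x"] x by (simp add: adj_times cstar_identity)
  ultimately have "(cnorm A x)^4 \<le> 2 * k^4"
    by (simp flip: power_mult)
  also have "2 * k^4 \<le> (2 * k)^4" by (simp add: power_mult_distrib)
  finally show ?thesis
    using nonneg[OF x] power_mono_iff[of "cnorm A x" "2 * k" 4] norm_ge_zero[OF x] by (simp add: k_def)
qed

end

section \<open>Eigenvectors and maximal commutative subalgebras\<close>

lemma independent_card_le_dim_span:
  assumes "complex_vector.independent P" "P \<subseteq> W" "W \<subseteq> complex_vector.span S" "finite S"
  shows "finite P \<and> card P \<le> complex_vector.dim W"
proof -
  obtain D where D: "D \<subseteq> W" "complex_vector.independent D" "W \<subseteq> complex_vector.span D"
    "card D = complex_vector.dim W"
    using complex_vector.basis_exists[of W] by blast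
  have "finite D" using complex_vector.independent_span_bound[OF assms(4) D(2)] D(1) assms(3) by blast
  then show ?thesis
    using complex_vector.independent_span_bound[OF _ assms(1), of D] D assms(2) by auto
qed

lemma subspace_eq_if_dim_le:
  assumes U: "complex_vector.subspace U" "U \<subseteq> W" and W: "W \<subseteq> complex_vector.span S" "finite S"
    and dim: "complex_vector.dim W \<le> complex_vector.dim U"
  shows "U = W"
proof (rule ccontr)
  assume "U \<noteq> W"
  then obtain w where w: "w \<in> W" "w \<notin> U" using U by blast
  obtain D where D: "D \<subseteq> U" "complex_vector.independent D" "U \<subseteq> complex_vector.span D"
    "card D = complex_vector.dim U"
    using complex_vector.basis_exists[of U] by blast
  have "complex_vector.span D \<subseteq> U" using D U by (intro complex_vector.span_minimal)
  then have "w \<notin> complex_vector.span D" using w by blast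
  then have "complex_vector.independent (insert w D)"
    using D by (intro complex_vector.independent_insertI) auto
  then have "finite (insert w D) \<and> card (insert w D) \<le> complex_vector.dim W"
    using D U w W by (intro independent_card_le_dim_span) auto
  moreover have "w \<notin> D" using w D by blast
  ultimately show False using dim D by auto
qed

text \<open>A nonzero polynomial of least degree annihilating v has a root z; its cofactor, applied to v,
  is nonzero by minimality and is an eigenvector for z.\<close>

lemma finite_dim_eigenvector:
  fixes T :: "'a::complex_vector \<Rightarrow> 'a"
  assumes W: "complex_vector.subspace W" "W \<subseteq> complex_vector.span S" "finite S"
    and T: "\<And>x. x \<in> W \<Longrightarrow> T x \<in> W" "\<And>x y. x \<in> W \<Longrightarrow> y \<in> W \<Longrightarrow> T (x + y) = T x + T y"
      "\<And>c x. x \<in> W \<Longrightarrow> T (scaleC c x) = scaleC c (T x)"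
    and v: "v \<in> W" "v \<noteq> 0"
  obtains c u where "u \<in> W" "u \<noteq> 0" "T u = scaleC c u"
proof -
  have W0: "0 \<in> W" and Wadd: "\<And>x y. x \<in> W \<Longrightarrow> y \<in> W \<Longrightarrow> x + y \<in> W"
    and Wsc: "\<And>c x. x \<in> W \<Longrightarrow> scaleC c x \<in> W"
    using W(1) by (auto simp: complex_vector.subspace_def)
  have T0: "T 0 = 0" using T(3)[OF W0, of 0] by simp
  \<comment> \<open>Horner's scheme for the value at \<open>v\<close> of the polynomial \<open>p\<close> in \<open>T\<close>\<close>
  define ev where "ev p = fold_coeffs (\<lambda>a w. scaleC a v + T w) p 0" for p
  have ev0: "ev 0 = 0" by (simp add: ev_def)
  have evC: "ev (pCons a p) = scaleC a v + T (ev p)" for a p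
    by (cases "p = 0 \<and> a = 0") (auto simp: ev_def T0)
  have evW: "ev p \<in> W" for p
    by (induction p) (auto simp: ev0 evC W0 intro!: Wadd Wsc T v)
  have ev_add: "ev (p + q) = ev p + ev q" for p q
    by (induction p q rule: poly_induct2)
      (simp_all add: ev0 evC T evW complex_vector.scale_left_distrib algebra_simps)
  have ev_smult: "ev (smult c p) = scaleC c (ev p)" for c p
    by (induction p) (simp_all add: ev0 evC T evW complex_vector.scale_right_distrib)
  have ev_sum: "ev (sum f I) = (\<Sum>i\<in>I. ev (f i))" for f and I :: "nat set"
    by (induction I rule: infinite_finite_induct) (simp_all add: ev0 ev_add)
  have "\<exists>p. p \<noteq> 0 \<and> ev p = 0"
  proof (cases "inj_on (\<lambda>i. ev (monom 1 i)) {..card S}")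
    case False
    then obtain i j where ij: "i \<noteq> j" "ev (monom 1 i) = ev (monom 1 j)" by (auto simp: inj_on_def)
    have "ev (monom 1 i + smult (-1) (monom 1 j)) = 0"
      unfolding ev_add ev_smult using ij by simp
    moreover have "coeff (monom (1::complex) i + smult (-1) (monom 1 j)) i \<noteq> 0" using ij by simp
    ultimately show ?thesis by (metis coeff_0)
  next
    case True
    let ?V = "(\<lambda>i. ev (monom 1 i)) ` {..card S}"
    have "card ?V = Suc (card S)" using True by (simp add: card_image)
    then have "complex_vector.dependent ?V"
      using complex_vector.independent_span_bound[OF W(3), of ?V] W(2) evW by fastforce
    then obtain t u where t: "finite t" "t \<subseteq> ?V" "(\<Sum>x\<in>t. scaleC (u x) x) = 0" "\<exists>x\<in>t. u x \<noteq> 0"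
      unfolding complex_vector.dependent_explicit by blast
    define I where "I = {i\<in>{..card S}. ev (monom 1 i) \<in> t}"
    define p where "p = (\<Sum>i\<in>I. smult (u (ev (monom 1 i))) (monom 1 i))"
    have "bij_betw (\<lambda>i. ev (monom 1 i)) I t"
      using True t(2) by (auto simp: bij_betw_def I_def intro: inj_on_subset)
    from sum.reindex_bij_betw[OF this, of "\<lambda>x. scaleC (u x) x"]
    have "ev p = 0" using t(3) by (simp add: p_def ev_sum ev_smult)
    moreover obtain x where x: "x \<in> t" "u x \<noteq> 0" using t by blast
    then obtain i where i: "i \<in> I" "x = ev (monom 1 i)" using t(2) by (auto simp: I_def)
    have "coeff p i = u x"
      using i by (simp add: p_def coeff_sum I_def if_distrib sum.delta cong: if_cong)
    then have "p \<noteq> 0" using x by auto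
    ultimately show ?thesis by blast
  qed
  then obtain p where p: "p \<noteq> 0" "ev p = 0"
    and min: "\<And>q. q \<noteq> 0 \<Longrightarrow> ev q = 0 \<Longrightarrow> degree p \<le> degree q"
    using ex_has_least_nat[of "\<lambda>p. p \<noteq> 0 \<and> ev p = 0" _ degree] by blast
  have "degree p \<noteq> 0"
  proof
    assume "degree p = 0"
    then obtain c where c: "p = [:c:]" using degree_eq_zeroE by blast
    then have "scaleC c v = 0" using p(2) by (simp add: evC ev0 T0)
    then show False using v p(1) c by simp
  qed
  then have "\<not> constant (poly p)" by (simp add: constant_degree)
  then obtain z where "poly p z = 0" using fundamental_theorem_of_algebra by blast
  then obtain q where q: "p = [:-z, 1:] * q" by (metis poly_eq_0_iff_dvd dvdE)
  have q0: "q \<noteq> 0" using q p(1) by auto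
  then have "degree q < degree p" unfolding q by (subst degree_mult_eq) auto
  then have "ev q \<noteq> 0" using min[OF q0] by fastforce
  have "p = smult (- z) q + pCons 0 q" using q by simp
  then have "ev p = scaleC (- z) (ev q) + T (ev q)" by (simp only: ev_add ev_smult evC) simp
  then have "T (ev q) = scaleC z (ev q)" using p(2) by simp
  then show thesis using that evW \<open>ev q \<noteq> 0\<close> by blast
qed

context cstar_algebra
begin

lemma cstar_subalgebraI:
  assumes C: "C \<subseteq> carr A" "complex_vector.subspace C"
    and times: "\<And>x y. x \<in> C \<Longrightarrow> y \<in> C \<Longrightarrow> x \<cdot> y \<in> C" and adj: "\<And>x. x \<in> C \<Longrightarrow> adj A x \<in> C"
    and lim: "\<And>s l. (\<And>n. s n \<in> C) \<Longrightarrow> l \<in> carr A \<Longrightarrow> tends s l \<Longrightarrow> l \<in> C"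
  shows "cstar_subalgebra C A"
proof -
  have c: "x \<in> carr A" if "x \<in> C" for x using C that by blast
  have "\<exists>l\<in>C. tends s l"
    if "\<And>n. s n \<in> C" "\<And>e. e > 0 \<Longrightarrow> \<exists>N. \<forall>m\<ge>N. \<forall>n\<ge>N. cnorm A (s m - s n) < e" for s
    using complete[of s] that lim[of s] c by blast
  then have "cstar_algebra (A\<lparr>carr := C\<rparr>)"
    by unfold_locales (simp_all add: C times adj c times_assoc times_add_left times_add_right
        times_scale_left times_scale_right adj_add adj_scale adj_times norm_ge_zero norm_eq_zero
        norm_triangle norm_scale norm_times cstar_identity)
  then show ?thesis using C by (simp add: cstar_subalgebra_def)
qed

definition commutant :: "'a set \<Rightarrow> 'a set" where
  "commutant Z = {x \<in> carr A. \<forall>z\<in>Z. x \<cdot> z = z \<cdot> x}"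

lemma commutant_subalgebra:
  assumes Z: "Z \<subseteq> carr A" and adj: "\<And>z. z \<in> Z \<Longrightarrow> adj A z \<in> Z"
  shows "cstar_subalgebra (commutant Z) A"
proof (rule cstar_subalgebraI)
  have c: "z \<in> carr A" if "z \<in> Z" for z using Z that by blast
  show "complex_vector.subspace (commutant Z)"
    by (auto simp: complex_vector.subspace_def commutant_def c alg_simps)
  show "x \<cdot> y \<in> commutant Z" if "x \<in> commutant Z" "y \<in> commutant Z" for x y
    using that by (auto simp: commutant_def c times_assoc) (metis c times_assoc)
  show "adj A x \<in> commutant Z" if x: "x \<in> commutant Z" for x
  proof -
    have "adj A x \<cdot> z = z \<cdot> adj A x" if z: "z \<in> Z" for z
    proof -
      have "adj A (adj A z \<cdot> x) = adj A (x \<cdot> adj A z)"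
        using x adj[OF z] by (auto simp: commutant_def)
      then show ?thesis using x z c by (simp add: commutant_def adj_times)
    qed
    then show ?thesis using x by (simp add: commutant_def)
  qed
  show "l \<in> commutant Z" if s: "\<And>n. s n \<in> commutant Z" and l: "l \<in> carr A" "tends s l" for s l
  proof -
    have sc: "s n \<in> carr A" for n using s[of n] by (simp add: commutant_def)
    have "l \<cdot> z = z \<cdot> l" if z: "z \<in> Z" for z
    proof (rule tends_unique)
      show "tends (\<lambda>n. s n \<cdot> z) (l \<cdot> z)" using tends_times_right[OF l(2) sc l(1) c[OF z]] .
      have "s n \<cdot> z = z \<cdot> s n" for n using s[of n] z by (simp add: commutant_def)
      then show "tends (\<lambda>n. s n \<cdot> z) (z \<cdot> l)" using tends_times_left[OF l(2) sc l(1) c[OF z]] by simp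
    qed (use sc l c z in auto)
    then show ?thesis using l by (simp add: commutant_def)
  qed
qed (auto simp: commutant_def)

lemma maximal_commutative_exists:
  assumes S: "finite S" "carr A \<subseteq> complex_vector.span S"
  shows "\<exists>C. maximal_commutative C A"
proof -
  let ?P = "\<lambda>C. commutative_subalgebra C A"
  have "cstar_subalgebra {0} A"
  proof (rule cstar_subalgebraI)
    show "l \<in> {0}" if "\<And>n. s n \<in> {0}" "l \<in> carr A" "tends s l" for s l
      using tends_unique[of s l 0] that by simp
  qed (auto simp: complex_vector.subspace_0 complex_vector.subspace_def)
  then have "?P {0}" by (simp add: commutative_subalgebra_def)
  moreover have "complex_vector.dim C < Suc (card S)" if "?P C" for C
  proof -
    have "C \<subseteq> complex_vector.span S"
      using that S by (auto simp: commutative_subalgebra_def cstar_subalgebra_def)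
    then show ?thesis using complex_vector.dim_le_card[OF _ S(1)] by (simp add: less_Suc_eq_le)
  qed
  ultimately obtain C where C: "?P C"
    and max: "\<And>D. ?P D \<Longrightarrow> complex_vector.dim D \<le> complex_vector.dim C"
    using ex_has_greatest_nat[of ?P "{0}" complex_vector.dim "Suc (card S)"] by blast
  have "D = C" if D: "?P D" "C \<subseteq> D" for D
  proof -
    have "complex_vector.subspace C"
      using C cstar_algebra.subspace[of "A\<lparr>carr := C\<rparr>"]
      by (simp add: commutative_subalgebra_def cstar_subalgebra_def)
    moreover have "D \<subseteq> complex_vector.span S"
      using D(1) S by (auto simp: commutative_subalgebra_def cstar_subalgebra_def)
    ultimately show ?thesis using subspace_eq_if_dim_le[of C D S] D S max by blast
  qed
  then show ?thesis using C by (auto simp: maximal_commutative_def)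
qed

text \<open>Choose \<open>y \<noteq> 0\<close> such that the ideal \<open>y A\<close> has least dimension.  If u in this ideal is an eigenvector of
  multiplication by x, then \<open>u A\<close> is the whole ideal, so x acts on \<open>y A\<close> as a scalar.  In particular
  \<open>y y*\<close> acts on itself as a scalar, and a multiple of it is a projection.\<close>

lemma commutative_minimal_projection:
  assumes comm: "\<And>x y. x \<in> carr A \<Longrightarrow> y \<in> carr A \<Longrightarrow> x \<cdot> y = y \<cdot> x"
    and S: "finite S" "carr A \<subseteq> complex_vector.span S" and ne: "x0 \<in> carr A" "x0 \<noteq> 0"
  obtains e where "e \<in> carr A" "e \<noteq> 0" "adj A e = e" "e \<cdot> e = e"
    "\<And>x. x \<in> carr A \<Longrightarrow> \<exists>c. x \<cdot> e = scaleC c e"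
proof -
  let ?I = "\<lambda>y. (\<lambda>d. y \<cdot> d) ` carr A"
  have sub: "complex_vector.subspace (?I y)" if y: "y \<in> carr A" for y
    unfolding complex_vector.subspace_def
  proof (intro conjI ballI allI)
    show "0 \<in> ?I y" using y by (intro image_eqI[of _ _ 0]) auto
    fix u v c assume "u \<in> ?I y" "v \<in> ?I y"
    then obtain d e where de: "u = y \<cdot> d" "v = y \<cdot> e" "d \<in> carr A" "e \<in> carr A" by blast
    show "u + v \<in> ?I y" using de y by (intro image_eqI[of _ _ "d + e"]) (auto simp: times_add_right)
  next
    fix u c assume "u \<in> ?I y"
    then obtain d where d: "u = y \<cdot> d" "d \<in> carr A" by blast
    show "scaleC c u \<in> ?I y" using d y by (intro image_eqI[of _ _ "scaleC c d"]) (auto simp: times_scale_right)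
  qed
  have sp: "?I y \<subseteq> complex_vector.span S" if "y \<in> carr A" for y using S that by auto
  obtain y where y: "y \<in> carr A" "y \<noteq> 0"
    and min: "\<And>z. z \<in> carr A \<Longrightarrow> z \<noteq> 0 \<Longrightarrow> complex_vector.dim (?I y) \<le> complex_vector.dim (?I z)"
    using ex_has_least_nat[of "\<lambda>y. y \<in> carr A \<and> y \<noteq> 0" x0 "\<lambda>y. complex_vector.dim (?I y)"] ne by blast
  let ?W = "?I y"
  have scalar: "\<exists>c. \<forall>z\<in>?W. x \<cdot> z = scaleC c z" if x: "x \<in> carr A" for x
  proof -
    define b where "b = y \<cdot> adj A y"
    have Wc: "u \<in> carr A" if "u \<in> ?W" for u using that y by auto
    have "\<exists>c u. u \<in> ?W \<and> u \<noteq> 0 \<and> x \<cdot> u = scaleC c u"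
    proof (rule finite_dim_eigenvector[OF sub[OF y(1)] sp[OF y(1)] S(1), of "\<lambda>z. x \<cdot> z" b])
      show "b \<noteq> 0" using adj_times_self_eq_0[of y] y comm[of y "adj A y"] by (auto simp: b_def)
      show "b \<in> ?W" using y by (auto simp: b_def)
      show "x \<cdot> z \<in> ?W" if "z \<in> ?W" for z
      proof -
        obtain d where d: "z = y \<cdot> d" "d \<in> carr A" using \<open>z \<in> ?W\<close> by blast
        have "x \<cdot> z = (x \<cdot> y) \<cdot> d" using d x y(1) by (simp add: times_assoc)
        also have "\<dots> = y \<cdot> (x \<cdot> d)" unfolding comm[OF x y(1)] using d x y(1) by (simp add: times_assoc)
        finally have "x \<cdot> z = y \<cdot> (x \<cdot> d)" .
        then show ?thesis using d x by auto
      qed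
      show "x \<cdot> (u + v) = x \<cdot> u + x \<cdot> v" if "u \<in> ?W" "v \<in> ?W" for u v
        by (rule times_add_right[OF x Wc[OF that(1)] Wc[OF that(2)]])
      show "x \<cdot> scaleC k u = scaleC k (x \<cdot> u)" if "u \<in> ?W" for k u
        by (rule times_scale_right[OF x Wc[OF that]])
    qed blast
    then obtain c u where u: "u \<in> ?W" "u \<noteq> 0" "x \<cdot> u = scaleC c u" by blast
    obtain d where d: "u = y \<cdot> d" "d \<in> carr A" using u(1) by blast
    have uc: "u \<in> carr A" using d y by simp
    have "?I u \<subseteq> ?W"
    proof safe
      fix e assume e: "e \<in> carr A"
      then have "u \<cdot> e = y \<cdot> (d \<cdot> e)" using d y by (simp add: times_assoc)
      then show "u \<cdot> e \<in> ?W" using d e by auto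
    qed
    then have IW: "?I u = ?W"
      by (rule subspace_eq_if_dim_le[OF sub[OF uc] _ sp[OF y(1)] S(1) min[OF uc u(2)]])
    have "x \<cdot> z = scaleC c z" if "z \<in> ?W" for z
    proof -
      have "z \<in> ?I u" unfolding IW by (rule that)
      then obtain e where e: "z = u \<cdot> e" "e \<in> carr A" by (rule imageE)
      then have "x \<cdot> z = (x \<cdot> u) \<cdot> e" using x uc by (simp add: times_assoc)
      also have "\<dots> = scaleC c z" unfolding u(3) using e uc by (simp add: times_scale_left)
      finally show ?thesis .
    qed
    then show ?thesis by blast
  qed
  define b where "b = y \<cdot> adj A y"
  have b: "b \<in> carr A" "adj A b = b" "b \<in> ?W" using y by (auto simp: b_def adj_times)
  have "b \<noteq> 0" using adj_times_self_eq_0[of y] y comm[of y "adj A y"] by (auto simp: b_def)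
  obtain c where c: "b \<cdot> b = scaleC c b" using scalar[OF b(1)] b(3) by blast
  have "c \<noteq> 0" using adj_times_self_eq_0[of b] b c \<open>b \<noteq> 0\<close> by auto
  have "adj A (b \<cdot> b) = b \<cdot> b" using b by (simp add: adj_times)
  then have "scaleC (cnj c) b = scaleC c b" unfolding c using b by (simp add: adj_scale)
  then have "cnj c = c" using \<open>b \<noteq> 0\<close> by simp
  define e where "e = scaleC (1 / c) b"
  have e: "e \<in> carr A" "e \<noteq> 0" using b \<open>b \<noteq> 0\<close> \<open>c \<noteq> 0\<close> by (auto simp: e_def)
  have "adj A e = e" using b \<open>cnj c = c\<close> by (simp add: e_def adj_scale)
  moreover have "e \<cdot> e = e" using b c \<open>c \<noteq> 0\<close> by (simp add: e_def times_scale_left times_scale_right)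
  moreover have "\<exists>k. x \<cdot> e = scaleC k e" if x: "x \<in> carr A" for x
  proof -
    obtain k where "x \<cdot> b = scaleC k b" using scalar[OF x] b(3) by blast
    then show ?thesis using x b by (intro exI[of _ k]) (simp add: e_def times_scale_right mult.commute)
  qed
  ultimately show thesis using that e by blast
qed

text \<open>For self-adjoint z, the double commutant of C and z is a commutative C*-subalgebra containing
  both, so it equals C.  Commutants are closed for free, whereas for a generated subalgebra
  completeness would be a separate matter.  A general z is a combination of the self-adjoint
  elements \<open>z + z*\<close> and \<open>i (z - z*)\<close>.\<close>

lemma maximal_commutative_contains_commuting:
  assumes C: "maximal_commutative C A" and z: "z \<in> carr A" and comm: "\<And>c. c \<in> C \<Longrightarrow> c \<cdot> z = z \<cdot> c"
  shows "z \<in> C"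
proof -
  have Csub: "C \<subseteq> carr A" and Calg: "cstar_algebra (A\<lparr>carr := C\<rparr>)"
    and Ccomm: "\<And>x y. x \<in> C \<Longrightarrow> y \<in> C \<Longrightarrow> x \<cdot> y = y \<cdot> x"
    using C by (auto simp: maximal_commutative_def commutative_subalgebra_def cstar_subalgebra_def)
  interpret C: cstar_algebra "A\<lparr>carr := C\<rparr>" by (rule Calg)
  have cc: "c \<in> carr A" if "c \<in> C" for c using Csub that by blast
  have Cadj: "adj A c \<in> C" if "c \<in> C" for c using C.adj_closed[of c] that by simp
  have sa: "h \<in> C" if h: "h \<in> carr A" "adj A h = h" "\<And>c. c \<in> C \<Longrightarrow> c \<cdot> h = h \<cdot> c" for h
  proof -
    let ?Z = "insert h C"
    let ?D = "commutant (commutant ?Z)"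
    have Z: "?Z \<subseteq> carr A" using h Csub by blast
    have Zadj: "adj A y \<in> ?Z" if "y \<in> ?Z" for y using that h Cadj by auto
    have "x \<cdot> y = y \<cdot> x" if "x \<in> ?Z" "y \<in> ?Z" for x y
      using that Ccomm h(3) by auto
    then have ZZ: "?Z \<subseteq> commutant ?Z" using Z unfolding commutant_def by blast
    have ZD: "?Z \<subseteq> ?D" using Z unfolding commutant_def by auto
    have "?D \<subseteq> commutant ?Z" using ZZ unfolding commutant_def by auto
    then have "\<forall>x\<in>?D. \<forall>y\<in>?D. x \<cdot> y = y \<cdot> x" unfolding commutant_def[of "commutant ?Z"] by blast
    moreover have "cstar_subalgebra ?D A"
    proof (rule commutant_subalgebra)
      have "cstar_subalgebra (commutant ?Z) A" using Z Zadj by (rule commutant_subalgebra)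
      then interpret Z: cstar_algebra "A\<lparr>carr := commutant ?Z\<rparr>" by (simp add: cstar_subalgebra_def)
      show "adj A y \<in> commutant ?Z" if "y \<in> commutant ?Z" for y using Z.adj_closed[of y] that by simp
    qed (simp add: commutant_def)
    ultimately have "commutative_subalgebra ?D A" by (simp add: commutative_subalgebra_def)
    then have "?D = C" using C ZD unfolding maximal_commutative_def by blast
    then show ?thesis using ZD by blast
  qed
  have comm': "c \<cdot> adj A z = adj A z \<cdot> c" if c: "c \<in> C" for c
  proof -
    have "adj A (adj A c \<cdot> z) = adj A (z \<cdot> adj A c)" using comm[OF Cadj[OF c]] by simp
    then show ?thesis using cc[OF c] z by (simp add: adj_times)
  qed
  have 1: "z + adj A z \<in> C"
    using z comm comm' cc by (intro sa) (auto simp: adj_add times_add_left times_add_right add.commute)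
  have 2: "scaleC \<i> (z - adj A z) \<in> C"
  proof (rule sa)
    show "adj A (scaleC \<i> (z - adj A z)) = scaleC \<i> (z - adj A z)"
      using z by (simp add: adj_scale adj_diff complex_vector.scale_right_diff_distrib)
  qed (use z comm comm' cc in \<open>auto simp: alg_simps\<close>)
  have 3: "z - adj A z \<in> C"
    using C.scale_closed[of "scaleC \<i> (z - adj A z)" "- \<i>"] 2 by simp
  have "scaleC (1/2) (z + z) \<in> C"
    using C.scale_closed[OF C.add_closed[of "z + adj A z" "z - adj A z"], of "1/2"] 1 3 by simp
  moreover have "z + z = scaleC 2 z" using scaleC_add_left[of 1 1 z] by simp
  ultimately show ?thesis by simp
qed

end

section \<open>The trace of a finite-dimensional C*-algebra\<close>

locale finite_dim_masa = cstar_algebra A for A :: "'a::complex_vector cstar" (structure) +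
  fixes C S :: "'a set"
  assumes masa: "maximal_commutative C A" and fin: "finite S" and span: "carr A \<subseteq> complex_vector.span S"
begin

lemma C_carr [simp]: "c \<in> C \<Longrightarrow> c \<in> carr A"
  using masa by (auto simp: maximal_commutative_def commutative_subalgebra_def cstar_subalgebra_def)

lemma C_comm: "x \<in> C \<Longrightarrow> y \<in> C \<Longrightarrow> x \<cdot> y = y \<cdot> x"
  using masa by (auto simp: maximal_commutative_def commutative_subalgebra_def)

sublocale C: cstar_algebra "A\<lparr>carr := C\<rparr>"
  using masa by (simp add: maximal_commutative_def commutative_subalgebra_def cstar_subalgebra_def)

text \<open>These are the minimal projections of C; the lemmas below show that they are orthogonal and sum
  up to a unit of the whole algebra.\<close>

definition atoms :: "'a set" where
  "atoms = {e \<in> C. e \<noteq> 0 \<and> adj A e = e \<and> e \<cdot> e = e \<and> (\<forall>x\<in>C. \<exists>c. x \<cdot> e = scaleC c e)}"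

lemma atomsD:
  assumes "p \<in> atoms"
  shows "p \<in> C" "p \<in> carr A" "p \<noteq> 0" "adj A p = p" "p \<cdot> p = p" "x \<in> C \<Longrightarrow> \<exists>c. x \<cdot> p = scaleC c p"
  using assms by (auto simp: atoms_def)

lemma atoms_orthogonal:
  assumes p: "p \<in> atoms" and q: "q \<in> atoms" and "p \<noteq> q"
  shows "p \<cdot> q = 0"
proof (rule ccontr)
  assume ne: "p \<cdot> q \<noteq> 0"
  note p = atomsD[OF p] and q = atomsD[OF q]
  obtain c where c: "p \<cdot> q = scaleC c q" using q(6)[OF p(1)] by blast
  obtain d where d: "q \<cdot> p = scaleC d p" using p(6)[OF q(1)] by blast
  have "c \<noteq> 0" "d \<noteq> 0" using ne c d C_comm[OF p(1) q(1)] by auto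
  have "scaleC d p = scaleC c q" using c d C_comm[OF p(1) q(1)] by simp
  then have "scaleC (1 / d) (scaleC d p) = scaleC (1 / d) (scaleC c q)" by simp
  then have pq: "p = scaleC (c / d) q" using \<open>d \<noteq> 0\<close> by simp
  have "scaleC (c / d * (c / d)) q = scaleC (c / d) q"
    using p(5) q(2,5) unfolding pq by (simp add: times_scale_left times_scale_right)
  then have "c / d = 1" using \<open>c \<noteq> 0\<close> \<open>d \<noteq> 0\<close> q(3) by (simp add: field_simps)
  then show False using pq \<open>p \<noteq> q\<close> by simp
qed

lemma atoms_times: "p \<in> atoms \<Longrightarrow> q \<in> atoms \<Longrightarrow> p \<cdot> q = (if p = q then p else 0)"
  using atoms_orthogonal atomsD(5) by auto

lemma atoms_finite: "finite atoms \<and> card atoms \<le> complex_vector.dim C"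
proof (rule independent_card_le_dim_span[of atoms C S])
  show "complex_vector.independent atoms"
    unfolding complex_vector.dependent_explicit
  proof safe
    fix t u v assume t: "finite t" "t \<subseteq> atoms" and s: "(\<Sum>v\<in>t. scaleC (u v) v) = 0" and v: "v \<in> t" "u v \<noteq> 0"
    have va: "v \<in> atoms" using t v by blast
    have ta: "w \<in> carr A" if "w \<in> t" for w using t that atomsD(2) by blast
    have "v \<cdot> (\<Sum>w\<in>t. scaleC (u w) w) = (\<Sum>w\<in>t. v \<cdot> scaleC (u w) w)"
      using ta v by (intro times_sum_right) auto
    also have "\<dots> = (\<Sum>w\<in>t. if v = w then scaleC (u v) v else 0)"
      using t ta va atomsD(2)[OF va] by (intro sum.cong refl) (auto simp: times_scale_right atoms_times subset_iff)
    also have "\<dots> = scaleC (u v) v" using t v by simp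
    finally show False using s v atomsD(2,3)[OF va] by simp
  qed
  show "C \<subseteq> complex_vector.span S" using span by auto
qed (use fin in \<open>auto simp: atoms_def\<close>)

text \<open>The elements of C that annihilate all atoms form a C*-algebra, and a minimal projection of this
  algebra would be an atom annihilating itself.\<close>

lemma eq_0_if_annihilates_atoms_C:
  assumes x: "x \<in> C" and xp: "\<And>p. p \<in> atoms \<Longrightarrow> x \<cdot> p = 0"
  shows "x = 0"
proof (rule ccontr)
  assume "x \<noteq> 0"
  define D where "D = {x \<in> C. \<forall>p\<in>atoms. x \<cdot> p = 0}"
  have Cc: "0 \<in> C" "a + b \<in> C" "scaleC k a \<in> C" "a \<cdot> b \<in> C" "adj A a \<in> C" if "a \<in> C" "b \<in> C" for a b k
    using C.zero_closed C.add_closed[of a b] C.scale_closed[of a k] C.times_closed[of a b] C.adj_closed[of a] that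
    by simp_all
  have "cstar_subalgebra D (A\<lparr>carr := C\<rparr>)"
  proof (rule C.cstar_subalgebraI)
    show "complex_vector.subspace D"
      using x by (auto simp: complex_vector.subspace_def D_def Cc atomsD times_add_left times_scale_left)
    show "times_alg (A\<lparr>carr := C\<rparr>) a b \<in> D" if "a \<in> D" "b \<in> D" for a b
      using that by (auto simp: D_def Cc atomsD times_assoc)
    show "adj (A\<lparr>carr := C\<rparr>) a \<in> D" if a: "a \<in> D" for a
    proof -
      have "adj A a \<cdot> p = 0" if p: "p \<in> atoms" for p
      proof -
        have aC: "a \<in> C" using a by (simp add: D_def)
        have "adj A a \<cdot> p = adj A (p \<cdot> a)" using aC p by (simp add: adj_times atomsD)
        also have "p \<cdot> a = a \<cdot> p" using aC p by (intro C_comm) (simp_all add: atomsD)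
        also have "a \<cdot> p = 0" using a p by (simp add: D_def)
        finally show ?thesis by simp
      qed
      then show ?thesis using a Cc(5)[of a a] by (simp add: D_def)
    qed
    show "l \<in> D" if s: "\<And>n. s n \<in> D" and l: "l \<in> carr (A\<lparr>carr := C\<rparr>)" "C.tends s l" for s l
    proof -
      have "l \<cdot> p = 0" if p: "p \<in> atoms" for p
      proof (rule tends_unique)
        have sC: "s n \<in> carr A" for n using s[of n] by (simp add: D_def)
        show "tends (\<lambda>n. s n \<cdot> p) (l \<cdot> p)"
          using l sC p by (intro tends_times_right) (simp_all add: atomsD)
        show "tends (\<lambda>n. s n \<cdot> p) 0" using s p by (simp add: D_def)
        show "s n \<cdot> p \<in> carr A" for n using sC p by (simp add: atomsD)
      qed (use l p in \<open>auto simp: atomsD\<close>)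
      then show ?thesis using l by (simp add: D_def)
    qed
  qed (auto simp: D_def)
  then interpret D: cstar_algebra "A\<lparr>carr := D\<rparr>" by (simp add: cstar_subalgebra_def)
  have "x \<in> D" using x xp by (simp add: D_def)
  then obtain e where e: "e \<in> D" "e \<noteq> 0" "adj A e = e" "e \<cdot> e = e"
    and sc: "\<And>y. y \<in> D \<Longrightarrow> \<exists>c. y \<cdot> e = scaleC c e"
    using D.commutative_minimal_projection[OF _ fin, of x] \<open>x \<noteq> 0\<close> span C_comm
    by (auto simp: D_def subset_iff)
  have eC: "e \<in> C" "\<And>p. p \<in> atoms \<Longrightarrow> e \<cdot> p = 0" using e by (auto simp: D_def)
  have "\<exists>c. y \<cdot> e = scaleC c e" if y: "y \<in> C" for y
  proof -
    have "y \<cdot> e \<in> D" using y eC Cc by (auto simp: D_def times_assoc atomsD)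
    then obtain c where "(y \<cdot> e) \<cdot> e = scaleC c e" using sc by blast
    then show ?thesis using y eC e by (auto simp: times_assoc)
  qed
  then have "e \<in> atoms" using e eC by (simp add: atoms_def)
  then show False using eC(2) e by auto
qed

definition unit_sum :: 'a where "unit_sum = \<Sum>atoms"

lemma unit_sum_closed [simp]: "unit_sum \<in> carr A"
  unfolding unit_sum_def by (rule sum_closed) (rule atomsD)

lemma unit_sum_times_atom: "p \<in> atoms \<Longrightarrow> unit_sum \<cdot> p = p"
  unfolding unit_sum_def using atoms_finite
  by (subst times_sum_left) (auto simp: atomsD atoms_times sum.If_cases cong: sum.cong)

text \<open>The product \<open>y* y\<close> annihilates every atom and therefore all of C, from both sides.  So it commutes
  with C, lies in C by maximality, and vanishes by the previous lemma.\<close>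

lemma eq_0_if_annihilates_atoms:
  assumes y: "y \<in> carr A" and yp: "\<And>p. p \<in> atoms \<Longrightarrow> y \<cdot> p = 0"
  shows "y = 0"
proof -
  let ?z = "adj A y \<cdot> y"
  have z: "?z \<in> carr A" using y by simp
  have zp: "?z \<cdot> p = 0" if "p \<in> atoms" for p using that y yp by (simp add: times_assoc atomsD)
  have zc: "?z \<cdot> c = 0" if c: "c \<in> C" for c
  proof -
    have Cu: "unit_sum \<in> C"
      unfolding unit_sum_def using C.sum_closed[of atoms "\<lambda>x. x"] atomsD(1) by simp
    have cu: "c \<cdot> unit_sum \<in> C" using C.times_closed[of c unit_sum] c Cu by simp
    have "c - c \<cdot> unit_sum = 0"
    proof (rule eq_0_if_annihilates_atoms_C)
      show "c - c \<cdot> unit_sum \<in> C" using C.diff_closed[of c "c \<cdot> unit_sum"] c cu by simp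
      show "(c - c \<cdot> unit_sum) \<cdot> p = 0" if "p \<in> atoms" for p
        using that c by (simp add: times_diff_left times_assoc atomsD unit_sum_times_atom)
    qed
    then have "c = c \<cdot> unit_sum" by simp
    also have "\<dots> = (\<Sum>p\<in>atoms. c \<cdot> p)"
      unfolding unit_sum_def using c by (intro times_sum_right) (auto simp: atomsD)
    finally have "?z \<cdot> c = (\<Sum>p\<in>atoms. ?z \<cdot> (c \<cdot> p))"
      using times_sum_right[of atoms "\<lambda>p. c \<cdot> p" ?z] z c by (simp add: atomsD)
    also have "\<dots> = 0"
    proof (rule sum.neutral, rule ballI)
      fix p assume p: "p \<in> atoms"
      obtain k where "c \<cdot> p = scaleC k p" using atomsD(6)[OF p c] by blast
      then show "?z \<cdot> (c \<cdot> p) = 0" using z p zp by (simp add: times_scale_right atomsD del: times_closed)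
    qed
    finally show ?thesis .
  qed
  have "c \<cdot> ?z = ?z \<cdot> c" if c: "c \<in> C" for c
  proof -
    have "adj A c \<in> C" using C.adj_closed[of c] c by simp
    from arg_cong[OF zc[OF this], of "adj A"] have "c \<cdot> ?z = 0" using c y by (simp add: adj_times)
    then show ?thesis using zc[OF c] by simp
  qed
  then have "?z \<in> C" by (rule maximal_commutative_contains_commuting[OF masa z])
  then have "?z = 0" using zp by (rule eq_0_if_annihilates_atoms_C)
  then show ?thesis using adj_times_self_eq_0 y by blast
qed

lemma times_unit_sum: assumes x: "x \<in> carr A" shows "x \<cdot> unit_sum = x"
proof -
  have "x - x \<cdot> unit_sum = 0"
    by (rule eq_0_if_annihilates_atoms)
      (simp_all add: x times_diff_left times_assoc atomsD unit_sum_times_atom)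
  then show ?thesis by simp
qed

lemma unit_sum_times: assumes x: "x \<in> carr A" shows "unit_sum \<cdot> x = x"
proof -
  have "adj A unit_sum = unit_sum" unfolding unit_sum_def by (simp add: adj_sum atomsD cong: sum.cong)
  then show ?thesis using arg_cong[OF times_unit_sum[of "adj A x"], of "adj A"] x by (simp add: adj_times)
qed

text \<open>The corner \<open>p x p\<close> commutes with C, so it is in C, where p is minimal.\<close>

lemma corner_scalar:
  assumes p: "p \<in> atoms" and x: "x \<in> carr A"
  shows "\<exists>k. p \<cdot> (x \<cdot> p) = scaleC k p"
proof -
  let ?z = "p \<cdot> (x \<cdot> p)"
  note a = atomsD[OF p]
  have "c \<cdot> ?z = ?z \<cdot> c" if c: "c \<in> C" for c
  proof -
    obtain k where k: "c \<cdot> p = scaleC k p" using a(6)[OF c] by blast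
    have "c \<cdot> ?z = (c \<cdot> p) \<cdot> (x \<cdot> p)" using c a(2) x by (simp add: times_assoc)
    also have "\<dots> = scaleC k ?z" unfolding k using a(2) x by (simp add: times_scale_left)
    also have "\<dots> = p \<cdot> (x \<cdot> (c \<cdot> p))" unfolding k using a(2) x by (simp add: times_scale_right)
    also have "\<dots> = ?z \<cdot> c" unfolding C_comm[OF c a(1)] using c a(2) x by (simp add: times_assoc)
    finally show ?thesis .
  qed
  then have "?z \<in> C" using a(2) x by (intro maximal_commutative_contains_commuting[OF masa]) auto
  from a(6)[OF this] show ?thesis using a(2,5) x by (simp add: times_assoc)
qed

text \<open>The diagonal entry of x at p when the atoms index the rows and columns of a matrix.\<close>

definition corner :: "'a \<Rightarrow> 'a \<Rightarrow> complex" where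
  "corner p x = (SOME k. p \<cdot> (x \<cdot> p) = scaleC k p)"

lemma corner: "p \<in> atoms \<Longrightarrow> x \<in> carr A \<Longrightarrow> p \<cdot> (x \<cdot> p) = scaleC (corner p x) p"
  unfolding corner_def by (rule someI_ex) (rule corner_scalar)

lemma cornerI:
  assumes "p \<in> atoms" "x \<in> carr A" "p \<cdot> (x \<cdot> p) = scaleC k p"
  shows "corner p x = k"
proof -
  have "scaleC (corner p x) p = scaleC k p"
    unfolding assms(3)[symmetric] by (rule corner[OF assms(1,2), symmetric])
  then show ?thesis using atomsD(3)[OF assms(1)] by simp
qed

lemma corner_add:
  "p \<in> atoms \<Longrightarrow> x \<in> carr A \<Longrightarrow> y \<in> carr A \<Longrightarrow> corner p (x + y) = corner p x + corner p y"
  by (rule cornerI) (simp_all add: times_add_left times_add_right atomsD corner scaleC_add_left)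

lemma corner_scale:
  "p \<in> atoms \<Longrightarrow> x \<in> carr A \<Longrightarrow> corner p (scaleC c x) = c * corner p x"
  by (rule cornerI) (simp_all add: times_scale_left times_scale_right atomsD corner)

lemma corner_zero: "p \<in> atoms \<Longrightarrow> corner p 0 = 0"
  by (rule cornerI) (simp_all add: atomsD)

lemma corner_sum:
  "p \<in> atoms \<Longrightarrow> (\<And>i. i \<in> I \<Longrightarrow> f i \<in> carr A) \<Longrightarrow> corner p (sum f I) = (\<Sum>i\<in>I. corner p (f i))"
  by (induction I rule: infinite_finite_induct) (auto simp: corner_zero corner_add sum_closed)

lemma corner_adj:
  assumes p: "p \<in> atoms" and x: "x \<in> carr A"
  shows "corner p (adj A x) = cnj (corner p x)"
proof (rule cornerI[OF p])
  have "adj A (p \<cdot> (x \<cdot> p)) = scaleC (cnj (corner p x)) p"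
    unfolding corner[OF p x] using p by (simp add: adj_scale atomsD)
  then show "p \<cdot> (adj A x \<cdot> p) = scaleC (cnj (corner p x)) p"
    using p x by (simp add: adj_times atomsD times_assoc)
qed (use x in simp)

text \<open>For \<open>a = p x q\<close> and \<open>b = q y p\<close> the products are \<open>a b = k p\<close> and \<open>b a = l q\<close>, and the two ways of
  bracketing \<open>a b a\<close> show \<open>k a = l a\<close>.  This is what makes the sum of the diagonal entries a trace.\<close>

lemma corner_swap:
  assumes p: "p \<in> atoms" and q: "q \<in> atoms" and x: "x \<in> carr A" and y: "y \<in> carr A"
  shows "corner p (x \<cdot> (q \<cdot> y)) = corner q (y \<cdot> (p \<cdot> x))"
proof -
  note pa = atomsD[OF p] and qa = atomsD[OF q]
  define a where "a = p \<cdot> (x \<cdot> q)"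
  define b where "b = q \<cdot> (y \<cdot> p)"
  let ?k = "corner p (x \<cdot> (q \<cdot> y))" and ?l = "corner q (y \<cdot> (p \<cdot> x))"
  have c: "a \<in> carr A" "b \<in> carr A" using pa qa x y by (auto simp: a_def b_def)
  have qq: "q \<cdot> (q \<cdot> z) = q \<cdot> z" "p \<cdot> (p \<cdot> z) = p \<cdot> z" if "z \<in> carr A" for z
    using that pa(2,5) qa(2,5) by (simp_all flip: times_assoc)
  have ab: "a \<cdot> b = scaleC ?k p" and ba: "b \<cdot> a = scaleC ?l q"
    using corner[OF p, of "x \<cdot> (q \<cdot> y)"] corner[OF q, of "y \<cdot> (p \<cdot> x)"] pa(2) qa(2) x y
    by (simp_all add: a_def b_def times_assoc qq)
  have "scaleC ?k a = (a \<cdot> b) \<cdot> a"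
    unfolding ab using pa(2) qa(2) x by (simp add: a_def times_scale_left qq)
  also have "\<dots> = a \<cdot> (b \<cdot> a)" using c by (simp add: times_assoc)
  also have "\<dots> = scaleC ?l a"
    unfolding ba using pa(2) qa(2,5) x by (simp add: a_def times_scale_right times_assoc)
  finally have "?k = ?l \<or> a = 0" by simp
  moreover have "?k = 0 \<and> ?l = 0" if "a = 0" using ab ba c pa(3) qa(3) that by auto
  ultimately show ?thesis by auto
qed

lemma norm_atom: "p \<in> atoms \<Longrightarrow> cnorm A p = 1"
  using norm_selfadjoint_square[of p] norm_eq_zero[of p] by (auto simp: power2_eq_square atomsD)

text \<open>For \<open>a = q x p\<close> one has \<open>a* a = k p\<close>, and the C*-identity gives \<open>\<bar>k\<bar> = \<parallel>a\<parallel>\<^sup>2\<close>; only the sign of the real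
  number k is in doubt.  If \<open>p \<noteq> q\<close> and \<open>k < 0\<close>, then \<open>w = a + a*\<close> satisfies \<open>w\<^sup>2 = k (p + q)\<close>.  The C*-identity
  for \<open>w - i t (p + q)\<close> with \<open>t\<^sup>2 = - k\<close> then shows \<open>w = i t (p + q)\<close>, which is not self-adjoint.\<close>

lemma corner_square:
  assumes p: "p \<in> atoms" and q: "q \<in> atoms" and x: "x \<in> carr A"
  shows "corner p (adj A x \<cdot> (q \<cdot> x)) = of_real ((cnorm A (q \<cdot> (x \<cdot> p)))\<^sup>2)"
proof -
  note pa = atomsD[OF p] and qa = atomsD[OF q]
  define a where "a = q \<cdot> (x \<cdot> p)"
  let ?k = "corner p (adj A x \<cdot> (q \<cdot> x))"
  have a: "a \<in> carr A" using pa(2) qa(2) x by (simp add: a_def)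
  have qq: "q \<cdot> (q \<cdot> z) = q \<cdot> z" "p \<cdot> (p \<cdot> z) = p \<cdot> z" if "z \<in> carr A" for z
    using that pa(2,5) qa(2,5) by (simp_all flip: times_assoc)
  have adja: "adj A a = p \<cdot> (adj A x \<cdot> q)" using pa(2,4) qa(2,4) x by (simp add: a_def adj_times times_assoc)
  have aa: "adj A a \<cdot> a = scaleC ?k p"
    using corner[OF p, of "adj A x \<cdot> (q \<cdot> x)"] pa(2) qa(2) x
    unfolding adja by (simp add: a_def times_assoc qq)
  have aa': "a \<cdot> adj A a = scaleC ?k q"
    using corner[OF q, of "x \<cdot> (p \<cdot> adj A x)"] corner_swap[OF p q, of "adj A x" x] pa(2) qa(2) x
    unfolding adja by (simp add: a_def times_assoc qq)
  have p1: "cnorm A p = 1" using p by (rule norm_atom)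
  have "cmod ?k = (cnorm A a)\<^sup>2"
    using cstar_identity[OF a] pa(2) p1 unfolding aa by (simp add: norm_scale)
  moreover have "cnj ?k = ?k"
  proof -
    have "adj A (scaleC ?k p) = scaleC ?k p" unfolding aa[symmetric] using a by (simp add: adj_times)
    then show ?thesis using pa(2,3,4) by (simp add: adj_scale)
  qed
  then have kr: "?k = of_real (Re ?k)" by (simp add: complex_eq_iff)
  moreover have "0 \<le> Re ?k"
  proof (rule ccontr)
    assume neg: "\<not> 0 \<le> Re ?k"
    show False
    proof (cases "p = q")
      case True
      have "a = scaleC (corner p x) p" unfolding a_def True[symmetric] by (rule corner[OF p x])
      then have "adj A a \<cdot> a = scaleC (cnj (corner p x) * corner p x) p"
        using pa(2,4,5) by (simp add: adj_scale times_scale_left times_scale_right mult.commute)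
      then have "?k = cnj (corner p x) * corner p x" using aa pa(3) by simp
      then have "Re ?k = (cmod (corner p x))\<^sup>2"
        by (metis Re_complex_of_real complex_norm_square mult.commute of_real_power)
      then show False using neg by simp
    next
      case False
      have pq: "p \<cdot> q = 0" "q \<cdot> p = 0" using atoms_orthogonal[OF p q] atoms_orthogonal[OF q p] False by auto
      have pq': "p \<cdot> (q \<cdot> z) = 0" "q \<cdot> (p \<cdot> z) = 0" if "z \<in> carr A" for z
        using that pa(2) qa(2) pq by (simp_all flip: times_assoc)
      define t where "t = sqrt (- Re ?k)"
      have t: "t > 0" "t * t = - Re ?k" using neg by (auto simp: t_def)
      define w where "w = a + adj A a"
      define f where "f = p + q"
      have wf: "w \<in> carr A" "f \<in> carr A" "adj A w = w" "adj A f = f"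
        using a pa qa by (auto simp: w_def f_def adj_add add.commute)
      have a2: "a \<cdot> a = 0"
        using pa(2) qa(2) x pq pq' by (simp add: a_def times_assoc)
      then have "adj A a \<cdot> adj A a = 0" using adj_times[OF a a] by simp
      with a2 have ww: "w \<cdot> w = scaleC ?k f"
        using a aa aa' by (simp add: w_def f_def times_add_left times_add_right scaleC_add_right)
      have "a \<cdot> p = a" "a \<cdot> q = 0" "adj A a \<cdot> p = 0" "adj A a \<cdot> q = adj A a"
        using pa(2,5) qa(2,5) x pq pq' unfolding adja by (simp_all add: a_def times_assoc)
      then have wf1: "w \<cdot> f = w"
        using a pa(2) qa(2) by (simp add: w_def f_def times_add_left times_add_right)
      then have wf2: "f \<cdot> w = w" using adj_times[OF wf(1,2)] wf by (simp add: wf1)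
      have ff: "f \<cdot> f = f" using pa(2,5) qa(2,5) pq by (simp add: f_def times_add_left times_add_right)
      define h where "h = w - scaleC (\<i> * of_real t) f"
      have h: "h \<in> carr A" using wf by (simp add: h_def)
      have "adj A h = w + scaleC (\<i> * of_real t) f"
        using wf by (simp add: h_def adj_diff adj_scale complex_vector.scale_minus_left)
      then have "adj A h \<cdot> h = w \<cdot> w - scaleC (\<i> * of_real t * (\<i> * of_real t)) f"
        using wf by (simp add: h_def times_add_left times_diff_right times_scale_left times_scale_right
            times_diff_left times_add_right complex_vector.scale_right_distrib wf1 wf2 ff)
      also have "\<i> * of_real t * (\<i> * of_real t) = ?k"
        using t(2) kr by (metis (no_types, lifting) i_squared mult.assoc mult.left_commute
            mult_minus1 of_real_minus of_real_mult minus_minus)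
      finally have "adj A h \<cdot> h = 0" by (simp add: ww)
      then have "h = 0" using adj_times_self_eq_0 h by blast
      then have w: "w = scaleC (\<i> * of_real t) f" by (simp add: h_def)
      have "scaleC (- (\<i> * of_real t)) f = scaleC (\<i> * of_real t) f"
        using wf(2,3,4) unfolding w by (simp add: adj_scale)
      then have "- (\<i> * of_real t) = \<i> * of_real t \<or> f = 0"
        by (simp only: complex_vector.scale_cancel_right)
      then have "f = 0" using t by (auto simp: complex_eq_iff)
      then have "f \<cdot> p = 0" using pa(2) by simp
      then show False using pa(2,3,5) qa(2) pq by (simp add: f_def times_add_left)
    qed
  qed
  then have "Re ?k = cmod ?k" using kr by (metis abs_of_nonneg norm_of_real)
  ultimately show ?thesis using kr by (simp add: a_def)
qed

definition tr :: "'a \<Rightarrow> real" where "tr x = (\<Sum>p\<in>atoms. Re (corner p x))"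

lemma corner_expand:
  assumes "p \<in> atoms" "x \<in> carr A" "y \<in> carr A"
  shows "corner p (x \<cdot> y) = (\<Sum>q\<in>atoms. corner p (x \<cdot> (q \<cdot> y)))"
proof -
  have "x \<cdot> y = x \<cdot> (unit_sum \<cdot> y)" using assms by (simp add: unit_sum_times)
  also have "\<dots> = (\<Sum>q\<in>atoms. x \<cdot> (q \<cdot> y))"
    unfolding unit_sum_def using assms by (simp add: times_sum_left times_sum_right atomsD)
  finally show ?thesis using assms by (simp add: corner_sum atomsD)
qed

lemma tr_add: "x \<in> carr A \<Longrightarrow> y \<in> carr A \<Longrightarrow> tr (x + y) = tr x + tr y"
  by (simp add: tr_def corner_add sum.distrib cong: sum.cong)

lemma tr_scale: "x \<in> carr A \<Longrightarrow> tr (scaleC (of_real c) x) = c * tr x"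
  by (simp add: tr_def corner_scale sum_distrib_left cong: sum.cong)

lemma tr_adj: "x \<in> carr A \<Longrightarrow> tr (adj A x) = tr x"
  by (simp add: tr_def corner_adj cong: sum.cong)

lemma tr_commute:
  assumes x: "x \<in> carr A" and y: "y \<in> carr A"
  shows "tr (x \<cdot> y) = tr (y \<cdot> x)"
proof -
  have "tr (x \<cdot> y) = (\<Sum>p\<in>atoms. \<Sum>q\<in>atoms. Re (corner p (x \<cdot> (q \<cdot> y))))"
    using x y by (simp add: tr_def corner_expand cong: sum.cong)
  also have "\<dots> = (\<Sum>p\<in>atoms. \<Sum>q\<in>atoms. Re (corner q (y \<cdot> (p \<cdot> x))))"
    by (intro sum.cong refl arg_cong[of _ _ Re] corner_swap x y)
  also have "\<dots> = (\<Sum>q\<in>atoms. \<Sum>p\<in>atoms. Re (corner q (y \<cdot> (p \<cdot> x))))" by (rule sum.swap)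
  also have "\<dots> = tr (y \<cdot> x)" using x y by (simp add: tr_def corner_expand cong: sum.cong)
  finally show ?thesis .
qed

lemma tr_square:
  assumes x: "x \<in> carr A"
  shows "tr (adj A x \<cdot> x) = (\<Sum>(p, q)\<in>atoms \<times> atoms. (cnorm A (q \<cdot> (x \<cdot> p)))\<^sup>2)"
  using x by (simp add: tr_def corner_expand corner_square sum.cartesian_product[symmetric] cong: sum.cong)

lemma tr_square_le:
  assumes x: "x \<in> carr A"
  shows "tr (adj A x \<cdot> x) \<le> (real (card atoms) * cnorm A x)\<^sup>2"
proof -
  have "(\<Sum>(p, q)\<in>atoms \<times> atoms. (cnorm A (q \<cdot> (x \<cdot> p)))\<^sup>2) \<le> (\<Sum>(p, q)\<in>atoms \<times> atoms. (cnorm A x)\<^sup>2)"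
  proof (intro sum_mono, clarify)
    fix p q assume pq: "p \<in> atoms" "q \<in> atoms"
    have "cnorm A (q \<cdot> (x \<cdot> p)) \<le> cnorm A q * cnorm A (x \<cdot> p)" using pq x by (intro norm_times) (simp_all add: atomsD)
    also have "\<dots> \<le> cnorm A x" using norm_times[of x p] pq x by (simp add: norm_atom atomsD)
    finally show "(cnorm A (q \<cdot> (x \<cdot> p)))\<^sup>2 \<le> (cnorm A x)\<^sup>2"
      using pq x by (intro power_mono norm_ge_zero) (simp_all add: atomsD)
  qed
  also have "\<dots> = (real (card atoms) * cnorm A x)\<^sup>2" by (simp add: power2_eq_square card_cartesian_product)
  finally show ?thesis by (simp add: tr_square[OF x])
qed

lemma norm_square_le_tr:
  assumes x: "x \<in> carr A"
  shows "(cnorm A x)\<^sup>2 \<le> (real (card atoms))\<^sup>2 * tr (adj A x \<cdot> x)"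
proof -
  let ?s = "\<lambda>z. cnorm A (case z of (p, q) \<Rightarrow> q \<cdot> (x \<cdot> p))"
  have "x = unit_sum \<cdot> (x \<cdot> unit_sum)" using x by (simp add: times_unit_sum unit_sum_times)
  also have "\<dots> = (\<Sum>p\<in>atoms. \<Sum>q\<in>atoms. q \<cdot> (x \<cdot> p))"
  proof -
    have "unit_sum \<cdot> (x \<cdot> unit_sum) = (\<Sum>p\<in>atoms. unit_sum \<cdot> (x \<cdot> p))"
      unfolding unit_sum_def[of ] using x unit_sum_closed[unfolded unit_sum_def]
      by (simp add: times_sum_right atomsD)
    also have "\<dots> = (\<Sum>p\<in>atoms. \<Sum>q\<in>atoms. q \<cdot> (x \<cdot> p))"
      unfolding unit_sum_def using x by (intro sum.cong refl times_sum_left) (simp_all add: atomsD)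
    finally show ?thesis .
  qed
  finally have "cnorm A x = cnorm A (\<Sum>(p, q)\<in>atoms \<times> atoms. q \<cdot> (x \<cdot> p))"
    by (simp add: sum.cartesian_product)
  also have "\<dots> \<le> (\<Sum>z\<in>atoms \<times> atoms. ?s z)"
    using x by (intro norm_sum) (auto simp: atomsD)
  finally have "(cnorm A x)\<^sup>2 \<le> (\<Sum>z\<in>atoms \<times> atoms. ?s z)\<^sup>2"
    using norm_ge_zero[OF x] by (intro power_mono)
  also have "\<dots> \<le> (\<Sum>z\<in>atoms \<times> atoms. (?s z)\<^sup>2) * card (atoms \<times> atoms)"
    by (rule sum_squared_le_sum_of_squares)
  also have "\<dots> = (real (card atoms))\<^sup>2 * tr (adj A x \<cdot> x)"
    by (simp add: tr_square[OF x] case_prod_beta power2_eq_square card_cartesian_product)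
  finally show ?thesis .
qed

end

section \<open>Schatten norms and their smoothness\<close>

locale traced_cstar = cstar_algebra A for A :: "'a::complex_vector cstar" (structure) +
  fixes T :: "'a \<Rightarrow> real"
  assumes T_add: "\<And>x y. x \<in> carr A \<Longrightarrow> y \<in> carr A \<Longrightarrow> T (x + y) = T x + T y"
    and T_scale: "\<And>c x. x \<in> carr A \<Longrightarrow> T (scaleC (of_real c) x) = c * T x"
    and T_adj: "\<And>x. x \<in> carr A \<Longrightarrow> T (adj A x) = T x"
    and T_commute: "\<And>x y. x \<in> carr A \<Longrightarrow> y \<in> carr A \<Longrightarrow> T (x \<cdot> y) = T (y \<cdot> x)"
    and T_pos: "\<And>x. x \<in> carr A \<Longrightarrow> 0 \<le> T (adj A x \<cdot> x)"
begin

text \<open>The form \<open>(a, b) \<mapsto> T (a* b)\<close> is a symmetric positive semidefinite bilinear form over the reals.\<close>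

lemma T_Cauchy_Schwarz:
  assumes a: "a \<in> carr A" and b: "b \<in> carr A"
  shows "\<bar>T (adj A a \<cdot> b)\<bar> \<le> sqrt (T (adj A a \<cdot> a)) * sqrt (T (adj A b \<cdot> b))"
proof -
  let ?a = "T (adj A a \<cdot> a)" and ?b = "T (adj A b \<cdot> b)" and ?x = "T (adj A a \<cdot> b)"
  have ba: "T (adj A b \<cdot> a) = ?x"
    using T_adj[of "adj A a \<cdot> b"] a b by (simp add: adj_times)
  have quad: "0 \<le> ?a + 2 * s * ?x + s\<^sup>2 * ?b" for s :: real
  proof -
    let ?s = "complex_of_real s"
    have "adj A (a + scaleC ?s b) \<cdot> (a + scaleC ?s b)
        = (adj A a \<cdot> a + scaleC ?s (adj A a \<cdot> b)) + (scaleC ?s (adj A b \<cdot> a) + scaleC ?s (scaleC ?s (adj A b \<cdot> b)))"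
      using a b by (simp add: alg_simps complex_vector.scale_right_distrib)
    then have "T (adj A (a + scaleC ?s b) \<cdot> (a + scaleC ?s b)) = ?a + s * ?x + (s * ?x + s * (s * ?b))"
      using a b by (simp add: T_add T_scale ba del: complex_vector.scale_scale)
    with T_pos[of "a + scaleC ?s b"] show ?thesis
      using a b by (simp add: power2_eq_square algebra_simps)
  qed
  have "?x\<^sup>2 \<le> ?a * ?b"
  proof (cases "?b = 0")
    case True
    have "?x = 0"
    proof (rule ccontr)
      assume "?x \<noteq> 0"
      then show False using quad[of "- (?a + 1) / (2 * ?x)"] True by (simp add: field_simps)
    qed
    then show ?thesis using True by simp
  next
    case False
    then have "?b > 0" using T_pos[OF b] by simp
    then show ?thesis using quad[of "- ?x / ?b"] by (simp add: field_simps power2_eq_square)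
  qed
  then have "sqrt (?x\<^sup>2) \<le> sqrt (?a * ?b)" by (rule real_sqrt_le_mono)
  then show ?thesis by (simp add: real_sqrt_mult)
qed

text \<open>\<open>schatten k\<close> is the Schatten norm of exponent \<open>2 ^ (k + 1)\<close> for the trace T.  The recursion, instead of
  a formula with powers, lets every property be proved by doubling the exponent.\<close>

primrec schatten :: "nat \<Rightarrow> 'a \<Rightarrow> real" where
  "schatten 0 x = sqrt (T (adj A x \<cdot> x))"
| "schatten (Suc k) x = sqrt (schatten k (adj A x \<cdot> x))"

primrec square_iter :: "nat \<Rightarrow> 'a \<Rightarrow> 'a" where
  "square_iter 0 x = x"
| "square_iter (Suc k) x = square_iter k (x \<cdot> x)"

lemma schatten_ge_0: "x \<in> carr A \<Longrightarrow> 0 \<le> schatten k x"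
  by (induction k arbitrary: x) (auto simp: T_pos)

lemma schatten_power:
  "x \<in> carr A \<Longrightarrow> schatten k x ^ (2 ^ Suc k) = T (square_iter k (adj A x \<cdot> x))"
proof (induction k arbitrary: x)
  case 0
  then show ?case using T_pos by simp
next
  case (Suc k)
  have "schatten (Suc k) x ^ (2 ^ Suc (Suc k)) = ((sqrt (schatten k (adj A x \<cdot> x)))\<^sup>2) ^ (2 ^ Suc k)"
    by (simp flip: power_mult)
  also have "\<dots> = schatten k (adj A x \<cdot> x) ^ (2 ^ Suc k)"
    using schatten_ge_0 Suc.prems by simp
  finally show ?case using Suc by (simp add: adj_times)
qed

lemma T_square_iter_commute:
  "a \<in> carr A \<Longrightarrow> b \<in> carr A \<Longrightarrow> T (square_iter k (a \<cdot> b)) = T (square_iter k (b \<cdot> a))"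
proof (induction k arbitrary: b)
  case 0
  then show ?case by (simp add: T_commute)
next
  case (Suc k)
  then show ?case using Suc.IH[of "b \<cdot> (a \<cdot> b)"] by (simp add: times_assoc)
qed

lemma power_le_cancel: "x ^ n \<le> y ^ n \<Longrightarrow> n > 0 \<Longrightarrow> 0 \<le> x \<Longrightarrow> 0 \<le> y \<Longrightarrow> x \<le> (y::real)"
  by simp

lemma schatten_adj: assumes x: "x \<in> carr A" shows "schatten k (adj A x) = schatten k x"
proof -
  have "schatten k (adj A x) ^ (2 ^ Suc k) = schatten k x ^ (2 ^ Suc k)"
    using x schatten_power[OF x] schatten_power[of "adj A x"] T_square_iter_commute[of x "adj A x"] by simp
  then show ?thesis
    by (rule power_eq_imp_eq_base) (simp_all add: x schatten_ge_0)
qed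

lemma schatten_square: "x \<in> carr A \<Longrightarrow> schatten k (adj A x \<cdot> x) = (schatten (Suc k) x)\<^sup>2"
  by (simp add: schatten_ge_0)

text \<open>Cyclicity turns the trace of a power of \<open>(a b)* (a b)\<close> into the trace of the same power of
  \<open>(a* a) (b b*)\<close>.  So a bound for powers of a product of two elements, with exponent \<open>2 ^ k\<close>, gives
  Hoelder's inequality between the norms of index k and \<open>k + 1\<close>; the next lemma closes the induction.\<close>

lemma schatten_Hoelder_step:
  assumes H: "\<And>a b. a \<in> carr A \<Longrightarrow> b \<in> carr A \<Longrightarrow>
      \<bar>T (square_iter k (a \<cdot> b))\<bar> \<le> (schatten k a * schatten k b) ^ (2 ^ k)"
    and a: "a \<in> carr A" and b: "b \<in> carr A"
  shows "schatten k (a \<cdot> b) \<le> schatten (Suc k) a * schatten (Suc k) b"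
proof -
  have "schatten k (a \<cdot> b) ^ (2 ^ Suc k) = T (square_iter k (adj A b \<cdot> (adj A a \<cdot> (a \<cdot> b))))"
    using a b by (simp only: schatten_power times_closed adj_times times_assoc adj_closed)
  also have "\<dots> = T (square_iter k ((adj A a \<cdot> a) \<cdot> (b \<cdot> adj A b)))"
    using a b T_square_iter_commute[of "adj A b" "adj A a \<cdot> (a \<cdot> b)" k] by (simp add: times_assoc)
  also have "\<dots> \<le> (schatten k (adj A a \<cdot> a) * schatten k (b \<cdot> adj A b)) ^ (2 ^ k)"
    using H[of "adj A a \<cdot> a" "b \<cdot> adj A b"] a b by simp
  also have "schatten k (b \<cdot> adj A b) = (schatten (Suc k) b)\<^sup>2"
    using schatten_square[of "adj A b" k] schatten_adj[OF b, of "Suc k"] b by (simp only: adj_adj adj_closed)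
  also have "schatten k (adj A a \<cdot> a) = (schatten (Suc k) a)\<^sup>2" using a by (rule schatten_square)
  also have "((schatten (Suc k) a)\<^sup>2 * (schatten (Suc k) b)\<^sup>2) ^ (2 ^ k)
      = (schatten (Suc k) a * schatten (Suc k) b) ^ (2 ^ Suc k)"
    by (simp only: power_mult_distrib[symmetric] power_mult[symmetric] power_Suc)
  finally show ?thesis
    using a b by (rule_tac power_le_cancel) (auto intro!: mult_nonneg_nonneg schatten_ge_0 simp del: schatten.simps)
qed

lemma abs_T_square_iter_le:
  "a \<in> carr A \<Longrightarrow> b \<in> carr A \<Longrightarrow>
    \<bar>T (square_iter k (a \<cdot> b))\<bar> \<le> (schatten k a * schatten k b) ^ (2 ^ k)"
proof (induction k arbitrary: a b)
  case 0
  then show ?case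
    using T_Cauchy_Schwarz[of "adj A a" b] schatten_adj[of a 0] by simp
next
  case (Suc k)
  have ab: "a \<cdot> b \<in> carr A" using Suc.prems by simp
  have "\<bar>T (square_iter (Suc k) (a \<cdot> b))\<bar> \<le> (schatten k (a \<cdot> b) * schatten k (a \<cdot> b)) ^ (2 ^ k)"
    using Suc.IH[OF ab ab] by simp
  also have "\<dots> \<le> ((schatten (Suc k) a * schatten (Suc k) b) * (schatten (Suc k) a * schatten (Suc k) b)) ^ (2 ^ k)"
    using Suc.prems ab
    by (intro power_mono mult_mono schatten_Hoelder_step Suc.IH mult_nonneg_nonneg schatten_ge_0)
  also have "\<dots> = (schatten (Suc k) a * schatten (Suc k) b) ^ (2 ^ Suc k)"
    by (simp only: power2_eq_square[symmetric] power_mult[symmetric] power_Suc)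
  finally show ?case .
qed

lemma schatten_Hoelder:
  "a \<in> carr A \<Longrightarrow> b \<in> carr A \<Longrightarrow> schatten k (a \<cdot> b) \<le> schatten (Suc k) a * schatten (Suc k) b"
  by (rule schatten_Hoelder_step[OF abs_T_square_iter_le])

lemma schatten_cross:
  assumes "x \<in> carr A" "y \<in> carr A"
  shows "schatten k (adj A x \<cdot> y) + schatten k (adj A y \<cdot> x) \<le> 2 * schatten (Suc k) x * schatten (Suc k) y"
proof -
  have "schatten k (adj A x \<cdot> y) \<le> schatten (Suc k) x * schatten (Suc k) y"
    using schatten_Hoelder[of "adj A x" y k] assms by (simp add: schatten_adj del: schatten.simps)
  moreover have "schatten k (adj A y \<cdot> x) \<le> schatten (Suc k) x * schatten (Suc k) y"
    using schatten_Hoelder[of "adj A y" x k] assms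
    by (simp add: schatten_adj mult.commute del: schatten.simps)
  ultimately show ?thesis by linarith
qed

lemma square_expand:
  assumes "x \<in> carr A" "y \<in> carr A"
  shows "adj A (x + y) \<cdot> (x + y) = (adj A x \<cdot> x + adj A y \<cdot> y) + (adj A x \<cdot> y + adj A y \<cdot> x)"
    "adj A (x - y) \<cdot> (x - y) = (adj A x \<cdot> x + adj A y \<cdot> y) - (adj A x \<cdot> y + adj A y \<cdot> x)"
  using assms by (simp_all add: alg_simps)

lemma schatten_triangle:
  "x \<in> carr A \<Longrightarrow> y \<in> carr A \<Longrightarrow> schatten k (x + y) \<le> schatten k x + schatten k y"
proof (induction k arbitrary: x y)
  case 0
  have "T (adj A y \<cdot> x) = T (adj A x \<cdot> y)" using T_adj[of "adj A x \<cdot> y"] 0 by (simp add: adj_times)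
  then have "T (adj A (x + y) \<cdot> (x + y)) = T (adj A x \<cdot> x) + T (adj A y \<cdot> y) + 2 * T (adj A x \<cdot> y)"
    using 0 by (simp add: square_expand T_add)
  also have "\<dots> \<le> (schatten 0 x + schatten 0 y)\<^sup>2"
    using T_Cauchy_Schwarz[OF 0] T_pos[of x] T_pos[of y] 0 by (simp add: power2_sum)
  finally show ?case
    using 0 T_pos by (simp add: real_le_lsqrt)
next
  case (Suc k)
  let ?x = "adj A x \<cdot> x" and ?y = "adj A y \<cdot> y"
  have "schatten k (adj A (x + y) \<cdot> (x + y)) \<le> (schatten k ?x + schatten k ?y) + (schatten k (adj A x \<cdot> y) + schatten k (adj A y \<cdot> x))"
    unfolding square_expand[OF Suc.prems] using Suc.prems
    by (intro order_trans[OF Suc.IH] add_mono Suc.IH) auto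
  also have "\<dots> \<le> ((schatten (Suc k) x)\<^sup>2 + (schatten (Suc k) y)\<^sup>2)
      + 2 * schatten (Suc k) x * schatten (Suc k) y"
    using schatten_cross[OF Suc.prems, of k]
    unfolding schatten_square[OF Suc.prems(1)] schatten_square[OF Suc.prems(2)] by linarith
  also have "\<dots> = (schatten (Suc k) x + schatten (Suc k) y)\<^sup>2" by (simp only: power2_sum)
  finally show ?case
    using Suc.prems schatten_ge_0[of x "Suc k"] schatten_ge_0[of y "Suc k"]
    unfolding schatten.simps(2)[of k "x + y"] by (intro real_le_lsqrt) (auto simp del: schatten.simps simp: schatten_ge_0)
qed

text \<open>Doubling the exponent: with \<open>u = x* x + y* y\<close> and \<open>v = x* y + y* x\<close>, the squares in question are
  the norms of \<open>u + v\<close> and \<open>u - v\<close> of index k, to which the induction hypothesis applies, and Hoelder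
  bounds v by \<open>2 a b\<close>.  The smoothness constant L becomes \<open>2 L + 1\<close>.  Starting from the parallelogram law
  with \<open>L = 1\<close>, this yields the exponent minus one.\<close>

lemma schatten_two_smooth:
  "x \<in> carr A \<Longrightarrow> y \<in> carr A \<Longrightarrow>
    (schatten k (x + y))\<^sup>2 + (schatten k (x - y))\<^sup>2
      \<le> 2 * ((schatten k x)\<^sup>2 + (2 ^ Suc k - 1) * (schatten k y)\<^sup>2)"
proof (induction k arbitrary: x y)
  case 0
  have "T (adj A (x + y) \<cdot> (x + y)) + T (adj A (x - y) \<cdot> (x - y))
      = T (adj A (x + y) \<cdot> (x + y) + adj A (x - y) \<cdot> (x - y))"
    using 0 by (simp add: T_add)
  also have "\<dots> = T ((adj A x \<cdot> x + adj A y \<cdot> y) + (adj A x \<cdot> x + adj A y \<cdot> y))"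
    unfolding square_expand[OF 0] by simp
  also have "\<dots> = 2 * (T (adj A x \<cdot> x) + T (adj A y \<cdot> y))" using 0 by (simp add: T_add)
  finally show ?case using 0 by (simp add: T_pos)
next
  case (Suc k)
  let ?N = "schatten k" and ?M = "schatten (Suc k)"
  define u where "u = adj A x \<cdot> x + adj A y \<cdot> y"
  define v where "v = adj A x \<cdot> y + adj A y \<cdot> x"
  define L :: real where "L = 2 ^ Suc k - 1"
  have L: "0 \<le> L" using one_le_power[of "2::real" "Suc k"] by (simp add: L_def)
  have c: "u \<in> carr A" "v \<in> carr A" using Suc.prems by (auto simp: u_def v_def)
  define a where "a = ?M x"
  define b where "b = ?M y"
  have ab: "0 \<le> a" "0 \<le> b" using Suc.prems schatten_ge_0 unfolding a_def b_def by blast+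
  have u: "?N u \<le> a\<^sup>2 + b\<^sup>2"
    using schatten_triangle[of "adj A x \<cdot> x" "adj A y \<cdot> y" k] Suc.prems
    by (simp only: u_def a_def b_def schatten_square times_closed adj_closed)
  have v: "?N v \<le> 2 * a * b"
    unfolding v_def a_def b_def using Suc.prems
    by (intro order_trans[OF schatten_triangle schatten_cross]) auto
  have "(?M (x + y))\<^sup>2 + (?M (x - y))\<^sup>2 = ?N (u + v) + ?N (u - v)"
    using Suc.prems
    by (simp only: schatten_square[symmetric] add_closed diff_closed square_expand u_def v_def)
  also have "\<dots> \<le> 2 * (a\<^sup>2 + (2 * L + 1) * b\<^sup>2)"
  proof (rule power2_le_imp_le)
    have "(?N (u + v) + ?N (u - v))\<^sup>2 \<le> 2 * ((?N (u + v))\<^sup>2 + (?N (u - v))\<^sup>2)"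
      using zero_le_power2[of "?N (u + v) - ?N (u - v)"] by (simp add: power2_sum power2_diff)
    also have "\<dots> \<le> 4 * ((?N u)\<^sup>2 + L * (?N v)\<^sup>2)" using Suc.IH[OF c] by (simp add: L_def)
    also have "\<dots> \<le> 4 * ((a\<^sup>2 + b\<^sup>2)\<^sup>2 + L * (2 * a * b)\<^sup>2)"
      using u v c L by (intro mult_left_mono add_mono power_mono schatten_ge_0) auto
    also have "\<dots> \<le> (2 * (a\<^sup>2 + (2 * L + 1) * b\<^sup>2))\<^sup>2"
    proof -
      have "(2 * (a\<^sup>2 + (2 * L + 1) * b\<^sup>2))\<^sup>2 - 4 * ((a\<^sup>2 + b\<^sup>2)\<^sup>2 + L * (2 * a * b)\<^sup>2)
          = 16 * (L\<^sup>2 + L) * (b\<^sup>2)\<^sup>2"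
        by (simp add: power2_eq_square algebra_simps)
      moreover have "0 \<le> 16 * (L\<^sup>2 + L) * (b\<^sup>2)\<^sup>2" using L by simp
      ultimately show ?thesis by linarith
    qed
    finally show "(?N (u + v) + ?N (u - v))\<^sup>2 \<le> (2 * (a\<^sup>2 + (2 * L + 1) * b\<^sup>2))\<^sup>2" .
  qed (use L in auto)
  also have "2 * L + 1 = 2 ^ Suc (Suc k) - 1" by (simp add: L_def)
  finally show ?case by (simp only: a_def b_def)
qed

lemma norm_le_schatten:
  assumes "\<And>x. x \<in> carr A \<Longrightarrow> cnorm A x \<le> r * schatten 0 x" "0 \<le> r"
  shows "x \<in> carr A \<Longrightarrow> cnorm A x ^ (2 ^ k) \<le> r * schatten k x ^ (2 ^ k)"
proof (induction k arbitrary: x)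
  case (Suc k)
  have "cnorm A x ^ (2 ^ Suc k) = cnorm A (adj A x \<cdot> x) ^ (2 ^ k)"
    using Suc.prems by (simp add: cstar_identity power_mult)
  also have "\<dots> \<le> r * schatten k (adj A x \<cdot> x) ^ (2 ^ k)" using Suc by simp
  also have "\<dots> = r * schatten (Suc k) x ^ (2 ^ Suc k)"
    using Suc.prems by (simp only: schatten_square power_mult[symmetric] power_Suc)
  finally show ?case .
qed (use assms in auto)

lemma schatten_le_norm:
  assumes "\<And>x. x \<in> carr A \<Longrightarrow> schatten 0 x \<le> r * cnorm A x" "0 \<le> r"
  shows "x \<in> carr A \<Longrightarrow> schatten k x ^ (2 ^ k) \<le> r * cnorm A x ^ (2 ^ k)"
proof (induction k arbitrary: x)
  case (Suc k)
  have "schatten (Suc k) x ^ (2 ^ Suc k) = schatten k (adj A x \<cdot> x) ^ (2 ^ k)"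
    using Suc.prems by (simp only: schatten_square power_mult[symmetric] power_Suc)
  also have "\<dots> \<le> r * cnorm A (adj A x \<cdot> x) ^ (2 ^ k)" using Suc by simp
  also have "\<dots> = r * cnorm A x ^ (2 ^ Suc k)"
    using Suc.prems by (simp add: cstar_identity power_mult)
  finally show ?case .
qed (use assms in auto)

end

text \<open>The trace norm of exponent 2 and the C*-norm are compared entry by entry with constants that are
  polynomial in the rank.  Sharp constants would bring nothing: they are going to be raised to a power
  of order \<open>1 / log (rank B)\<close>.\<close>

lemma finite_dim_trace:
  fixes B :: "'b::complex_vector cstar"
  assumes "finite_dim_cstar B"
  obtains T where "traced_cstar B T"
    "\<And>x. x \<in> carr B \<Longrightarrow> T (adj B x \<cdot>\<^bsub>B\<^esub> x) \<le> (real (rank_cstar B) * cnorm B x)\<^sup>2"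
    "\<And>x. x \<in> carr B \<Longrightarrow> (cnorm B x)\<^sup>2 \<le> (real (rank_cstar B))\<^sup>2 * T (adj B x \<cdot>\<^bsub>B\<^esub> x)"
proof -
  obtain S where alg: "cstar_algebra B" and S: "finite S" "carr B \<subseteq> complex_vector.span S"
    using assms by (auto simp: finite_dim_cstar_def)
  define C where "C = (SOME C. maximal_commutative C B)"
  have "maximal_commutative C B"
    unfolding C_def using cstar_algebra.maximal_commutative_exists[OF alg S] by (rule someI_ex)
  then interpret finite_dim_masa B C S
    using alg S by (simp add: finite_dim_masa_def finite_dim_masa_axioms_def)
  have card: "real (card atoms) \<le> real (rank_cstar B)"
    using atoms_finite by (simp add: rank_cstar_def C_def)
  have pos: "0 \<le> tr (adj B x \<cdot>\<^bsub>B\<^esub> x)" if "x \<in> carr B" for x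
    unfolding tr_square[OF that] by (intro sum_nonneg) auto
  show thesis
  proof (rule that[of tr])
    show "traced_cstar B tr"
      by unfold_locales (rule tr_add tr_scale tr_adj tr_commute pos; assumption)+
    fix x assume x: "x \<in> carr B"
    show "tr (adj B x \<cdot>\<^bsub>B\<^esub> x) \<le> (real (rank_cstar B) * cnorm B x)\<^sup>2"
      using norm_ge_zero[OF x]
      by (intro order_trans[OF tr_square_le[OF x]] power_mono mult_right_mono[OF card]) auto
    show "(cnorm B x)\<^sup>2 \<le> (real (rank_cstar B))\<^sup>2 * tr (adj B x \<cdot>\<^bsub>B\<^esub> x)"
      using norm_square_le_tr[OF x] mult_right_mono[OF power_mono[OF card, of 2] pos[OF x]] by simp
  qed
qed

text \<open>The Schatten norm of index k and the C*-norm differ at most by the factor \<open>rank B\<close> to the power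
  \<open>1 / 2 ^ k\<close>, which is at most 2 once \<open>rank B \<le> 2 ^ 2 ^ k\<close>.  The least such k has a smoothness constant of
  order \<open>log (rank B)\<close>.  This logarithm is the source of the logarithm in the entropy estimate.\<close>

lemma two_smooth_renorming:
  fixes B :: "'b::complex_vector cstar"
  assumes B: "finite_dim_cstar B"
  obtains N :: "'b \<Rightarrow> real" and L :: real where
    "1 \<le> L" "L \<le> 6 * ln (real (max 1 (rank_cstar B))) + 1"
    "\<And>x. x \<in> carr B \<Longrightarrow> 0 \<le> N x"
    "\<And>x. x \<in> carr B \<Longrightarrow> cnorm B x \<le> 2 * N x"
    "\<And>x. x \<in> carr B \<Longrightarrow> N x \<le> 2 * cnorm B x"
    "\<And>x y. x \<in> carr B \<Longrightarrow> y \<in> carr B \<Longrightarrow>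
      (N (x + y))\<^sup>2 + (N (x - y))\<^sup>2 \<le> 2 * ((N x)\<^sup>2 + L * (N y)\<^sup>2)"
proof (rule finite_dim_trace[OF B])
  fix T :: "'b \<Rightarrow> real"
  let ?r = "real (rank_cstar B)"
  assume "traced_cstar B T"
    and up: "\<And>x. x \<in> carr B \<Longrightarrow> T (adj B x \<cdot>\<^bsub>B\<^esub> x) \<le> (?r * cnorm B x)\<^sup>2"
    and low: "\<And>x. x \<in> carr B \<Longrightarrow> (cnorm B x)\<^sup>2 \<le> ?r\<^sup>2 * T (adj B x \<cdot>\<^bsub>B\<^esub> x)"
  interpret traced_cstar B T by fact
  have low0: "cnorm B x \<le> ?r * schatten 0 x" if x: "x \<in> carr B" for x
    using real_sqrt_le_mono[OF low[OF x]] norm_ge_zero[OF x] by (simp add: real_sqrt_mult)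
  have up0: "schatten 0 x \<le> ?r * cnorm B x" if x: "x \<in> carr B" for x
    using real_sqrt_le_mono[OF up[OF x]] norm_ge_zero[OF x] by simp
  \<comment> \<open>The doubly exponential bound keeps the smoothness constant logarithmic in the rank.\<close>
  have "\<exists>k. ?r \<le> 2 ^ 2 ^ k"
  proof (intro exI[of _ "rank_cstar B"])
    have "rank_cstar B < 2 ^ rank_cstar B" by (rule less_exp)
    also have "(2::nat) ^ rank_cstar B \<le> 2 ^ 2 ^ rank_cstar B"
      by (intro power_increasing) (auto simp: less_exp less_imp_le)
    finally have "rank_cstar B \<le> 2 ^ 2 ^ rank_cstar B" by simp
    then have "?r \<le> real (2 ^ 2 ^ rank_cstar B)" by (simp only: of_nat_le_iff)
    then show "?r \<le> 2 ^ 2 ^ rank_cstar B" by simp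
  qed
  then obtain k where k: "?r \<le> 2 ^ 2 ^ k" and min: "\<And>j. j < k \<Longrightarrow> \<not> ?r \<le> 2 ^ 2 ^ j"
    using exists_least_iff[of "\<lambda>k. ?r \<le> 2 ^ 2 ^ k"] by blast
  show thesis
  proof (rule that[of "2 ^ Suc k - 1" "schatten k"])
    show "(1::real) \<le> 2 ^ Suc k - 1" by simp
    show "2 ^ Suc k - 1 \<le> 6 * ln (real (max 1 (rank_cstar B))) + 1"
    proof (cases k)
      case (Suc j)
      then have j: "2 ^ 2 ^ j < ?r" using min[of j] by simp
      have "(1::real) \<le> 2 ^ 2 ^ j" by (rule one_le_power) simp
      then have r1: "1 \<le> ?r" using j by simp
      then have m: "real (max 1 (rank_cstar B)) = ?r" by simp
      have "ln (2 ^ 2 ^ j) \<le> ln ?r" using j by simp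
      then have "2 ^ j * ln 2 \<le> ln ?r" by (simp add: ln_realpow)
      moreover have "2 ^ j * (2 / 3) \<le> 2 ^ j * ln (2::real)"
        using ln2_ge_two_thirds by (intro mult_left_mono) auto
      ultimately have "2 ^ j * (2 / 3) \<le> ln ?r" by linarith
      then show ?thesis unfolding m Suc by simp
    qed simp
    fix x assume x: "x \<in> carr B"
    show "0 \<le> schatten k x" by (rule schatten_ge_0[OF x])
    have *: "u \<le> 2 * v" if "u ^ 2 ^ k \<le> ?r * v ^ 2 ^ k" "0 \<le> u" "0 \<le> v" for u v
    proof (rule power_le_cancel[of _ "2 ^ k"])
      have "?r * v ^ 2 ^ k \<le> 2 ^ 2 ^ k * v ^ 2 ^ k" using k that by (intro mult_right_mono) auto
      then show "u ^ 2 ^ k \<le> (2 * v) ^ 2 ^ k" using that by (simp add: power_mult_distrib)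
    qed (use that in auto)
    show "cnorm B x \<le> 2 * schatten k x"
      using norm_le_schatten[OF low0 _ x, of k] x by (intro *) (auto simp: norm_ge_zero schatten_ge_0)
    show "schatten k x \<le> 2 * cnorm B x"
      using schatten_le_norm[OF up0 _ x, of k] x by (intro *) (auto simp: norm_ge_zero schatten_ge_0)
  next
    fix x y assume "x \<in> carr B" "y \<in> carr B"
    then show "(schatten k (x + y))\<^sup>2 + (schatten k (x - y))\<^sup>2
        \<le> 2 * ((schatten k x)\<^sup>2 + (2 ^ Suc k - 1) * (schatten k y)\<^sup>2)"
      by (rule schatten_two_smooth)
  qed
qed

section \<open>Learning a functional with few corrections\<close>

text \<open>Numbers \<open>\<tau> 0, \<tau> 1, \<dots>\<close> are to be predicted one after the other.  The current hypothesis is a vector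
  Y, and whenever a prediction is off by more than \<open>\<theta>\<close>, the datum \<open>z i\<close> is added to or subtracted from
  Y.  The assumption \<open>smooth\<close> is two-smoothness of N for increments \<open>z i\<close> so short that the second-order
  term is at most \<open>\<theta>\<close>.\<close>

locale smooth_learner =
  fixes V :: "'b::complex_vector set" and N :: "'b \<Rightarrow> real" and \<theta> :: real and z :: "nat \<Rightarrow> 'b"
  assumes V: "complex_vector.subspace V" and z: "z i \<in> V" and \<theta>: "\<theta> > 0" and N0: "N 0 = 0"
    and smooth: "Y \<in> V \<Longrightarrow> (N (Y + z i))\<^sup>2 + (N (Y - z i))\<^sup>2 \<le> 2 * (N Y)\<^sup>2 + 2 * \<theta>"
begin

text \<open>A symmetric difference quotient of \<open>N\<^sup>2 / 2\<close> at Y in the direction \<open>z i\<close>.\<close>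

definition predict :: "'b \<Rightarrow> nat \<Rightarrow> real" where
  "predict Y i = ((N (Y + z i))\<^sup>2 - (N (Y - z i))\<^sup>2) / 4"

definition correction :: "'b \<Rightarrow> nat \<Rightarrow> real \<Rightarrow> real" where
  "correction Y i t = (if \<bar>t - predict Y i\<bar> \<le> \<theta> then 0 else sgn (t - predict Y i))"

primrec hypothesis :: "(nat \<Rightarrow> real) \<Rightarrow> nat \<Rightarrow> 'b" where
  "hypothesis \<tau> 0 = 0"
| "hypothesis \<tau> (Suc i) = hypothesis \<tau> i + scaleC (of_real (correction (hypothesis \<tau> i) i (\<tau> i))) (z i)"

text \<open>A good prediction already determines the number up to \<open>\<theta>\<close>.  After a bad one, the sign of the
  correction and the number itself, rounded to a multiple of \<open>\<theta>\<close>, are recorded.\<close>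

definition code :: "(nat \<Rightarrow> real) \<Rightarrow> nat \<Rightarrow> (real \<times> int) option" where
  "code \<tau> i = (let s = correction (hypothesis \<tau> i) i (\<tau> i)
    in if s = 0 then None else Some (s, \<lfloor>\<tau> i / \<theta>\<rfloor>))"

lemma correction_eq_0: "correction Y i t = 0 \<longleftrightarrow> \<bar>t - predict Y i\<bar> \<le> \<theta>"
  using \<theta> by (auto simp: correction_def sgn_real_def)

lemma hypothesis_cong:
  "(\<And>i. i < n \<Longrightarrow> code \<tau> i = code \<tau>' i) \<Longrightarrow> hypothesis \<tau> n = hypothesis \<tau>' n"
proof (induction n)
  case (Suc n)
  then have "hypothesis \<tau> n = hypothesis \<tau>' n" "code \<tau> n = code \<tau>' n" by auto
  then show ?case by (auto simp: code_def Let_def split: if_splits)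
qed simp

text \<open>The code determines the hypotheses, hence the predictions.\<close>

lemma close_if_same_code:
  assumes "\<And>i. i < n \<Longrightarrow> code \<tau> i = code \<tau>' i" "i < n"
  shows "\<bar>\<tau> i - \<tau>' i\<bar> \<le> 2 * \<theta>"
proof -
  have h: "hypothesis \<tau> i = hypothesis \<tau>' i" using assms by (intro hypothesis_cong) auto
  have c: "code \<tau> i = code \<tau>' i" using assms by auto
  show ?thesis
  proof (cases "code \<tau> i")
    case None
    then have "\<bar>\<tau> i - predict (hypothesis \<tau> i) i\<bar> \<le> \<theta>" "\<bar>\<tau>' i - predict (hypothesis \<tau> i) i\<bar> \<le> \<theta>"
      using c h by (auto simp: code_def Let_def correction_eq_0 split: if_splits)
    then show ?thesis by linarith
  next
    case (Some a)
    then have "\<lfloor>\<tau> i / \<theta>\<rfloor> = \<lfloor>\<tau>' i / \<theta>\<rfloor>"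
      using c by (auto simp: code_def Let_def split: if_splits)
    then have "\<bar>\<tau> i / \<theta> - \<tau>' i / \<theta>\<bar> < 1" by linarith
    then have "\<bar>\<tau> i - \<tau>' i\<bar> < \<theta>" using \<theta> by (simp add: field_simps flip: diff_divide_distrib)
    then show ?thesis using \<theta> by linarith
  qed
qed

abbreviation "sg \<tau> i \<equiv> correction (hypothesis \<tau> i) i (\<tau> i)"

lemma hypothesis_sum: "hypothesis \<tau> n = (\<Sum>i<n. scaleC (of_real (sg \<tau> i)) (z i))"
  by (induction n) auto

lemma hypothesis_closed: "hypothesis \<tau> n \<in> V"
  by (subst hypothesis_sum) (intro complex_vector.subspace_sum[OF V] complex_vector.subspace_scale[OF V] z)

text \<open>A correction with sign s changes \<open>N\<^sup>2\<close> by at most \<open>\<theta> + 2 s\<close> times the prediction, and the prediction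
  fell short of \<open>\<tau> n\<close> by more than \<open>\<theta>\<close> in the direction s.\<close>

lemma potential: "(N (hypothesis \<tau> n))\<^sup>2 + \<theta> * (\<Sum>i<n. \<bar>sg \<tau> i\<bar>) \<le> 2 * (\<Sum>i<n. sg \<tau> i * \<tau> i)"
proof (induction n)
  case (Suc n)
  let ?Y = "hypothesis \<tau> n" and ?s = "sg \<tau> n"
  have "(N (hypothesis \<tau> (Suc n)))\<^sup>2 + \<theta> * \<bar>?s\<bar> \<le> (N ?Y)\<^sup>2 + 2 * (?s * \<tau> n)"
  proof (cases "\<bar>\<tau> n - predict ?Y n\<bar> \<le> \<theta>")
    case True
    then show ?thesis by (simp add: correction_def)
  next
    case False
    note sm = smooth[OF hypothesis_closed[of \<tau> n], of n]
    show ?thesis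
    proof (cases "\<tau> n - predict ?Y n > 0")
      case True
      then have s: "?s = 1" using False by (simp add: correction_def)
      have "(N (?Y + z n))\<^sup>2 \<le> (N ?Y)\<^sup>2 + \<theta> + 2 * predict ?Y n" using sm by (simp add: predict_def field_simps)
      then show ?thesis using False True by (simp add: s scaleC_one)
    next
      case neg: False
      then have s: "?s = -1" using False \<theta> by (simp add: correction_def sgn_real_def)
      have "(N (?Y - z n))\<^sup>2 \<le> (N ?Y)\<^sup>2 + \<theta> - 2 * predict ?Y n" using sm by (simp add: predict_def field_simps)
      then show ?thesis using False neg by (simp add: s scaleC_one)
    qed
  qed
  then show ?case using Suc by (simp add: algebra_simps del: hypothesis.simps)
qed (simp add: N0)

text \<open>If \<open>\<tau>\<close> comes from a functional bounded by \<open>\<kappa> N\<close>, up to a small error per correction, then the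
  potential leaves only \<open>2 \<kappa> N - N\<^sup>2 \<le> \<kappa>\<^sup>2\<close> to be spent on corrections.\<close>

lemma few_corrections:
  assumes dual: "(\<Sum>i<n. sg \<tau> i * \<tau> i) \<le> \<kappa> * N (hypothesis \<tau> n) + \<theta> / 4 * (\<Sum>i<n. \<bar>sg \<tau> i\<bar>)"
  shows "\<theta> * real (card {i\<in>{..<n}. code \<tau> i \<noteq> None}) \<le> 2 * \<kappa>\<^sup>2"
proof -
  have "(\<Sum>i<n. \<bar>sg \<tau> i\<bar>) = (\<Sum>i<n. if code \<tau> i \<noteq> None then 1 else 0)"
    by (intro sum.cong refl) (auto simp: code_def Let_def correction_def abs_sgn_eq)
  also have "\<dots> = real (card {i\<in>{..<n}. code \<tau> i \<noteq> None})"
    by (subst sum.inter_filter[symmetric]) auto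
  finally have m: "(\<Sum>i<n. \<bar>sg \<tau> i\<bar>) = real (card {i\<in>{..<n}. code \<tau> i \<noteq> None})" .
  have "0 \<le> (N (hypothesis \<tau> n) - \<kappa>)\<^sup>2" by simp
  then show ?thesis using potential[of \<tau> n] dual unfolding m
    by (simp add: power2_diff algebra_simps)
qed

lemma code_in:
  assumes "\<bar>\<tau> i\<bar> \<le> \<theta> * M"
  shows "code \<tau> i \<in> insert None (Some ` ({1, -1} \<times> {\<lfloor>- M\<rfloor>..\<lfloor>M\<rfloor>}))"
proof -
  have "\<tau> i / \<theta> \<le> M" "- M \<le> \<tau> i / \<theta>" using assms \<theta> by (auto simp: field_simps abs_le_iff)
  then show ?thesis
    by (auto simp: code_def Let_def correction_def sgn_real_def intro!: floor_mono split: if_splits)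
qed

end

definition sparse_functions :: "nat \<Rightarrow> 'l set \<Rightarrow> nat \<Rightarrow> (nat \<Rightarrow> 'l option) set" where
  "sparse_functions n \<Lambda> K =
    {c \<in> {..<n} \<rightarrow>\<^sub>E insert None (Some ` \<Lambda>). card {i\<in>{..<n}. c i \<noteq> None} \<le> K}"

lemma finite_sparse_functions: "finite \<Lambda> \<Longrightarrow> finite (sparse_functions n \<Lambda> K)"
  unfolding sparse_functions_def
  by (rule finite_subset[OF _ finite_PiE[of "{..<n}" "\<lambda>_. insert None (Some ` \<Lambda>)"]]) auto

text \<open>Each of the functions has weight at least 1 if every value other than \<open>None\<close> is given the weight
  t and the total is multiplied by \<open>t ^ (- K)\<close>; the sum of these weights over all functions is a product.
  For K of smaller order than n this bound grows subexponentially in n, because t can be taken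
  arbitrarily small.\<close>

lemma card_sparse_functions_le:
  assumes fin: "finite \<Lambda>" and t: "0 < t" "t \<le> 1"
  shows "real (card (sparse_functions n \<Lambda> K)) \<le> (1 / t) ^ K * exp (t * real n * real (card \<Lambda>))"
    (is "real (card ?F) \<le> _")
proof -
  let ?P = "{..<n} \<rightarrow>\<^sub>E insert None (Some ` \<Lambda>)" and ?m = "\<lambda>c. card {i\<in>{..<n}. c i \<noteq> None}"
  let ?w = "\<lambda>l. if l = None then 1 else t"
  have finP: "finite ?P" using fin by (intro finite_PiE) auto
  have "real (card ?F) = (\<Sum>c\<in>?F. 1)" by simp
  also have "\<dots> \<le> (\<Sum>c\<in>?F. (1 / t) ^ K * t ^ ?m c)"
  proof (rule sum_mono)
    fix c assume "c \<in> ?F"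
    then have "t ^ K \<le> t ^ ?m c" using t by (intro power_decreasing) (auto simp: sparse_functions_def)
    then show "1 \<le> (1 / t) ^ K * t ^ ?m c" using t by (simp add: power_one_over field_simps)
  qed
  also have "\<dots> \<le> (\<Sum>c\<in>?P. (1 / t) ^ K * t ^ ?m c)"
    using finP t by (intro sum_mono2) (auto simp: sparse_functions_def)
  also have "\<dots> = (1 / t) ^ K * (\<Sum>c\<in>?P. \<Prod>i<n. ?w (c i))"
  proof -
    have "(\<Prod>i<n. ?w (c i)) = t ^ ?m c" for c :: "nat \<Rightarrow> 'a option"
    proof -
      have "(\<Prod>i<n. ?w (c i)) = (\<Prod>i\<in>{i\<in>{..<n}. c i \<noteq> None}. t)"
        by (subst prod.inter_filter) (auto intro!: prod.cong)
      then show ?thesis by simp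
    qed
    then show ?thesis by (simp add: sum_distrib_left)
  qed
  also have "(\<Sum>c\<in>?P. \<Prod>i<n. ?w (c i)) = (\<Prod>i<n. \<Sum>l\<in>insert None (Some ` \<Lambda>). ?w l)"
    using fin by (subst prod_sum_PiE) auto
  also have "\<dots> = (1 + t * real (card \<Lambda>)) ^ n"
  proof -
    have "(\<Sum>l\<in>insert None (Some ` \<Lambda>). ?w l) = 1 + t * real (card \<Lambda>)"
      using fin by (subst sum.insert) (auto simp: sum.reindex)
    then show ?thesis by simp
  qed
  also have "\<dots> \<le> exp (t * real (card \<Lambda>)) ^ n"
    using t by (intro power_mono) (auto simp: exp_ge_add_one_self)
  also have "\<dots> = exp (t * real n * real (card \<Lambda>))"
    by (simp add: exp_of_nat_mult[symmetric] mult_ac)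
  finally show ?thesis using t by simp
qed

section \<open>The quasi-state space\<close>

lemma closedin_Ball:
  assumes "\<And>i. i \<in> I \<Longrightarrow> closedin X {x \<in> topspace X. P i x}"
  shows "closedin X {x \<in> topspace X. \<forall>i\<in>I. P i x}"
proof (cases "I = {}")
  case False
  then have "{x \<in> topspace X. \<forall>i\<in>I. P i x} = (\<Inter>i\<in>I. {x \<in> topspace X. P i x})" by blast
  then show ?thesis using False assms by auto
qed auto

lemma openin_finite_Ball:
  assumes "finite I" "\<And>i. i \<in> I \<Longrightarrow> openin X {x \<in> topspace X. P i x}"
  shows "openin X {x \<in> topspace X. \<forall>i\<in>I. P i x}"
  using assms
proof (induction I rule: finite_induct)
  case (insert i I)
  have "{x \<in> topspace X. \<forall>j\<in>insert i I. P j x}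
      = {x \<in> topspace X. P i x} \<inter> {x \<in> topspace X. \<forall>j\<in>I. P j x}" by blast
  then show ?case using insert by (simp add: openin_Int)
qed auto

lemma quasi_states_extensional: "quasi_states A \<subseteq> extensional (carr A)"
  by (auto simp: quasi_states_def)

lemma topspace_quasi_state_space [simp]: "topspace (quasi_state_space A) = quasi_states A"
  using quasi_states_extensional[of A] by (auto simp: quasi_state_space_def PiE_def)

text \<open>As in the Banach-Alaoglu theorem, the quasi-states form a closed subset of a product of discs.\<close>

lemma compact_space_quasi_state_space:
  assumes "cstar_algebra A"
  shows "compact_space (quasi_state_space A)"
proof -
  interpret cstar_algebra A by fact
  let ?P = "product_topology (\<lambda>_. euclidean :: complex topology) (carr A)"
  have top: "topspace ?P = extensional (carr A)" by (simp add: PiE_def)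
  note cont = continuous_map_product_projection[of _ "carr A" "\<lambda>_. euclidean :: complex topology"]
  have pre: "closedin ?P {\<phi> \<in> topspace ?P. f \<phi> \<in> K}"
    if "continuous_map ?P euclidean f" "closed K" for f :: "('a \<Rightarrow> complex) \<Rightarrow> complex" and K
    using closedin_continuous_map_preimage[OF that(1), of K] that(2) by simp
  have pos: "x \<in> carr A" if "x \<in> positive_elements A" for x
    using that by (auto simp: positive_elements_def)
  have 1: "closedin ?P {\<phi> \<in> topspace ?P. \<forall>x\<in>carr A. \<forall>y\<in>carr A. \<phi> (x + y) - (\<phi> x + \<phi> y) \<in> {0}}"
    by (intro closedin_Ball pre[of "\<lambda>\<phi>. \<phi> (_ + _) - (\<phi> _ + \<phi> _)"] continuous_map_diff continuous_map_add cont) auto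
  have 2: "closedin ?P {\<phi> \<in> topspace ?P. \<forall>c\<in>UNIV. \<forall>x\<in>carr A. \<phi> (scaleC c x) - c * \<phi> x \<in> {0}}"
  proof (intro closedin_Ball)
    fix c x assume x: "x \<in> carr A"
    have "continuous_map ?P euclidean (\<lambda>\<phi>. c * \<phi> x)"
      using continuous_map_compose[OF cont[OF x], of euclidean "(*) c"]
      by (simp add: o_def continuous_intros)
    with x show "closedin ?P {\<phi> \<in> topspace ?P. \<phi> (scaleC c x) - c * \<phi> x \<in> {0}}"
      by (intro pre[of "\<lambda>\<phi>. \<phi> (scaleC c x) - c * \<phi> x"] continuous_map_diff cont) auto
  qed
  have 3: "closedin ?P {\<phi> \<in> topspace ?P. \<forall>x\<in>positive_elements A. \<phi> x \<in> \<real>\<^sub>\<ge>\<^sub>0}"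
    by (intro closedin_Ball pre[of "\<lambda>\<phi>. \<phi> _"] cont pos closed_nonneg_Reals_complex)
  have 4: "closedin ?P {\<phi> \<in> topspace ?P. \<forall>x\<in>carr A. \<phi> x \<in> cball 0 (cnorm A x)}"
    by (intro closedin_Ball pre[of "\<lambda>\<phi>. \<phi> _"] cont closed_cball)
  have "quasi_states A = {\<phi> \<in> topspace ?P. \<forall>x\<in>carr A. \<forall>y\<in>carr A. \<phi> (x + y) - (\<phi> x + \<phi> y) \<in> {0}}
      \<inter> {\<phi> \<in> topspace ?P. \<forall>c\<in>UNIV. \<forall>x\<in>carr A. \<phi> (scaleC c x) - c * \<phi> x \<in> {0}}
      \<inter> {\<phi> \<in> topspace ?P. \<forall>x\<in>positive_elements A. \<phi> x \<in> \<real>\<^sub>\<ge>\<^sub>0}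
      \<inter> {\<phi> \<in> topspace ?P. \<forall>x\<in>carr A. \<phi> x \<in> cball 0 (cnorm A x)}"
    unfolding top quasi_states_def by auto
  then have "closedin ?P (quasi_states A)" using 1 2 3 4 by (simp only: closedin_Int)
  moreover have "compactin ?P (PiE (carr A) (\<lambda>x. cball 0 (cnorm A x)))"
    by (simp add: compactin_PiE)
  moreover have "quasi_states A \<subseteq> PiE (carr A) (\<lambda>x. cball 0 (cnorm A x))"
    by (auto simp: quasi_states_def PiE_def)
  ultimately have "compactin ?P (quasi_states A)" by (metis closed_compactin)
  then show ?thesis unfolding quasi_state_space_def by (rule compact_space_subtopology)
qed

lemma openin_quasi_state_nbhd:
  assumes "finite F" "F \<subseteq> carr A"
  shows "openin (quasi_state_space A) {\<omega> \<in> quasi_states A. \<forall>x\<in>F. cmod (\<omega> x - \<sigma> x) < e}"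
proof -
  have "openin (quasi_state_space A) {\<omega> \<in> topspace (quasi_state_space A). \<forall>x\<in>F. cmod (\<omega> x - \<sigma> x) < e}"
  proof (rule openin_finite_Ball[OF assms(1)])
    fix x assume "x \<in> F"
    then have "continuous_map (quasi_state_space A) euclidean (\<lambda>\<omega>. \<omega> x)"
      unfolding quasi_state_space_def using assms(2)
      by (intro continuous_map_from_subtopology continuous_map_product_projection[of x "carr A" "\<lambda>_. euclidean"]) auto
    from openin_continuous_map_preimage[OF this, of "ball (\<sigma> x) e"]
    show "openin (quasi_state_space A) {\<omega> \<in> topspace (quasi_state_space A). cmod (\<omega> x - \<sigma> x) < e}"
      by (simp add: dist_norm norm_minus_commute)
  qed
  then show ?thesis by simp
qed

lemma quasi_state_nbhd_base:
  assumes u: "openin (quasi_state_space A) u" and \<sigma>: "\<sigma> \<in> u"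
  obtains F e where "finite F" "F \<subseteq> carr A" "e > 0"
    "\<And>\<omega>. \<omega> \<in> quasi_states A \<Longrightarrow> (\<And>x. x \<in> F \<Longrightarrow> cmod (\<omega> x - \<sigma> x) < e) \<Longrightarrow> \<omega> \<in> u"
proof -
  obtain S where S: "openin (product_topology (\<lambda>_. euclidean :: complex topology) (carr A)) S"
    and uS: "u = S \<inter> quasi_states A"
    using u by (auto simp: quasi_state_space_def openin_subtopology)
  have "\<sigma> \<in> S" using \<sigma> uS by blast
  then obtain W where W: "finite {x \<in> carr A. W x \<noteq> (UNIV :: complex set)}" "\<And>x. x \<in> carr A \<Longrightarrow> open (W x)"
    "\<sigma> \<in> PiE (carr A) W" "PiE (carr A) W \<subseteq> S"
    using S unfolding openin_product_topology_alt by auto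
  let ?F = "{x \<in> carr A. W x \<noteq> UNIV}"
  have "\<forall>x\<in>?F. \<exists>e>0. ball (\<sigma> x) e \<subseteq> W x"
  proof
    fix x assume x: "x \<in> ?F"
    then have "open (W x)" "\<sigma> x \<in> W x" using W(2,3) by (auto simp: PiE_def Pi_def)
    then show "\<exists>e>0. ball (\<sigma> x) e \<subseteq> W x" by (rule openE) blast
  qed
  then obtain r where r: "\<And>x. x \<in> ?F \<Longrightarrow> r x > 0 \<and> ball (\<sigma> x) (r x) \<subseteq> W x" by metis
  define e where "e = Min (insert 1 (r ` ?F))"
  have e: "e > 0" unfolding e_def using W(1) r by (subst Min_gr_iff) auto
  have er: "e \<le> r x" if "x \<in> ?F" for x unfolding e_def using W(1) that by (intro Min_le) auto
  have "\<omega> \<in> u" if \<omega>: "\<omega> \<in> quasi_states A" and c: "\<And>x. x \<in> ?F \<Longrightarrow> cmod (\<omega> x - \<sigma> x) < e" for \<omega>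
  proof -
    have "\<omega> x \<in> W x" if x: "x \<in> carr A" for x
    proof (cases "x \<in> ?F")
      case True
      then have "\<omega> x \<in> ball (\<sigma> x) (r x)" using c[OF True] er[OF True] by (simp add: dist_norm norm_minus_commute)
      then show ?thesis using r[OF True] by blast
    qed (use x in auto)
    then have "\<omega> \<in> PiE (carr A) W" using \<omega> quasi_states_extensional by (auto simp: PiE_def)
    then show ?thesis using W(4) uS \<omega> by blast
  qed
  with that[of ?F e] show thesis using W(1) e by blast
qed

text \<open>Each point has a basic neighbourhood of twice the needed width inside a member of the cover;
  finitely many of the narrow ones cover the compact space.\<close>

lemma quasi_state_Lebesgue_number:
  assumes A: "cstar_algebra A" and U: "finite_open_cover (quasi_state_space A) U"
  obtains F e where "finite F" "F \<subseteq> carr A" "e > 0"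
    "\<And>\<sigma>. \<sigma> \<in> quasi_states A \<Longrightarrow>
      \<exists>u\<in>U. \<forall>\<omega>\<in>quasi_states A. (\<forall>x\<in>F. cmod (\<omega> x - \<sigma> x) < e) \<longrightarrow> \<omega> \<in> u"
proof -
  let ?Q = "quasi_states A"
  have "\<exists>F e u. finite F \<and> F \<subseteq> carr A \<and> e > 0 \<and> u \<in> U \<and>
      (\<forall>\<omega>\<in>?Q. (\<forall>x\<in>F. cmod (\<omega> x - \<sigma> x) < e) \<longrightarrow> \<omega> \<in> u)" if \<sigma>: "\<sigma> \<in> ?Q" for \<sigma>
  proof -
    have "\<Union>U = ?Q" using U by (simp add: finite_open_cover_def)
    then obtain u where u: "u \<in> U" "\<sigma> \<in> u" using \<sigma> by blast
    then have "openin (quasi_state_space A) u" using U by (simp add: finite_open_cover_def)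
    from quasi_state_nbhd_base[OF this u(2)] u(1) show ?thesis by metis
  qed
  then obtain F e u where Feu: "\<And>\<sigma>. \<sigma> \<in> ?Q \<Longrightarrow> finite (F \<sigma>) \<and> F \<sigma> \<subseteq> carr A \<and> e \<sigma> > (0::real) \<and> u \<sigma> \<in> U \<and>
      (\<forall>\<omega>\<in>?Q. (\<forall>x\<in>F \<sigma>. cmod (\<omega> x - \<sigma> x) < e \<sigma>) \<longrightarrow> \<omega> \<in> u \<sigma>)"
    by metis
  define nb where "nb \<sigma> = {\<omega> \<in> ?Q. \<forall>x\<in>F \<sigma>. cmod (\<omega> x - \<sigma> x) < e \<sigma> / 2}" for \<sigma>
  have "\<And>\<sigma>. \<sigma> \<in> ?Q \<Longrightarrow> openin (quasi_state_space A) (nb \<sigma>)"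
    unfolding nb_def using Feu by (intro openin_quasi_state_nbhd) auto
  moreover have "?Q \<subseteq> \<Union>(nb ` ?Q)" using Feu by (fastforce simp: nb_def)
  ultimately obtain \<F> where "finite \<F>" "\<F> \<subseteq> nb ` ?Q" "?Q \<subseteq> \<Union>\<F>"
    using compact_space_quasi_state_space[OF A] unfolding compact_space_alt topspace_quasi_state_space
    by (metis (no_types, lifting) imageE)
  then obtain P where P: "finite P" "P \<subseteq> ?Q" "?Q \<subseteq> \<Union>(nb ` P)"
    by (metis finite_subset_image)
  define d where "d = Min (insert 1 ((\<lambda>\<sigma>. e \<sigma> / 2) ` P))"
  have d: "d > 0" unfolding d_def using P Feu by (subst Min_gr_iff) auto
  have de: "d \<le> e \<sigma> / 2" if "\<sigma> \<in> P" for \<sigma> unfolding d_def using P that by (intro Min_le) auto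
  show thesis
  proof (rule that[of "\<Union>(F ` P)" d])
    show "finite (\<Union>(F ` P))" "\<Union>(F ` P) \<subseteq> carr A" using P Feu by blast+
    fix \<sigma> assume "\<sigma> \<in> ?Q"
    then obtain p where p: "p \<in> P" "\<sigma> \<in> nb p" using P by blast
    then have pQ: "p \<in> ?Q" using P by blast
    have "\<omega> \<in> u p" if \<omega>: "\<omega> \<in> ?Q" "\<forall>x\<in>\<Union>(F ` P). cmod (\<omega> x - \<sigma> x) < d" for \<omega>
    proof -
      have "cmod (\<omega> x - p x) < e p" if x: "x \<in> F p" for x
      proof -
        have "cmod (\<omega> x - p x) \<le> cmod (\<omega> x - \<sigma> x) + cmod (\<sigma> x - p x)"
          using norm_triangle_ineq[of "\<omega> x - \<sigma> x" "\<sigma> x - p x"] by simp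
        moreover have "cmod (\<omega> x - \<sigma> x) < d" using \<omega> x p by blast
        moreover have "cmod (\<sigma> x - p x) < e p / 2" using p x by (simp add: nb_def)
        ultimately show ?thesis using de[OF p(1)] by linarith
      qed
      then show ?thesis using Feu[OF pQ] \<omega> by blast
    qed
    then show "\<exists>u\<in>U. \<forall>\<omega>\<in>?Q. (\<forall>x\<in>\<Union>(F ` P). cmod (\<omega> x - \<sigma> x) < d) \<longrightarrow> \<omega> \<in> u"
      using Feu[OF pQ] by blast
  qed (rule d)
qed

section \<open>Minimal subcovers and the induced map\<close>

lemma min_subcover_le_card:
  assumes fin: "finite K" and c: "\<And>x. x \<in> topspace X \<Longrightarrow> c x \<in> K"
    and J: "\<And>W. W \<in> J \<Longrightarrow> W \<subseteq> topspace X"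
    and cell: "\<And>x. x \<in> topspace X \<Longrightarrow> \<exists>W\<in>J. \<forall>y\<in>topspace X. c y = c x \<longrightarrow> y \<in> W"
  shows "min_subcover X J \<le> card K"
proof -
  obtain w where w: "\<And>x. x \<in> topspace X \<Longrightarrow> w x \<in> J \<and> (\<forall>y\<in>topspace X. c y = c x \<longrightarrow> y \<in> w x)"
    using cell by metis
  define rep where "rep k = (SOME x. x \<in> topspace X \<and> c x = k)" for k
  have rep: "rep (c x) \<in> topspace X \<and> c (rep (c x)) = c x" if "x \<in> topspace X" for x
    unfolding rep_def by (rule someI[of _ x]) (use that in simp)
  let ?W = "(\<lambda>k. w (rep k)) ` c ` topspace X"
  have cK: "c ` topspace X \<subseteq> K" using c by blast
  then have finc: "finite (c ` topspace X)" using fin by (rule finite_subset)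
  have "?W \<subseteq> J" using w rep by auto
  moreover have "\<Union>?W = topspace X"
  proof
    show "\<Union>?W \<subseteq> topspace X" using \<open>?W \<subseteq> J\<close> J by blast
    show "topspace X \<subseteq> \<Union>?W"
    proof
      fix x assume x: "x \<in> topspace X"
      then have "x \<in> w (rep (c x))" using w[of "rep (c x)"] rep[OF x] by auto
      then show "x \<in> \<Union>?W" using x by blast
    qed
  qed
  ultimately have "min_subcover X J \<le> card ?W"
    unfolding min_subcover_def using finc by (intro Least_le exI[of _ ?W]) auto
  also have "\<dots> \<le> card K"
    using card_image_le[OF finc] card_mono[OF fin cK] by (rule order_trans)
  finally show ?thesis .
qed

context cstar_algebra
begin

lemma automorphism_iterate:
  assumes \<alpha>: "cstar_automorphism A \<alpha>" and x: "x \<in> carr A" and y: "y \<in> carr A"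
  shows "(\<alpha> ^^ i) x \<in> carr A" "(\<alpha> ^^ i) (x + y) = (\<alpha> ^^ i) x + (\<alpha> ^^ i) y"
    "(\<alpha> ^^ i) (scaleC c x) = scaleC c ((\<alpha> ^^ i) x)" "cnorm A ((\<alpha> ^^ i) x) \<le> cnorm A x"
proof -
  have hom: "star_hom A A \<alpha>" using \<alpha> by (simp add: cstar_automorphism_def)
  note h = star_homD[OF hom]
  have c: "(\<alpha> ^^ i) x \<in> carr A" if "x \<in> carr A" for i x
    by (induction i) (use that h(1) in auto)
  show "(\<alpha> ^^ i) x \<in> carr A" by (rule c[OF x])
  show "(\<alpha> ^^ i) (x + y) = (\<alpha> ^^ i) x + (\<alpha> ^^ i) y"
    by (induction i) (use x y c h(2) in auto)
  show "(\<alpha> ^^ i) (scaleC k x) = scaleC k ((\<alpha> ^^ i) x)" for k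
    by (induction i) (use x c h(3) in auto)
  show "cnorm A ((\<alpha> ^^ i) x) \<le> cnorm A x"
  proof (induction i)
    case (Suc i)
    have "cnorm A (\<alpha> ((\<alpha> ^^ i) x)) \<le> cnorm A ((\<alpha> ^^ i) x)"
      by (rule star_hom_contractive[OF _ _ hom c[OF x]]) unfold_locales
    then show ?case using Suc by simp
  qed simp
qed

lemma induced_map_quasi_state:
  assumes \<alpha>: "cstar_automorphism A \<alpha>" and \<omega>: "\<omega> \<in> quasi_states A"
  shows "induced_map A \<alpha> \<omega> \<in> quasi_states A"
proof -
  have hom: "star_hom A A \<alpha>" using \<alpha> by (simp add: cstar_automorphism_def)
  note h = star_homD[OF hom]
  have con: "cnorm A (\<alpha> x) \<le> cnorm A x" if "x \<in> carr A" for x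
    by (rule star_hom_contractive[OF _ _ hom that]) unfold_locales
  have bound: "cmod (\<omega> (\<alpha> x)) \<le> cnorm A x" if x: "x \<in> carr A" for x
    using \<omega> h(1)[OF x x] con[OF x] by (force simp: quasi_states_def)
  have pos: "x \<in> carr A \<and> \<alpha> x \<in> positive_elements A" if "x \<in> positive_elements A" for x
    using that h by (auto simp: positive_elements_def)
  show ?thesis
    using \<omega> h pos bound unfolding quasi_states_def induced_map_def by auto
qed

lemma induced_map_iterate:
  assumes \<alpha>: "cstar_automorphism A \<alpha>" and \<omega>: "\<omega> \<in> quasi_states A"
  shows "(induced_map A \<alpha> ^^ i) \<omega> \<in> quasi_states A"
    "x \<in> carr A \<Longrightarrow> (induced_map A \<alpha> ^^ i) \<omega> x = \<omega> ((\<alpha> ^^ i) x)"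
proof -
  show "(induced_map A \<alpha> ^^ i) \<omega> \<in> quasi_states A"
    by (induction i) (use \<omega> induced_map_quasi_state[OF \<alpha>] in auto)
  show "x \<in> carr A \<Longrightarrow> (induced_map A \<alpha> ^^ i) \<omega> x = \<omega> ((\<alpha> ^^ i) x)"
  proof (induction i arbitrary: x)
    case (Suc i)
    have "\<alpha> x \<in> carr A" using automorphism_iterate(1)[OF \<alpha> Suc.prems Suc.prems, of 1] by simp
    then show ?case using Suc by (simp add: induced_map_def funpow_swap1)
  qed simp
qed

end

section \<open>Coding quasi-states through finite-dimensional approximants\<close>

lemma sum_scaleC_apply:
  fixes f :: "'i \<Rightarrow> 'x \<Rightarrow> 'b::complex_vector"
  shows "(\<Sum>i\<in>I. scaleC (k i) (f i)) \<xi> = (\<Sum>i\<in>I. scaleC (k i) (f i \<xi>))"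
  by (induction I rule: infinite_finite_induct) (auto simp: scaleC_fun_def)

lemma linear_map_sum:
  assumes "linear_map A B f" "cstar_algebra A" "\<And>i. i \<in> I \<Longrightarrow> x i \<in> carr A"
  shows "f (\<Sum>i\<in>I. scaleC (c i) (x i)) = (\<Sum>i\<in>I. scaleC (c i) (f (x i)))"
proof -
  interpret cstar_algebra A by fact
  have f: "f (x + y) = f x + f y" if "x \<in> carr A" "y \<in> carr A" for x y
    using assms(1) that by (auto simp: linear_map_def)
  have fc: "f (scaleC c x) = scaleC c (f x)" if "x \<in> carr A" for x c
    using assms(1) that by (auto simp: linear_map_def)
  have f0: "f 0 = 0" using f[of 0 0] by simp
  show ?thesis
    using assms(3) by (induction I rule: infinite_finite_induct) (auto simp: f fc f0 sum_closed)
qed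

context cstar_algebra
begin

lemma quasi_state_sum:
  assumes "\<omega> \<in> quasi_states A" "\<And>i. i \<in> I \<Longrightarrow> x i \<in> carr A"
  shows "\<omega> (\<Sum>i\<in>I. scaleC (c i) (x i)) = (\<Sum>i\<in>I. c i * \<omega> (x i))"
proof -
  have w: "\<omega> (x + y) = \<omega> x + \<omega> y" if "x \<in> carr A" "y \<in> carr A" for x y
    using assms(1) that by (auto simp: quasi_states_def)
  have wc: "\<omega> (scaleC c x) = c * \<omega> x" if "x \<in> carr A" for x c
    using assms(1) that by (auto simp: quasi_states_def)
  have w0: "\<omega> 0 = 0" using w[of 0 0] by simp
  show ?thesis
    using assms(2) by (induction I rule: infinite_finite_induct) (auto simp: w wc w0 sum_closed)
qed

text \<open>A quasi-state is bounded by the norm of A, which is at most twice the norm in the representation,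
  where \<open>\<psi> \<circ> \<phi>\<close> is close to \<open>\<pi>\<close>.  So on real combinations of the \<open>y i\<close> a quasi-state behaves like
  a functional on B of norm at most 2, up to an error that is linear in the coefficients.\<close>

lemma approximation_dual_bound:
  fixes \<pi> :: "'a \<Rightarrow> 'h \<Rightarrow> 'h::chilbert_space"
  assumes \<pi>: "faithful_rep A \<pi>" and cpa: "(\<phi>, \<psi>, B) \<in> CPA A \<pi> Y \<delta>"
    and y: "\<And>i. i \<in> I \<Longrightarrow> y i \<in> carr A \<and> y i \<in> Y" and \<omega>: "\<omega> \<in> quasi_states A"
  shows "(\<Sum>i\<in>I. c i * Re (\<omega> (y i)))
    \<le> 2 * cnorm B (\<Sum>i\<in>I. scaleC (of_real (c i)) (\<phi> (y i))) + 2 * \<delta> * (\<Sum>i\<in>I. \<bar>c i\<bar>)"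
proof -
  define x where "x = (\<Sum>i\<in>I. scaleC (of_real (c i)) (y i))"
  have x: "x \<in> carr A" unfolding x_def using y by (intro sum_closed scale_closed) blast
  have B: "cstar_algebra B" and \<phi>: "linear_map A B \<phi>" and \<psi>: "linear_map B bounded_operators \<psi>"
    and \<psi>1: "\<And>b. b \<in> carr B \<Longrightarrow> onorm (\<psi> b) \<le> cnorm B b"
    and app: "\<And>a. a \<in> Y \<Longrightarrow> onorm (\<psi> (\<phi> a) - \<pi> a) < \<delta>"
    using cpa by (auto simp: CPA_def finite_dim_cstar_def cpc_map_def completely_positive_def bounded_operators_def)
  have \<pi>lin: "linear_map A bounded_operators \<pi>" using \<pi> by (auto simp: faithful_rep_def star_hom_def)
  have \<phi>c: "\<phi> a \<in> carr B" if "a \<in> carr A" for a using \<phi> that by (auto simp: linear_map_def)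
  have \<psi>c: "\<psi> b \<in> carr bounded_operators" if "b \<in> carr B" for b using \<psi> that by (auto simp: linear_map_def)
  have \<pi>c: "\<pi> a \<in> carr bounded_operators" if "a \<in> carr A" for a using \<pi>lin that by (auto simp: linear_map_def)
  note blin = bounded_operatorsD(1)
  have bdiff: "bounded_linear (\<psi> (\<phi> (y i)) - \<pi> (y i))" if "i \<in> I" for i
    using bounded_linear_sub[OF blin[OF \<psi>c[OF \<phi>c]] blin[OF \<pi>c], of "y i" "y i"] y[OF that]
    by (simp add: fun_diff_def)
  let ?d = "\<lambda>i. \<psi> (\<phi> (y i)) - \<pi> (y i)"
  have \<phi>x: "\<phi> x = (\<Sum>i\<in>I. scaleC (of_real (c i)) (\<phi> (y i)))"
    unfolding x_def using y by (intro linear_map_sum[OF \<phi>]) (auto, unfold_locales)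
  have \<psi>x: "\<psi> (\<phi> x) = (\<Sum>i\<in>I. scaleC (of_real (c i)) (\<psi> (\<phi> (y i))))"
    unfolding \<phi>x using y by (intro linear_map_sum[OF \<psi> B]) (auto intro: \<phi>c)
  have \<pi>x: "\<pi> x = (\<Sum>i\<in>I. scaleC (of_real (c i)) (\<pi> (y i)))"
    unfolding x_def using y by (intro linear_map_sum[OF \<pi>lin]) (auto, unfold_locales)
  have "norm (\<pi> x \<xi>) \<le> (cnorm B (\<phi> x) + \<delta> * (\<Sum>i\<in>I. \<bar>c i\<bar>)) * norm \<xi>" for \<xi>
  proof -
    have "norm (\<psi> (\<phi> x) \<xi> - \<pi> x \<xi>) = norm (\<Sum>i\<in>I. c i *\<^sub>R ?d i \<xi>)"
      unfolding \<psi>x \<pi>x sum_scaleC_apply sum_subtractf[symmetric]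
      by (simp add: scaleR_eq_scaleC complex_vector.scale_right_diff_distrib)
    also have "\<dots> \<le> (\<Sum>i\<in>I. \<bar>c i\<bar> * (\<delta> * norm \<xi>))"
    proof (intro sum_norm_le)
      fix i assume i: "i \<in> I"
      have "norm (?d i \<xi>) \<le> onorm (?d i) * norm \<xi>"
        by (rule onorm[OF bdiff[OF i]])
      also have "\<dots> \<le> \<delta> * norm \<xi>"
        using app[of "y i"] y[OF i] by (intro mult_right_mono) auto
      finally show "norm (c i *\<^sub>R ?d i \<xi>) \<le> \<bar>c i\<bar> * (\<delta> * norm \<xi>)"
        by (simp add: mult_left_mono)
    qed
    also have "\<dots> = \<delta> * (\<Sum>i\<in>I. \<bar>c i\<bar>) * norm \<xi>"
      by (simp add: sum_distrib_left sum_distrib_right mult_ac)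
    finally have 1: "norm (\<psi> (\<phi> x) \<xi> - \<pi> x \<xi>) \<le> \<delta> * (\<Sum>i\<in>I. \<bar>c i\<bar>) * norm \<xi>" .
    have "norm (\<psi> (\<phi> x) \<xi>) \<le> onorm (\<psi> (\<phi> x)) * norm \<xi>"
      by (rule onorm[OF blin[OF \<psi>c[OF \<phi>c[OF x]]]])
    also have "\<dots> \<le> cnorm B (\<phi> x) * norm \<xi>" by (intro mult_right_mono \<psi>1 \<phi>c x) simp
    finally have "norm (\<psi> (\<phi> x) \<xi>) \<le> cnorm B (\<phi> x) * norm \<xi>" .
    then show ?thesis
      using 1 norm_triangle_sub[of "\<pi> x \<xi>" "\<psi> (\<phi> x) \<xi>"] by (simp add: norm_minus_commute algebra_simps)
  qed
  moreover have "0 \<le> cnorm B (\<phi> x) + \<delta> * (\<Sum>i\<in>I. \<bar>c i\<bar>)"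
  proof -
    have "0 \<le> \<delta>" if i: "i \<in> I" for i
    proof -
      from onorm_pos_le[OF bdiff[OF i]] show ?thesis using app[of "y i"] y[OF i] by simp
    qed
    then have "0 \<le> \<delta> * (\<Sum>i\<in>I. \<bar>c i\<bar>)"
      unfolding sum_distrib_left by (intro sum_nonneg mult_nonneg_nonneg) auto
    then show ?thesis using cstar_algebra.norm_ge_zero[OF B \<phi>c[OF x]] by simp
  qed
  ultimately have o: "onorm (\<pi> x) \<le> cnorm B (\<phi> x) + \<delta> * (\<Sum>i\<in>I. \<bar>c i\<bar>)"
    by (intro onorm_bound)
  have "(\<Sum>i\<in>I. c i * Re (\<omega> (y i))) = Re (\<omega> x)"
    unfolding x_def using y by (subst quasi_state_sum[OF \<omega>]) auto
  also have "\<dots> \<le> cmod (\<omega> x)" by (rule complex_Re_le_cmod)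
  also have "\<dots> \<le> cnorm A x" using \<omega> x by (simp add: quasi_states_def)
  also have "\<dots> \<le> 2 * onorm (\<pi> x)" by (rule faithful_rep_bounded_below[OF \<pi> x])
  finally show ?thesis using o unfolding \<phi>x by (simp add: algebra_simps)
qed

text \<open>The learner runs in B with the data \<open>\<eta> \<phi> (y j)\<close> and the targets \<open>\<eta> Re \<omega> (y j)\<close>.  Since the smoothness
  constant is of order \<open>log (rank B)\<close>, so is the number of its corrections.\<close>

lemma quasi_state_codes:
  fixes \<pi> :: "'a \<Rightarrow> 'h \<Rightarrow> 'h::chilbert_space"
  assumes \<pi>: "faithful_rep A \<pi>" and cpa: "(\<phi>, \<psi>, B) \<in> CPA A \<pi> Y (\<epsilon> / 8)"
    and y: "\<And>j. y j \<in> carr A" "\<And>j. cnorm A (y j) \<le> M" "\<And>j. j < m \<Longrightarrow> y j \<in> Y"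
    and \<epsilon>: "\<epsilon> > 0" and M: "M \<ge> 1"
    and K: "128 * M\<^sup>2 / \<epsilon>\<^sup>2 * (6 * ln (real (max 1 (rank_cstar B))) + 1) \<le> real K"
  obtains c :: "('a \<Rightarrow> complex) \<Rightarrow> nat \<Rightarrow> (real \<times> int) option" where
    "\<And>\<omega>. \<omega> \<in> quasi_states A \<Longrightarrow>
      c \<omega> \<in> sparse_functions m ({1, -1} \<times> {\<lfloor>- (M / \<epsilon>)\<rfloor>..\<lfloor>M / \<epsilon>\<rfloor>}) K"
    "\<And>\<omega> \<sigma> j. \<omega> \<in> quasi_states A \<Longrightarrow> \<sigma> \<in> quasi_states A \<Longrightarrow> c \<omega> = c \<sigma> \<Longrightarrow> j < m \<Longrightarrow>
      \<bar>Re (\<omega> (y j)) - Re (\<sigma> (y j))\<bar> \<le> 2 * \<epsilon>"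
proof -
  have fd: "finite_dim_cstar B" and \<phi>: "linear_map A B \<phi>"
    and \<phi>1: "\<And>a. a \<in> carr A \<Longrightarrow> cnorm B (\<phi> a) \<le> cnorm A a"
    using cpa by (auto simp: CPA_def cpc_map_def completely_positive_def)
  interpret B: cstar_algebra B using fd by (simp add: finite_dim_cstar_def)
  have \<phi>c: "\<phi> a \<in> carr B" if "a \<in> carr A" for a using \<phi> that by (auto simp: linear_map_def)
  obtain N L where L: "1 \<le> L" "L \<le> 6 * ln (real (max 1 (rank_cstar B))) + 1"
    and N0: "\<And>x. x \<in> carr B \<Longrightarrow> 0 \<le> N x"
    and Nlow: "\<And>x. x \<in> carr B \<Longrightarrow> cnorm B x \<le> 2 * N x"
    and Nup: "\<And>x. x \<in> carr B \<Longrightarrow> N x \<le> 2 * cnorm B x"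
    and Nsm: "\<And>x y. x \<in> carr B \<Longrightarrow> y \<in> carr B \<Longrightarrow>
      (N (x + y))\<^sup>2 + (N (x - y))\<^sup>2 \<le> 2 * ((N x)\<^sup>2 + L * (N y)\<^sup>2)"
    by (rule two_smooth_renorming[OF fd], rule that, assumption+)
  \<comment> \<open>This step size makes \<open>L\<close> times the squared norm of a datum at most \<open>\<theta> = \<eta> \<epsilon>\<close>.\<close>
  define \<eta> where "\<eta> = \<epsilon> / (4 * L * M\<^sup>2)"
  have \<eta>: "\<eta> > 0" using \<epsilon> L M by (simp add: \<eta>_def)
  define \<theta> where "\<theta> = \<eta> * \<epsilon>"
  have \<theta>: "\<theta> > 0" using \<eta> \<epsilon> by (simp add: \<theta>_def)
  define z where "z j = scaleC (of_real \<eta>) (\<phi> (y j))" for j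
  have z: "z j \<in> carr B" for j using \<phi>c[OF y(1)] by (simp add: z_def)
  have zN: "L * (N (z j))\<^sup>2 \<le> \<theta>" for j
  proof -
    have "cnorm B (z j) \<le> \<eta> * M"
      using \<phi>c[OF y(1)] \<phi>1[OF y(1), of j] y(2)[of j] \<eta> by (simp add: z_def B.norm_scale)
    then have "N (z j) \<le> 2 * (\<eta> * M)" using Nup[OF z[of j]] by linarith
    then have "(N (z j))\<^sup>2 \<le> (2 * (\<eta> * M))\<^sup>2" using N0[OF z] by (intro power_mono)
    then have "L * (N (z j))\<^sup>2 \<le> L * (2 * (\<eta> * M))\<^sup>2" using L by (intro mult_left_mono) auto
    also have "\<dots> = \<eta> * (\<eta> * (4 * L * M\<^sup>2))" by (simp add: power2_eq_square algebra_simps)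
    also have "\<eta> * (4 * L * M\<^sup>2) = \<epsilon>" using L M by (simp add: \<eta>_def)
    finally show ?thesis by (simp add: \<theta>_def)
  qed
  interpret S: smooth_learner "carr B" N \<theta> z
  proof
    show "N 0 = 0" using N0[of 0] Nup[of 0] by simp
    show "(N (x + z i))\<^sup>2 + (N (x - z i))\<^sup>2 \<le> 2 * (N x)\<^sup>2 + 2 * \<theta>" if "x \<in> carr B" for x i
      using Nsm[OF that z[of i]] zN[of i] by simp
  qed (use z \<theta> B.subspace in auto)
  define \<tau> where "\<tau> \<omega> j = \<eta> * Re (\<omega> (y j))" for \<omega> :: "'a \<Rightarrow> complex" and j
  have few: "card {i\<in>{..<m}. S.code (\<tau> \<omega>) i \<noteq> None} \<le> K" if \<omega>: "\<omega> \<in> quasi_states A" for \<omega>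
  proof -
    let ?n = "card {i\<in>{..<m}. S.code (\<tau> \<omega>) i \<noteq> None}"
    let ?Y = "S.hypothesis (\<tau> \<omega>) m"
    let ?s = "\<lambda>i. S.sg (\<tau> \<omega>) i"
    have hyp: "?Y = (\<Sum>i<m. scaleC (of_real (?s i * \<eta>)) (\<phi> (y i)))"
      by (subst S.hypothesis_sum) (simp add: z_def)
    have "(\<Sum>i<m. ?s i * \<tau> \<omega> i) = (\<Sum>i<m. (?s i * \<eta>) * Re (\<omega> (y i)))"
      by (simp add: \<tau>_def mult_ac)
    also have "\<dots> \<le> 2 * cnorm B ?Y + 2 * (\<epsilon> / 8) * (\<Sum>i<m. \<bar>?s i * \<eta>\<bar>)"
      unfolding hyp using y by (intro approximation_dual_bound[OF \<pi> cpa _ \<omega>]) auto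
    also have "2 * (\<epsilon> / 8) * (\<Sum>i<m. \<bar>?s i * \<eta>\<bar>) = \<theta> / 4 * (\<Sum>i<m. \<bar>?s i\<bar>)"
      using \<eta> by (simp add: \<theta>_def abs_mult sum_distrib_left sum_distrib_right mult_ac)
    also have "2 * cnorm B ?Y \<le> 4 * N ?Y"
      using Nlow[OF S.hypothesis_closed] by simp
    finally have "\<theta> * real ?n \<le> 2 * 4\<^sup>2"
      by (intro S.few_corrections) simp
    then have "real ?n \<le> 32 / \<theta>"
      using \<theta> by (simp add: field_simps)
    also have "32 / \<theta> = 128 * M\<^sup>2 / \<epsilon>\<^sup>2 * L"
      using \<epsilon> L M by (simp add: \<theta>_def \<eta>_def power2_eq_square)
    also have "\<dots> \<le> 128 * M\<^sup>2 / \<epsilon>\<^sup>2 * (6 * ln (real (max 1 (rank_cstar B))) + 1)"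
      using L(2) by (intro mult_left_mono) auto
    finally have "real ?n \<le> real K" using K by linarith
    then show ?thesis by simp
  qed
  have lab: "S.code (\<tau> \<omega>) j \<in> insert None (Some ` ({1, -1} \<times> {\<lfloor>- (M / \<epsilon>)\<rfloor>..\<lfloor>M / \<epsilon>\<rfloor>}))"
    if \<omega>: "\<omega> \<in> quasi_states A" for \<omega> j
  proof (rule S.code_in)
    have "\<bar>Re (\<omega> (y j))\<bar> \<le> cmod (\<omega> (y j))" by (rule abs_Re_le_cmod)
    also have "\<dots> \<le> cnorm A (y j)" using \<omega> y(1) by (simp add: quasi_states_def)
    finally have "\<bar>Re (\<omega> (y j))\<bar> \<le> M" using y(2)[of j] by linarith
    then show "\<bar>\<tau> \<omega> j\<bar> \<le> \<theta> * (M / \<epsilon>)"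
      using \<eta> \<epsilon> by (simp add: \<tau>_def \<theta>_def abs_mult)
  qed
  show thesis
  proof (rule that[of "\<lambda>\<omega>. restrict (S.code (\<tau> \<omega>)) {..<m}"], goal_cases)
    case (1 \<omega>)
    have "{i\<in>{..<m}. restrict (S.code (\<tau> \<omega>)) {..<m} i \<noteq> None} = {i\<in>{..<m}. S.code (\<tau> \<omega>) i \<noteq> None}"
      by auto
    then show ?case using few[OF 1] lab[OF 1] unfolding sparse_functions_def by (simp only: mem_Collect_eq restrict_PiE_iff) auto
  next
    case (2 \<omega> \<sigma> j)
    have "S.code (\<tau> \<omega>) i = S.code (\<tau> \<sigma>) i" if "i < m" for i
      using fun_cong[OF 2(3), of i] that by simp
    then have "\<bar>\<tau> \<omega> j - \<tau> \<sigma> j\<bar> \<le> 2 * \<theta>" using 2(4) by (rule S.close_if_same_code)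
    then have "\<eta> * \<bar>Re (\<omega> (y j)) - Re (\<sigma> (y j))\<bar> \<le> \<eta> * (2 * \<epsilon>)"
      using \<eta> by (simp add: \<tau>_def \<theta>_def flip: right_diff_distrib) (simp add: abs_mult mult_ac)
    then show ?case using \<eta> by simp
  qed
qed

text \<open>The quasi-states with a given code are close to each other along the first n steps of the orbit, so
  they lie in one member of the iterated cover.  The set D also contains the elements \<open>- i x\<close>, because
  the imaginary part of \<open>\<omega> x\<close> is the real part of \<open>\<omega> (- i x)\<close>.\<close>

lemma min_subcover_bound:
  fixes \<pi> :: "'a \<Rightarrow> 'h \<Rightarrow> 'h::chilbert_space"
  assumes \<alpha>: "cstar_automorphism A \<alpha>" and \<pi>: "faithful_rep A \<pi>"
    and F: "\<And>\<sigma>. \<sigma> \<in> quasi_states A \<Longrightarrow>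
      \<exists>u\<in>U. \<forall>\<omega>\<in>quasi_states A. (\<forall>x\<in>F. cmod (\<omega> x - \<sigma> x) < e) \<longrightarrow> \<omega> \<in> u"
    and D: "finite D" "D \<subseteq> carr A" "D \<noteq> {}" "\<And>x. x \<in> F \<Longrightarrow> x \<in> D \<and> scaleC (- \<i>) x \<in> D"
    and M: "M \<ge> 1" "\<And>x. x \<in> D \<Longrightarrow> cnorm A x \<le> M" and e: "e > 0" and n: "n > 0"
    and cpa: "(\<phi>, \<psi>, B) \<in> CPA A \<pi> (\<Union>i<n. (\<alpha> ^^ i) ` D) (e / 5 / 8)"
    and K: "128 * M\<^sup>2 / (e / 5)\<^sup>2 * (6 * ln (real (max 1 (rank_cstar B))) + 1) \<le> real K"
    and t: "0 < t" "t \<le> 1"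
  shows "real (min_subcover (quasi_state_space A)
      (cover_join n (\<lambda>i. pullback_cover (quasi_state_space A) (induced_map A \<alpha> ^^ i) U)))
    \<le> (1 / t) ^ K * exp (t * real (n * card D) * real (card ({1::real, -1} \<times> {\<lfloor>- (M / (e / 5))\<rfloor>..\<lfloor>M / (e / 5)\<rfloor>})))"
    (is "real (min_subcover ?X ?J) \<le> (1 / t) ^ K * exp (t * real ?m * real (card ?\<Lambda>))")
proof -
  let ?Q = "quasi_states A" and ?\<epsilon> = "e / 5" and ?q = "card D" and ?T = "induced_map A \<alpha>"
  have q: "?q > 0" using D by (simp add: card_gt_0_iff)
  obtain g where g: "bij_betw g {0..<?q} D" using ex_bij_betw_nat_finite[OF D(1)] by blast
  \<comment> \<open>The index \<open>j = i * card D + k\<close> stands for the \<open>i\<close>-th iterate at the \<open>k\<close>-th element of \<open>D\<close>.\<close>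
  define y where "y j = (\<alpha> ^^ (j div ?q)) (g (j mod ?q))" for j
  have gD: "g (j mod ?q) \<in> D" for j using g q by (auto simp: bij_betw_def)
  then have gA: "g (j mod ?q) \<in> carr A" for j using D by blast
  have yY: "y j \<in> (\<Union>i<n. (\<alpha> ^^ i) ` D)" if "j < ?m" for j
    unfolding y_def using that
    by (intro UN_I[of "j div ?q"] imageI gD) (simp add: less_mult_imp_div_less)
  have y: "y j \<in> carr A" "cnorm A (y j) \<le> M" for j
    unfolding y_def
    by (rule automorphism_iterate(1)[OF \<alpha> gA gA],
        rule order_trans[OF automorphism_iterate(4)[OF \<alpha> gA gA] M(2)[OF gD]])
  have "?\<epsilon> > 0" using e by simp
  note codes = quasi_state_codes[OF \<pi> cpa y _ this M(1) K]
  obtain c where c: "\<And>\<omega>. \<omega> \<in> ?Q \<Longrightarrow>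
      c \<omega> \<in> sparse_functions ?m ?\<Lambda> K"
    and close: "\<And>\<omega> \<sigma> j. \<omega> \<in> ?Q \<Longrightarrow> \<sigma> \<in> ?Q \<Longrightarrow> c \<omega> = c \<sigma> \<Longrightarrow> j < ?m \<Longrightarrow>
      \<bar>Re (\<omega> (y j)) - Re (\<sigma> (y j))\<bar> \<le> 2 * ?\<epsilon>"
    by (rule codes, rule yY, assumption, rule that, assumption+)
  have closeD: "\<bar>Re (\<omega> ((\<alpha> ^^ i) x)) - Re (\<sigma> ((\<alpha> ^^ i) x))\<bar> \<le> 2 * ?\<epsilon>"
    if "\<omega> \<in> ?Q" "\<sigma> \<in> ?Q" "c \<omega> = c \<sigma>" "i < n" "x \<in> D" for \<omega> \<sigma> i x
  proof -
    have "x \<in> g ` {0..<?q}" using g \<open>x \<in> D\<close> by (simp add: bij_betw_def)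
    then obtain k where k: "k < ?q" "x = g k" by auto
    have "i * ?q + k < Suc i * ?q" using k(1) by simp
    also have "\<dots> \<le> n * ?q" using \<open>i < n\<close> by (intro mult_right_mono) auto
    finally have "i * ?q + k < ?m" .
    moreover have "y (i * ?q + k) = (\<alpha> ^^ i) x" using k by (simp add: y_def)
    ultimately show ?thesis using close[OF that(1-3)] by metis
  qed
  have same: "cmod (\<omega> ((\<alpha> ^^ i) x) - \<sigma> ((\<alpha> ^^ i) x)) < e"
    if h: "\<omega> \<in> ?Q" "\<sigma> \<in> ?Q" "c \<omega> = c \<sigma>" "i < n" and x: "x \<in> F" for \<omega> \<sigma> i x
  proof -
    have xD: "x \<in> D" "scaleC (- \<i>) x \<in> D" and xA: "x \<in> carr A" using D x by auto
    have im: "Re (\<rho> ((\<alpha> ^^ i) (scaleC (- \<i>) x))) = Im (\<rho> ((\<alpha> ^^ i) x))" if "\<rho> \<in> ?Q" for \<rho>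
    proof -
      have "(\<alpha> ^^ i) x \<in> carr A" using automorphism_iterate(1)[OF \<alpha> xA xA] .
      then have "\<rho> ((\<alpha> ^^ i) (scaleC (- \<i>) x)) = - \<i> * \<rho> ((\<alpha> ^^ i) x)"
        unfolding automorphism_iterate(3)[OF \<alpha> xA xA] using that unfolding quasi_states_def by blast
      then show ?thesis by simp
    qed
    have "cmod (\<omega> ((\<alpha> ^^ i) x) - \<sigma> ((\<alpha> ^^ i) x))
        \<le> \<bar>Re (\<omega> ((\<alpha> ^^ i) x) - \<sigma> ((\<alpha> ^^ i) x))\<bar> + \<bar>Im (\<omega> ((\<alpha> ^^ i) x) - \<sigma> ((\<alpha> ^^ i) x))\<bar>"
      by (rule cmod_le)
    also have "\<dots> \<le> 2 * ?\<epsilon> + 2 * ?\<epsilon>"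
      using closeD[OF h xD(1)] closeD[OF h xD(2)] unfolding im[OF h(1)] im[OF h(2)]
      by (intro add_mono) simp_all
    also have "\<dots> < e" using e by simp
    finally show ?thesis .
  qed
  have "min_subcover ?X ?J \<le> card (sparse_functions ?m ?\<Lambda> K)"
  proof (rule min_subcover_le_card[where c = c])
    show "finite (sparse_functions ?m ?\<Lambda> K)" by (rule finite_sparse_functions) simp
    show "W \<subseteq> topspace ?X" if "W \<in> ?J" for W
      using that n by (fastforce simp: cover_join_def pullback_cover_def)
    fix \<sigma> assume "\<sigma> \<in> topspace ?X"
    then have \<sigma>: "\<sigma> \<in> ?Q" by simp
    have "\<forall>i. \<exists>u\<in>U. \<forall>\<omega>\<in>?Q. (\<forall>x\<in>F. cmod (\<omega> x - (?T ^^ i) \<sigma> x) < e) \<longrightarrow> \<omega> \<in> u"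
      using F induced_map_iterate(1)[OF \<alpha> \<sigma>] by blast
    then obtain u where u: "\<And>i. u i \<in> U"
      "\<And>i \<omega>. \<omega> \<in> ?Q \<Longrightarrow> (\<forall>x\<in>F. cmod (\<omega> x - (?T ^^ i) \<sigma> x) < e) \<Longrightarrow> \<omega> \<in> u i" by metis
    define W where "W = (\<Inter>i<n. {\<omega> \<in> topspace ?X. (?T ^^ i) \<omega> \<in> u i})"
    have cell: "\<omega> \<in> W" if \<omega>: "\<omega> \<in> ?Q" "c \<omega> = c \<sigma>" for \<omega>
    proof -
      have "(?T ^^ i) \<omega> \<in> u i" if i: "i < n" for i
      proof (rule u(2))
        show "\<forall>x\<in>F. cmod ((?T ^^ i) \<omega> x - (?T ^^ i) \<sigma> x) < e"
        proof
          fix x assume x: "x \<in> F"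
          then have "x \<in> carr A" using D by blast
          then show "cmod ((?T ^^ i) \<omega> x - (?T ^^ i) \<sigma> x) < e"
            using same[OF \<omega>(1) \<sigma> \<omega>(2) i x] by (simp add: induced_map_iterate(2)[OF \<alpha>] \<omega> \<sigma>)
        qed
      qed (rule induced_map_iterate(1)[OF \<alpha> \<omega>(1)])
      then show ?thesis using \<omega> by (auto simp: W_def)
    qed
    moreover have "W \<in> ?J"
    proof -
      have "\<forall>i<n. {\<omega> \<in> topspace ?X. (?T ^^ i) \<omega> \<in> u i} \<in> pullback_cover ?X (?T ^^ i) U"
        using u(1) by (auto simp: pullback_cover_def)
      then have "W \<in> {\<Inter>i<n. v i | v. \<forall>i<n. v i \<in> pullback_cover ?X (?T ^^ i) U}"
        unfolding W_def by blast
      moreover have "W \<noteq> {}" using cell[OF \<sigma>] by auto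
      ultimately show ?thesis by (simp add: cover_join_def)
    qed
    ultimately show "\<exists>W\<in>?J. \<forall>\<omega>\<in>topspace ?X. c \<omega> = c \<sigma> \<longrightarrow> \<omega> \<in> W" by auto
  qed (use c in simp)
  also have "real \<dots> \<le> (1 / t) ^ K * exp (t * real ?m * real (card ?\<Lambda>))"
    by (rule card_sparse_functions_le[OF _ t]) simp
  finally show ?thesis by simp
qed

lemma rcp_attained:
  fixes \<pi> :: "'a \<Rightarrow> 'h \<Rightarrow> 'h::chilbert_space"
  assumes "log_enat (rcp A \<pi> Y \<delta>) / ereal (real n) < ereal \<beta>" and n: "n > 0" and \<beta>: "\<beta> > 0"
  obtains \<phi> \<psi> B where "(\<phi>, \<psi>, B) \<in> CPA A \<pi> Y \<delta>" "ln (real (max 1 (rank_cstar B))) \<le> \<beta> * real n"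
proof -
  obtain k where k: "rcp A \<pi> Y \<delta> = enat k"
    using assms(1) n by (cases "rcp A \<pi> Y \<delta>") (auto simp: log_enat_def)
  then have "ln (real k) < \<beta> * real n"
    using assms(1) n by (simp add: log_enat_def field_simps)
  then have lk: "ln (real (max 1 k)) \<le> \<beta> * real n"
    using \<beta> by (cases "k = 0") (auto simp: max_def)
  have "(INF (\<phi>, \<psi>, B) \<in> CPA A \<pi> Y \<delta>. enat (rank_cstar B)) < enat (Suc k)"
    using k by (simp add: rcp_def)
  then obtain \<phi> \<psi> B where B: "(\<phi>, \<psi>, B) \<in> CPA A \<pi> Y \<delta>" "rank_cstar B < Suc k"
    by (auto simp: INF_less_iff)
  have "ln (real (max 1 (rank_cstar B))) \<le> ln (real (max 1 k))"
    using B(2) by (subst ln_le_cancel_iff) auto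
  from that[OF B(1) order_trans[OF this lk]] show thesis .
qed

end

section \<open>Vanishing of the topological entropy\<close>

text \<open>With \<open>h n\<close> the size of a minimal subcover, \<open>log (h n) \<le> K log (1 / t) + t m l\<close>, where m is proportional to
  n, the number l of labels does not depend on n, and K is at most of order \<open>\<beta> n\<close> as soon as the rank is
  at most \<open>exp (\<beta> n)\<close>.  First t is chosen to make the second term small, then \<open>\<beta>\<close> for the first term.\<close>

lemma htop_cover_quasi_states_eq_0:
  fixes A :: "'a::complex_vector cstar" and \<pi> :: "'a \<Rightarrow> 'h \<Rightarrow> 'h::chilbert_space"
  assumes A: "cstar_algebra A" and \<pi>: "faithful_rep A \<pi>" and \<alpha>: "cstar_automorphism A \<alpha>"
    and ht: "ht A \<pi> \<alpha> = 0" and U: "finite_open_cover (quasi_state_space A) U"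
  shows "htop_cover (quasi_state_space A) (induced_map A \<alpha>) U = 0"
proof -
  interpret cstar_algebra A by fact
  obtain F e where F: "finite F" "F \<subseteq> carr A" and e: "e > 0"
    and Leb: "\<And>\<sigma>. \<sigma> \<in> quasi_states A \<Longrightarrow>
      \<exists>u\<in>U. \<forall>\<omega>\<in>quasi_states A. (\<forall>x\<in>F. cmod (\<omega> x - \<sigma> x) < e) \<longrightarrow> \<omega> \<in> u"
    using quasi_state_Lebesgue_number[OF A U] by blast
  \<comment> \<open>The element 0 keeps \<open>D\<close> nonempty when \<open>F\<close> is empty.\<close>
  define D where "D = insert 0 (F \<union> scaleC (- \<i>) ` F)"
  have D: "finite D" "D \<subseteq> carr A" "D \<noteq> {}" "\<And>x. x \<in> F \<Longrightarrow> x \<in> D \<and> scaleC (- \<i>) x \<in> D"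
    using F by (auto simp: D_def)
  define M where "M = Max (insert 1 (cnorm A ` D))"
  have M: "M \<ge> 1" "\<And>x. x \<in> D \<Longrightarrow> cnorm A x \<le> M"
    unfolding M_def by (rule Max_ge; use D(1) in auto)+
  define C where "C = 128 * M\<^sup>2 / (e / 5)\<^sup>2"
  have C: "C > 0" using M e by (simp add: C_def)
  define l where "l = real (card ({1::real, -1} \<times> {\<lfloor>- (M / (e / 5))\<rfloor>..\<lfloor>M / (e / 5)\<rfloor>}))"
  have l: "l \<ge> 0" by (simp add: l_def)
  define h where "h n = min_subcover (quasi_state_space A)
      (cover_join n (\<lambda>i. pullback_cover (quasi_state_space A) (induced_map A \<alpha> ^^ i) U))" for n
  have "(\<lambda>n. ln (real (h n)) / real n) \<longlonglongrightarrow> 0"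
  proof (rule LIMSEQ_I)
    fix \<gamma> :: real assume \<gamma>: "\<gamma> > 0"
    define t where "t = min 1 (\<gamma> / (4 * (real (card D) * l + 1)))"
    have p: "real (card D) * l + 1 > 0" using l by (intro add_nonneg_pos mult_nonneg_nonneg) auto
    have t: "0 < t" "t \<le> 1" using \<gamma> p by (auto simp: t_def)
    have tl: "t * (real (card D) * l) \<le> \<gamma> / 4"
    proof -
      have "t * (real (card D) * l) \<le> t * (real (card D) * l + 1)" using t by simp
      also have "\<dots> \<le> \<gamma> / (4 * (real (card D) * l + 1)) * (real (card D) * l + 1)"
        using p by (intro mult_right_mono) (auto simp: t_def)
      also have "\<dots> = \<gamma> / 4" using p by (simp add: field_simps)
      finally show ?thesis .
    qed
    define b where "b = ln (1 / t)"
    have b: "b \<ge> 0" using t by (simp add: b_def)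
    define \<beta> where "\<beta> = \<gamma> / (24 * C * (b + 1))"
    have \<beta>: "\<beta> > 0" using \<gamma> C b by (simp add: \<beta>_def)
    have \<beta>b: "6 * C * \<beta> * b \<le> \<gamma> / 4"
    proof -
      have "6 * C * \<beta> * b \<le> 6 * C * \<beta> * (b + 1)" using C \<beta> b by (intro mult_left_mono) auto
      also have "\<dots> = \<gamma> / 4"
      proof -
        obtain w where w: "w = b + 1" "w > 0" using b by simp
        show ?thesis unfolding \<beta>_def w(1)[symmetric] using C w(2) by (simp add: field_simps)
      qed
      finally show ?thesis .
    qed
    have "ht_local A \<pi> \<alpha> D (e / 5 / 8) \<le> ht A \<pi> \<alpha>"
      unfolding ht_def using D e by (intro SUP_upper2[of D] SUP_upper) auto
    then have "limsup (\<lambda>n. log_enat (rcp A \<pi> (\<Union>i<n. (\<alpha> ^^ i) ` D) (e / 5 / 8)) / ereal (real n)) < ereal \<beta>"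
      using ht \<beta> unfolding ht_local_def by (simp add: order_le_less_trans)
    from Limsup_lessD[OF this] obtain N1 where
      N1: "\<And>n. n \<ge> N1 \<Longrightarrow> log_enat (rcp A \<pi> (\<Union>i<n. (\<alpha> ^^ i) ` D) (e / 5 / 8)) / ereal (real n) < ereal \<beta>"
      unfolding eventually_sequentially by blast
    obtain N2 :: nat where N2: "4 * (C + 1) * b / \<gamma> < real N2" using reals_Archimedean2 by blast
    have "norm (ln (real (h n)) / real n - 0) < \<gamma>" if n: "n \<ge> max 1 (max N1 N2)" for n
    proof -
      have n0: "n > 0" using n by simp
      obtain \<phi> \<psi> B where cpa: "(\<phi>, \<psi>, B) \<in> CPA A \<pi> (\<Union>i<n. (\<alpha> ^^ i) ` D) (e / 5 / 8)"
        and rk: "ln (real (max 1 (rank_cstar B))) \<le> \<beta> * real n"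
        using rcp_attained[OF N1 n0 \<beta>] n by auto
      let ?r = "ln (real (max 1 (rank_cstar B)))"
      define K where "K = nat \<lceil>C * (6 * ?r + 1)\<rceil>"
      have K: "C * (6 * ?r + 1) \<le> real K"
        unfolding K_def by (rule real_nat_ceiling_ge)
      have ln0: "0 \<le> ?r" by (rule ln_ge_zero) simp
      then have "0 \<le> C * (6 * ?r + 1)" using C by simp
      then have "real K \<le> C * (6 * ?r + 1) + 1"
        unfolding K_def by linarith
      also have "\<dots> \<le> C * (6 * (\<beta> * real n) + 1) + 1" using C rk by simp
      finally have Kb: "real K \<le> 6 * C * \<beta> * real n + (C + 1)" by (simp add: algebra_simps)
      have "real (h n) \<le> (1 / t) ^ K * exp (t * real (n * card D) * l)"
        unfolding h_def l_def
        by (rule min_subcover_bound[OF \<alpha> \<pi> Leb D M e n0 cpa K[unfolded C_def] t])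
      moreover have "0 < (1 / t) ^ K * exp (t * real (n * card D) * l)" using t by simp
      ultimately have "ln (real (h n)) \<le> ln ((1 / t) ^ K * exp (t * real (n * card D) * l))"
        if "h n \<noteq> 0" using that by (subst ln_le_cancel_iff) auto
      moreover have "ln ((1 / t) ^ K * exp (t * real (n * card D) * l)) = real K * b + real n * (t * (real (card D) * l))"
        using t by (simp add: ln_mult ln_realpow b_def mult_ac)
      ultimately have "ln (real (h n)) \<le> real K * b + real n * (t * (real (card D) * l))"
      proof (cases "h n = 0")
        case True
        then show ?thesis using b t l by simp
      qed linarith
      also have "\<dots> \<le> (6 * C * \<beta> * real n + (C + 1)) * b + real n * (\<gamma> / 4)"
        using Kb b tl by (intro add_mono mult_right_mono mult_left_mono) auto
      also have "\<dots> = real n * (6 * C * \<beta> * b) + (C + 1) * b + real n * (\<gamma> / 4)" by (simp add: algebra_simps)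
      also have "\<dots> \<le> real n * (\<gamma> / 4) + real n * (\<gamma> / 4) + real n * (\<gamma> / 4)"
      proof (intro add_mono mult_left_mono \<beta>b)
        have "4 * (C + 1) * b / \<gamma> < real n" using N2 n by linarith
        then show "(C + 1) * b \<le> real n * (\<gamma> / 4)" using \<gamma> by (simp add: field_simps)
      qed auto
      also have "\<dots> < real n * \<gamma>" using n0 \<gamma> by simp
      finally have "ln (real (h n)) / real n < \<gamma>" using n0 by (simp add: field_simps)
      moreover have "0 \<le> ln (real (h n)) / real n" by (cases "h n = 0") auto
      ultimately show ?thesis by simp
    qed
    then show "\<exists>N. \<forall>n\<ge>N. norm (ln (real (h n)) / real n - 0) < \<gamma>" by blast
  qed
  then show ?thesis unfolding htop_cover_def h_def by (rule limI)
qed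

theorem theorem4p2:
  fixes A :: "'a::complex_vector cstar"
    and \<pi> :: "'a \<Rightarrow> 'h \<Rightarrow> 'h::chilbert_space"
    and \<alpha> :: "'a \<Rightarrow> 'a"
  assumes "cstar_algebra A"
    and "separable_cstar A"
    and "exact_cstar TYPE('k::chilbert_space) A"
    and "faithful_rep A \<pi>"
    and "cstar_automorphism A \<alpha>"
    and "ht A \<pi> \<alpha> = 0"
  shows "htop (quasi_state_space A) (induced_map A \<alpha>) = 0"
proof -
  let ?X = "quasi_state_space A"
  have "finite_open_cover ?X {topspace ?X}" by (simp add: finite_open_cover_def del: topspace_quasi_state_space)
  then have ne: "{U. finite_open_cover ?X U} \<noteq> {}" by blast
  have "ereal (htop_cover ?X (induced_map A \<alpha>) U) = 0" if "finite_open_cover ?X U" for U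
    using htop_cover_quasi_states_eq_0[OF assms(1,4,5,6) that] by simp
  then have "htop ?X (induced_map A \<alpha>) = (SUP U\<in>{U. finite_open_cover ?X U}. 0)"
    unfolding htop_def by (intro SUP_cong) auto
  then show ?thesis using SUP_const[OF ne] by simp
qed

end
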